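(* Let $G$ be a compact second countable abelian group with Haar measure $\mu$, let $f\in C(G)\setminus A(G)$ and let $\varphi:G\times G\to\mathbb{C}$, $\varphi(s,t)=f(s-t)$. Then $\varphi$ is $\omega$-continuous but is not a w*-closable multiplier.
   Context: $A(G)$ is the Fourier algebra of $G$, i.e. the image of $L^1(\hat G)$ under Fourier transform, where $\hat G$ is the dual group. On $G\times G$: a rectangle is a set $\alpha\times\beta$ with $\alpha,\beta\subseteq G$ measurable; a set is marginally null if it is contained in $(X_0\times G)\cup(G\times Y_0)$ with $\mu(X_0)=\mu(Y_0)=0$; a set is $\omega$-open if its symmetric difference with some countable union of rectangles is marginally null. A measurable function $g:G\times G\to\mathbb{C}$ is $\omega$-continuous if $g^{-1}(U)$ is $\omega$-open for every open $U\subseteq\mathbb{C}$. Let $H=L^2(G)$; for $k\in L^2(G\times G)$ let $I_k:H\to H$, $(I_k\xi)(y)=\int_Gk(x,y)\xi(x)\,d\mu(x)$. For measurable $\varphi$ let $D(\varphi)=\{k\in L^2(G\times G):\varphi k\in L^2(G\times G)\}$ and let $S_\varphi$ be the densely defined operator on the space $\mathcal{K}(H)$ of compact operators with domain $\{I_k:k\in D(\varphi)\}$, $S_\varphi(I_k)=I_{\varphi k}$; $\varphi$ is a w*-closable multiplier if the weak* closure of the graph of $S_\varphi$ in $\mathcal{K}(H)^{**}\oplus\mathcal{K}(H)^{**}=\mathcal{B}(H)\oplus\mathcal{B}(H)$ is the graph of an operator. *)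

theory Defs
  imports "HOL-Analysis.Analysis"
begin

section \<open>Haar measure, dual group, Fourier algebra\<close>

text \<open>
  The group is given by a topology \<open>T\<close>, with carrier \<open>topspace T\<close>, and its operation \<open>m\<close>, so that
  the notion applies both to a group type and to its dual group, a set of functions. A Haar measure
  is a nonzero, translation invariant Radon measure on the Borel sets; it is not normalised.
\<close>

definition haar_measure :: "'a topology \<Rightarrow> ('a \<Rightarrow> 'a \<Rightarrow> 'a) \<Rightarrow> 'a measure \<Rightarrow> bool" where
  "haar_measure T m M \<longleftrightarrow>
     space M = topspace T \<and>
     sets M = sigma_sets (topspace T) {U. openin T U} \<and>
     emeasure M (topspace T) \<noteq> 0 \<and>
     (\<forall>K. compactin T K \<longrightarrow> emeasure M K < \<infinity>) \<and>
     (\<forall>A\<in>sets M. emeasure M A = (INF U\<in>{U. openin T U \<and> A \<subseteq> U}. emeasure M U)) \<and>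
     (\<forall>U. openin T U \<longrightarrow>
        emeasure M U = (SUP K\<in>{K. compactin T K \<and> K \<subseteq> U}. emeasure M K)) \<and>
     (\<forall>a\<in>topspace T. \<forall>A\<in>sets M. emeasure M (m a ` A) = emeasure M A)"

definition characters :: "('g::topological_ab_group_add \<Rightarrow> complex) set" where
  "characters = {\<gamma>. continuous_on UNIV \<gamma> \<and> (\<forall>x. norm (\<gamma> x) = 1) \<and>
                     (\<forall>x y. \<gamma> (x + y) = \<gamma> x * \<gamma> y)}"

definition dual_topology :: "('g::topological_ab_group_add \<Rightarrow> complex) topology" where
  "dual_topology =
     subtopology (topology_generated_by {{h. h ` K \<subseteq> U} | K U. compact K \<and> open U}) characters"

definition dual_mult ::
    "('g \<Rightarrow> complex) \<Rightarrow> ('g \<Rightarrow> complex) \<Rightarrow> 'g \<Rightarrow> complex" where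
  "dual_mult \<gamma> \<psi> = (\<lambda>x. \<gamma> x * \<psi> x)"

definition fourier_transform ::
    "('g \<Rightarrow> complex) measure \<Rightarrow> (('g \<Rightarrow> complex) \<Rightarrow> complex) \<Rightarrow> 'g \<Rightarrow> complex" where
  "fourier_transform \<nu> h = (\<lambda>x. \<integral>\<gamma>. h \<gamma> * cnj (\<gamma> x) \<partial>\<nu>)"

text \<open>
  The Haar measure of the dual group is unique up to a positive factor, which does not affect the
  image of \<open>L\<^sup>1\<close>, so the existential quantifier over \<open>\<nu>\<close> amounts to fixing any Haar measure.
\<close>

definition fourier_algebra :: "('g::topological_ab_group_add \<Rightarrow> complex) set" where
  "fourier_algebra = {fourier_transform \<nu> h | \<nu> h.
     haar_measure dual_topology dual_mult \<nu> \<and> integrable \<nu> h}"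

section \<open>Sets and functions modulo marginally null sets\<close>

definition marginally_null :: "'a measure \<Rightarrow> ('a \<times> 'a) set \<Rightarrow> bool" where
  "marginally_null M E \<longleftrightarrow>
     (\<exists>X\<in>null_sets M. \<exists>Y\<in>null_sets M. E \<subseteq> (X \<times> space M) \<union> (space M \<times> Y))"

definition rectangles :: "'a measure \<Rightarrow> ('a \<times> 'a) set set" where
  "rectangles M = {A \<times> B | A B. A \<in> sets M \<and> B \<in> sets M}"

definition omega_open :: "'a measure \<Rightarrow> ('a \<times> 'a) set \<Rightarrow> bool" where
  "omega_open M E \<longleftrightarrow>
     (\<exists>R. countable R \<and> R \<subseteq> rectangles M \<and> marginally_null M (sym_diff E (\<Union>R)))"

definition omega_continuous :: "'a measure \<Rightarrow> ('a \<times> 'a \<Rightarrow> complex) \<Rightarrow> bool" where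
  "omega_continuous M g \<longleftrightarrow> g \<in> borel_measurable (M \<Otimes>\<^sub>M M) \<and>
     (\<forall>U. open U \<longrightarrow> omega_open M (g -` U \<inter> space (M \<Otimes>\<^sub>M M)))"

section \<open>Operators on \<open>L\<^sup>2\<close> and the weak* topology\<close>

text \<open>
  Elements of \<open>L\<^sup>2(M)\<close> are represented by square integrable functions, and operators by maps between
  such functions. Equality in \<open>L\<^sup>2(M)\<close> is equality almost everywhere, and equality of operators is
  \<open>op_eq\<close>; values of an operator outside \<open>L2 M\<close> are irrelevant.
\<close>

definition L2 :: "'a measure \<Rightarrow> ('a \<Rightarrow> complex) set" where
  "L2 M = {\<xi>. \<xi> \<in> borel_measurable M \<and> integrable M (\<lambda>x. (norm (\<xi> x))\<^sup>2)}"

definition l2_norm :: "'a measure \<Rightarrow> ('a \<Rightarrow> complex) \<Rightarrow> real" where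
  "l2_norm M \<xi> = sqrt (\<integral>x. (norm (\<xi> x))\<^sup>2 \<partial>M)"

definition l2_inner :: "'a measure \<Rightarrow> ('a \<Rightarrow> complex) \<Rightarrow> ('a \<Rightarrow> complex) \<Rightarrow> complex" where
  "l2_inner M \<xi> \<eta> = (\<integral>x. \<xi> x * cnj (\<eta> x) \<partial>M)"

type_synonym 'a l2_op = "('a \<Rightarrow> complex) \<Rightarrow> ('a \<Rightarrow> complex)"

definition bounded_op :: "'a measure \<Rightarrow> 'a l2_op \<Rightarrow> bool" where
  "bounded_op M T \<longleftrightarrow>
     (\<forall>\<xi>\<in>L2 M. T \<xi> \<in> L2 M) \<and>
     (\<forall>\<xi>\<in>L2 M. \<forall>\<eta>\<in>L2 M. (AE x in M. \<xi> x = \<eta> x) \<longrightarrow> (AE x in M. T \<xi> x = T \<eta> x)) \<and>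
     (\<forall>\<xi>\<in>L2 M. \<forall>\<eta>\<in>L2 M. AE x in M. T (\<lambda>y. \<xi> y + \<eta> y) x = T \<xi> x + T \<eta> x) \<and>
     (\<forall>c. \<forall>\<xi>\<in>L2 M. AE x in M. T (\<lambda>y. c * \<xi> y) x = c * T \<xi> x) \<and>
     (\<exists>C. \<forall>\<xi>\<in>L2 M. l2_norm M (T \<xi>) \<le> C * l2_norm M \<xi>)"

definition op_eq :: "'a measure \<Rightarrow> 'a l2_op \<Rightarrow> 'a l2_op \<Rightarrow> bool" where
  "op_eq M T S \<longleftrightarrow> (\<forall>\<xi>\<in>L2 M. AE x in M. T \<xi> x = S \<xi> x)"

text \<open>
  The dual of the space of compact operators is the trace class, whose elements are the sums
  \<open>A = (\<Sum>n. \<xi> n \<otimes> (\<eta> n)\<^sup>*)\<close> with \<open>(\<Sum>n. \<parallel>\<xi> n\<parallel>\<^sup>2) < \<infinity>\<close> and \<open>(\<Sum>n. \<parallel>\<eta> n\<parallel>\<^sup>2) < \<infinity>\<close>, and a bounded operator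
  \<open>T\<close>, as an element of the bidual, acts on \<open>A\<close> by \<open>tr (T A) = (\<Sum>n. \<langle>T (\<xi> n), \<eta> n\<rangle>)\<close>.
\<close>

definition square_summable :: "'a measure \<Rightarrow> (nat \<Rightarrow> 'a \<Rightarrow> complex) \<Rightarrow> bool" where
  "square_summable M \<xi> \<longleftrightarrow> (\<forall>n. \<xi> n \<in> L2 M) \<and> summable (\<lambda>n. (l2_norm M (\<xi> n))\<^sup>2)"

definition trace_pairing ::
    "'a measure \<Rightarrow> (nat \<Rightarrow> 'a \<Rightarrow> complex) \<Rightarrow> (nat \<Rightarrow> 'a \<Rightarrow> complex) \<Rightarrow> 'a l2_op \<Rightarrow> complex" where
  "trace_pairing M \<xi> \<eta> T = (\<Sum>n. l2_inner M (T (\<xi> n)) (\<eta> n))"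

definition weak_star_topology :: "'a measure \<Rightarrow> 'a l2_op topology" where
  "weak_star_topology M = topology_generated_by
     {{T. bounded_op M T \<and> trace_pairing M \<xi> \<eta> T \<in> U} | \<xi> \<eta> U.
        square_summable M \<xi> \<and> square_summable M \<eta> \<and> open U}"

section \<open>Closable multipliers\<close>

definition integral_op :: "'a measure \<Rightarrow> ('a \<times> 'a \<Rightarrow> complex) \<Rightarrow> 'a l2_op" where
  "integral_op M k \<xi> = (\<lambda>y. \<integral>x. k (x, y) * \<xi> x \<partial>M)"

definition multiplier_domain ::
    "'a measure \<Rightarrow> ('a \<times> 'a \<Rightarrow> complex) \<Rightarrow> ('a \<times> 'a \<Rightarrow> complex) set" where
  "multiplier_domain M \<phi> = {k \<in> L2 (M \<Otimes>\<^sub>M M). (\<lambda>p. \<phi> p * k p) \<in> L2 (M \<Otimes>\<^sub>M M)}"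

definition multiplier_graph ::
    "'a measure \<Rightarrow> ('a \<times> 'a \<Rightarrow> complex) \<Rightarrow> ('a l2_op \<times> 'a l2_op) set" where
  "multiplier_graph M \<phi> =
     {(integral_op M k, integral_op M (\<lambda>p. \<phi> p * k p)) | k. k \<in> multiplier_domain M \<phi>}"

text \<open>
  The closure of the graph is a linear subspace, so it is the graph of a (linear) operator as soon
  as it is single-valued; single-valuedness is taken modulo \<open>op_eq\<close>.
\<close>

definition weak_star_closable :: "'a measure \<Rightarrow> ('a \<times> 'a \<Rightarrow> complex) \<Rightarrow> bool" where
  "weak_star_closable M \<phi> \<longleftrightarrow>
     (let G = prod_topology (weak_star_topology M) (weak_star_topology M)
                closure_of multiplier_graph M \<phi>
      in \<forall>(T, S)\<in>G. \<forall>(T', S')\<in>G. op_eq M T T' \<longrightarrow> op_eq M S S')"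

end

theory Submission
  imports Defs
begin

text \<open>
  Continuity of \<open>f\<close> makes \<open>\<phi>\<close> continuous, and in a second countable space open sets are countable
  unions of open rectangles; hence \<open>\<phi>\<close> is \<open>\<omega>\<close>-continuous. The substance is the failure of closability,
  and for that the convolution operators, those with a kernel \<open>u (x - y)\<close> and \<open>u\<close> continuous, suffice.

  A trace class operator \<open>B = (\<Sum>n. \<xi> n \<otimes> (\<eta> n)\<^sup>*)\<close> determines the function
  \<open>g\<^sub>B t = (\<Sum>n. \<integral>s. \<xi> n (s + t) * cnj (\<eta> n s) \<partial>M)\<close>, which is continuous and belongs to \<open>A(G)\<close>. The
  convolution operator of \<open>u\<close> pairs with \<open>B\<close> to \<open>\<integral>t. u t * g\<^sub>B t \<partial>M\<close>, and the translation by \<open>a\<close> pairs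
  with \<open>B\<close> to \<open>g\<^sub>B a\<close>. If a pair \<open>(A, B)\<close> annihilates all elements of the graph of \<open>S\<^sub>\<phi>\<close> that come from
  convolution operators, then \<open>\<integral>t. u t * (g\<^sub>A t + f t * g\<^sub>B t) \<partial>M = 0\<close> for all continuous \<open>u\<close>, so
  \<open>f \<cdot> g\<^sub>B = - g\<^sub>A\<close>: the function \<open>h = g\<^sub>B\<close> lies in the ideal \<open>J = {h \<in> A(G). f \<cdot> h \<in> A(G)}\<close>. All elements of
  this ideal vanish at a common point \<open>x0\<close>. Otherwise, by compactness, some finite sum
  \<open>H = (\<Sum>i. \<bar>h\<^sub>i\<bar>\<^sup>2)\<close> with \<open>h\<^sub>i \<in> J\<close> is strictly positive; Wiener's lemma puts \<open>1 / H\<close> into \<open>A(G)\<close>, and then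
  \<open>f = (f \<cdot> H) \<cdot> (1 / H)\<close> is in \<open>A(G)\<close>, against the hypothesis. So every such \<open>(A, B)\<close> also annihilates
  the pair of \<open>0\<close> and the translation by \<open>x0\<close>. This pair is therefore in the weak* closure of the graph
  (\<open>translation_in_closure\<close>), and so is \<open>(0, 0)\<close>: the closure is not single-valued.

  Three results about the group carry this argument. The first is the uniqueness theorem for Fourier
  coefficients (\<open>fourier_uniqueness\<close>), that is, the existence of enough characters. In place of the
  spectral theorem for compact operators it uses power iteration: the normalised convolution powers
  of \<open>g \<star> g\<close> converge uniformly to the projection onto the top eigenspace, which is convolution with
  an idempotent, and a minimal idempotent is a multiple of a character. The second is \<open>g\<^sub>B \<in> A(G)\<close>, which
  follows from uniqueness, Bessel's inequality and the continuity of translation. The third is Wiener's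
  lemma for strictly positive functions (\<open>Wiener_inverse\<close>), by a frequency count: the \<open>n\<close>-th power of
  a trigonometric polynomial with \<open>m\<close> frequencies has at most \<open>(n + 1)\<^sup>m\<close> of them, so its norm in \<open>A(G)\<close>
  exceeds the \<open>n\<close>-th power of its supremum by a polynomial factor only. Since the dual of a compact
  group is discrete, counting measure is a Haar measure on it, and absolutely convergent series of
  characters are Fourier transforms in the sense of \<open>fourier_algebra\<close>.
\<close>

section \<open>Square integrable functions\<close>

lemma L2_integrable_mult:
  assumes "\<xi> \<in> L2 M" "\<eta> \<in> L2 M"
  shows "integrable M (\<lambda>x. \<xi> x * \<eta> x)"
proof (rule Bochner_Integration.integrable_bound)
  show "integrable M (\<lambda>x. (norm (\<xi> x))\<^sup>2 + (norm (\<eta> x))\<^sup>2)" "(\<lambda>x. \<xi> x * \<eta> x) \<in> borel_measurable M"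
    using assms by (auto simp: L2_def)
  show "AE x in M. norm (\<xi> x * \<eta> x) \<le> norm ((norm (\<xi> x))\<^sup>2 + (norm (\<eta> x))\<^sup>2)"
  proof (intro AE_I2)
    fix x
    have "2 * (norm (\<xi> x) * norm (\<eta> x)) \<le> (norm (\<xi> x))\<^sup>2 + (norm (\<eta> x))\<^sup>2"
      using sum_squares_bound[of "norm (\<xi> x)" "norm (\<eta> x)"] by (simp add: algebra_simps)
    moreover have "0 \<le> norm (\<xi> x) * norm (\<eta> x)" by simp
    ultimately have "norm (\<xi> x) * norm (\<eta> x) \<le> (norm (\<xi> x))\<^sup>2 + (norm (\<eta> x))\<^sup>2" by linarith
    then show "norm (\<xi> x * \<eta> x) \<le> norm ((norm (\<xi> x))\<^sup>2 + (norm (\<eta> x))\<^sup>2)"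
      by (simp add: norm_mult)
  qed
qed

lemma L2_cnj: "\<xi> \<in> L2 M \<Longrightarrow> (\<lambda>x. cnj (\<xi> x)) \<in> L2 M"
  using borel_measurable_continuous_on[of cnj \<xi> M]
  by (auto simp: L2_def continuous_on_cnj)

lemma L2_add:
  assumes "\<xi> \<in> L2 M" "\<eta> \<in> L2 M" shows "(\<lambda>x. \<xi> x + \<eta> x) \<in> L2 M"
proof -
  have m: "\<xi> \<in> borel_measurable M" "\<eta> \<in> borel_measurable M" using assms by (auto simp: L2_def)
  have "integrable M (\<lambda>x. (norm (\<xi> x + \<eta> x))\<^sup>2)"
  proof (rule Bochner_Integration.integrable_bound)
    show "integrable M (\<lambda>x. 2 * (norm (\<xi> x))\<^sup>2 + 2 * (norm (\<eta> x))\<^sup>2)"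
      using assms by (auto simp: L2_def)
    show "AE x in M. norm ((norm (\<xi> x + \<eta> x))\<^sup>2) \<le> norm (2 * (norm (\<xi> x))\<^sup>2 + 2 * (norm (\<eta> x))\<^sup>2)"
    proof (intro AE_I2)
      fix x
      have "(norm (\<xi> x + \<eta> x))\<^sup>2 \<le> (norm (\<xi> x) + norm (\<eta> x))\<^sup>2"
        by (intro power_mono norm_triangle_ineq) auto
      also have "\<dots> \<le> 2 * (norm (\<xi> x))\<^sup>2 + 2 * (norm (\<eta> x))\<^sup>2"
        using sum_squares_bound[of "norm (\<xi> x)" "norm (\<eta> x)"] by (simp add: power2_sum)
      finally show "norm ((norm (\<xi> x + \<eta> x))\<^sup>2) \<le> norm (2 * (norm (\<xi> x))\<^sup>2 + 2 * (norm (\<eta> x))\<^sup>2)"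
        by simp
    qed
  qed (use m in measurable)
  then show ?thesis using m by (auto simp: L2_def)
qed

lemma L2_cmult:
  assumes "\<xi> \<in> L2 M" shows "(\<lambda>x. c * \<xi> x) \<in> L2 M"
  using assms by (auto simp: L2_def norm_mult power_mult_distrib)

lemma l2_norm_nonneg: "0 \<le> l2_norm M \<xi>"
  by (simp add: l2_norm_def)

lemma l2_norm_sq: "(l2_norm M \<xi>)\<^sup>2 = (\<integral>x. (norm (\<xi> x))\<^sup>2 \<partial>M)"
  by (simp add: l2_norm_def)

text \<open>The quadratic form in \<open>q\<close> below is the integral of \<open>(s * \<bar>\<xi>\<bar> - t * \<bar>\<eta>\<bar>)\<^sup>2\<close>; its nonnegativity for all real
\<open>s\<close> and \<open>t\<close> is the discriminant condition.\<close>

lemma L2_Cauchy_Schwarz_norm: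
  assumes "\<xi> \<in> L2 M" "\<eta> \<in> L2 M"
  shows "(\<integral>x. norm (\<xi> x * \<eta> x) \<partial>M) \<le> l2_norm M \<xi> * l2_norm M \<eta>"
proof -
  define a where "a = (\<integral>x. (norm (\<xi> x))\<^sup>2 \<partial>M)"
  define b where "b = (\<integral>x. norm (\<xi> x * \<eta> x) \<partial>M)"
  define d where "d = (\<integral>x. (norm (\<eta> x))\<^sup>2 \<partial>M)"
  have i: "integrable M (\<lambda>x. (norm (\<xi> x))\<^sup>2)" "integrable M (\<lambda>x. (norm (\<eta> x))\<^sup>2)"
    "integrable M (\<lambda>x. norm (\<xi> x * \<eta> x))"
    using assms L2_integrable_mult[OF assms] by (auto simp: L2_def)
  have nn: "0 \<le> a" "0 \<le> b" "0 \<le> d" by (auto simp: a_def b_def d_def)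
  have q: "0 \<le> s\<^sup>2 * a - 2 * (s * t) * b + t\<^sup>2 * d" for s t
  proof -
    have "0 \<le> (\<integral>x. (s * norm (\<xi> x) - t * norm (\<eta> x))\<^sup>2 \<partial>M)" by simp
    also have "\<dots> = (\<integral>x. s\<^sup>2 * (norm (\<xi> x))\<^sup>2 - 2 * (s * t) * norm (\<xi> x * \<eta> x)
        + t\<^sup>2 * (norm (\<eta> x))\<^sup>2 \<partial>M)"
      by (simp add: power2_diff power_mult_distrib norm_mult algebra_simps)
    also have "\<dots> = s\<^sup>2 * a - 2 * (s * t) * b + t\<^sup>2 * d"
      using i by (simp add: a_def b_def d_def)
    finally show ?thesis .
  qed
  have "b\<^sup>2 \<le> a * d"
  proof (cases "d = 0")
    case True
    \<comment> \<open>Here the form is \<open>a - 2 * t * b\<close>, linear in \<open>t\<close>, so \<open>b\<close> must vanish.\<close>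
    have "b = 0"
    proof (rule ccontr)
      assume "b \<noteq> 0"
      with q[of 1 "(a + 1) / b"] True nn show False by simp
    qed
    then show ?thesis by (simp add: True)
  next
    case False
    with nn have "0 < d" by simp
    have "0 \<le> d * (d * a - b\<^sup>2)"
      using q[of d b] by (simp add: power2_eq_square algebra_simps)
    with \<open>0 < d\<close> show ?thesis
      by (simp add: zero_le_mult_iff mult.commute)
  qed
  then have "b \<le> sqrt (a * d)" by (rule real_le_rsqrt)
  then show ?thesis by (simp add: l2_norm_def a_def b_def d_def real_sqrt_mult)
qed

lemma L2_Cauchy_Schwarz:
  assumes "\<xi> \<in> L2 M" "\<eta> \<in> L2 M"
  shows "norm (\<integral>x. \<xi> x * \<eta> x \<partial>M) \<le> l2_norm M \<xi> * l2_norm M \<eta>"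
  using L2_Cauchy_Schwarz_norm[OF assms] integral_norm_bound[of M "\<lambda>x. \<xi> x * \<eta> x"] by linarith

section \<open>Integration on a compact group\<close>

abbreviation cont :: "('a::topological_space \<Rightarrow> complex) \<Rightarrow> bool" where
  "cont u \<equiv> continuous_on UNIV u"

locale compact_haar =
  fixes M :: "'g::{topological_ab_group_add, second_countable_topology, t2_space} measure"
  assumes compact_group: "compact (UNIV :: 'g set)"
    and haar: "haar_measure euclidean (+) M"
begin

lemma space_M [simp]: "space M = UNIV"
  using haar by (simp add: haar_measure_def)

lemma sets_M [measurable_cong, simp]: "sets M = sets borel"
  using haar by (simp add: haar_measure_def borel_def)

lemma sets_MM: "sets (M \<Otimes>\<^sub>M M) = sets borel"
  using sets_pair_measure_cong[OF sets_M sets_M] unfolding borel_prod .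

sublocale finite_measure M
proof (rule finite_measureI)
  have "compactin euclidean (UNIV::'g set)" using compact_group by simp
  then have "emeasure M UNIV < \<infinity>" using haar unfolding haar_measure_def by blast
  then show "emeasure M (space M) \<noteq> \<infinity>" by simp
qed

sublocale pair_sigma_finite M M ..

lemma emeasure_translate: "A \<in> sets M \<Longrightarrow> emeasure M ((+) a ` A) = emeasure M A"
  using haar unfolding haar_measure_def topspace_euclidean by blast

definition vol :: real where "vol = measure M UNIV"

lemma vol_pos: "0 < vol"
proof -
  have "emeasure M UNIV \<noteq> 0" using haar unfolding haar_measure_def topspace_euclidean by blast
  then show ?thesis by (simp add: vol_def emeasure_eq_measure zero_less_measure_iff)
qed

lemma cont_measurable: "cont u \<Longrightarrow> u \<in> borel_measurable M"
  using borel_measurable_continuous_onI measurable_cong_sets[OF sets_M refl] by blast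

lemma cont_measurable_pair:
  fixes u :: "'g \<times> 'g \<Rightarrow> complex"
  shows "cont u \<Longrightarrow> u \<in> borel_measurable (M \<Otimes>\<^sub>M M)"
  using borel_measurable_continuous_onI measurable_cong_sets[OF sets_MM refl] by blast

lemma add_measurable: "(\<lambda>p::'g \<times> 'g. fst p + snd p) \<in> borel_measurable (M \<Otimes>\<^sub>M M)"
  unfolding measurable_cong_sets[OF sets_MM refl]
  by (intro borel_measurable_continuous_onI continuous_intros)

lemma translation_measurable [measurable]: "(\<lambda>x::'g. x + a) \<in> measurable M M"
  unfolding measurable_cong_sets[OF sets_M sets_M]
  by (intro borel_measurable_continuous_onI continuous_intros)

lemma distr_translation: "distr M M (\<lambda>x. x + a) = M"
proof (rule measure_eqI)
  fix A assume "A \<in> sets (distr M M (\<lambda>x. x + a))"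
  then have A: "A \<in> sets M" by simp
  have eq: "(\<lambda>x. x + a) -` A = (+) (- a) ` A"
  proof
    show "(\<lambda>x. x + a) -` A \<subseteq> (+) (- a) ` A"
      by (rule subsetI, rule image_eqI[where x = "x + a" for x]) (auto simp: algebra_simps)
  qed auto
  have "emeasure (distr M M (\<lambda>x. x + a)) A = emeasure M ((\<lambda>x. x + a) -` A)"
    using A by (subst emeasure_distr) auto
  also have "\<dots> = emeasure M A"
    unfolding eq by (rule emeasure_translate[OF A])
  finally show "emeasure (distr M M (\<lambda>x. x + a)) A = emeasure M A" .
qed simp

lemma integral_translation:
  fixes u :: "'g \<Rightarrow> 'b::{banach, second_countable_topology}"
  assumes "u \<in> borel_measurable M"
  shows "(\<integral>x. u (x + a) \<partial>M) = (\<integral>x. u x \<partial>M)"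
  using integral_distr[of "\<lambda>x. x + a" M M u] assms distr_translation[of a] by simp

lemma integrable_translation:
  fixes u :: "'g \<Rightarrow> 'b::{banach, second_countable_topology}"
  assumes "integrable M u"
  shows "integrable M (\<lambda>x. u (x + a))"
  using integrable_distr[of "\<lambda>x. x + a" M M u] assms distr_translation[of a] by simp

lemma cont_bounded:
  fixes u :: "'g \<Rightarrow> complex"
  assumes "cont u" obtains B where "0 \<le> B" "\<And>x. norm (u x) \<le> B"
proof -
  have "compact (u ` UNIV)" using assms compact_group by (rule compact_continuous_image)
  then obtain B where "\<forall>x\<in>range u. norm x \<le> B" using compact_imp_bounded bounded_iff by metis
  then have "\<And>x. norm (u x) \<le> B" by auto
  moreover have "0 \<le> B" using calculation[of 0] norm_ge_zero order_trans by blast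
  ultimately show ?thesis using that by blast
qed

lemma bounded_integrable:
  fixes u :: "'g \<Rightarrow> 'b::{banach, second_countable_topology}"
  assumes "u \<in> borel_measurable M" "\<And>x. norm (u x) \<le> B"
  shows "integrable M u"
  using assms by (intro integrable_const_bound[where B = B]) auto

lemma cont_integrable: "cont u \<Longrightarrow> integrable M u"
  by (meson bounded_integrable cont_bounded cont_measurable)

lemma cont_L2: assumes "cont u" shows "u \<in> L2 M"
proof -
  have "cont (\<lambda>x. complex_of_real ((norm (u x))\<^sup>2))" using assms by (intro continuous_intros)
  from integrable_Re[OF cont_integrable[OF this]] show ?thesis
    using assms cont_measurable by (auto simp: L2_def)
qed

lemma cont_translate: "cont u \<Longrightarrow> cont (\<lambda>x::'g. u (x + a))"
  by (rule continuous_on_compose2[of UNIV u]) (auto intro!: continuous_intros)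

lemma cont_minus: "cont u \<Longrightarrow> cont (\<lambda>x::'g. u (a - x))"
  by (rule continuous_on_compose2[of UNIV u]) (auto intro!: continuous_intros)

lemma cont_swap: "cont u \<Longrightarrow> cont (\<lambda>x::'g. u (- x))"
  by (rule continuous_on_compose2[of UNIV u]) (auto intro!: continuous_intros)

lemma pair_integrable_cont:
  fixes u :: "'g \<times> 'g \<Rightarrow> complex"
  assumes "cont u"
  shows "integrable (M \<Otimes>\<^sub>M M) u"
proof -
  have "compact (u ` (UNIV \<times> UNIV))"
    using assms compact_group by (intro compact_continuous_image compact_Times) auto
  then obtain B where B: "\<forall>x\<in>range u. norm x \<le> B" using compact_imp_bounded bounded_iff by (metis UNIV_Times_UNIV)
  interpret P: finite_measure "M \<Otimes>\<^sub>M M" by (rule finite_measure_pair_measure) unfold_locales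
  show ?thesis using B cont_measurable_pair[OF assms]
    by (intro P.integrable_const_bound[where B = B]) auto
qed

lemma Fubini_cont:
  fixes u :: "'g \<times> 'g \<Rightarrow> complex"
  assumes "cont u"
  shows "(\<integral>x. (\<integral>y. u (x, y) \<partial>M) \<partial>M) = (\<integral>y. (\<integral>x. u (x, y) \<partial>M) \<partial>M)"
  using Fubini_integral[of "\<lambda>x y. u (x, y)"] pair_integrable_cont[OF assms] by simp

text \<open>Both sides, multiplied by the total mass, are the double integral of \<open>u (y - x)\<close>: integrating first
over \<open>y\<close> gives \<open>u\<close>, integrating first over \<open>x\<close> gives its reflection.\<close>

lemma integral_reflection:
  assumes "cont u"
  shows "(\<integral>x. u (- x) \<partial>M) = (\<integral>x. u x \<partial>M)"
proof -
  have c: "cont (\<lambda>p::'g\<times>'g. u (snd p - fst p))"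
    by (rule continuous_on_compose2[OF assms]) (auto intro!: continuous_intros)
  have "vol * (\<integral>x. u x \<partial>M) = (\<integral>x. (\<integral>y. u (y - x) \<partial>M) \<partial>M)"
    using integral_translation[OF cont_measurable[OF assms], of "- x" for x] by (simp add: vol_def scaleR_conv_of_real)
  also have "\<dots> = (\<integral>y. (\<integral>x. u (y - x) \<partial>M) \<partial>M)" using Fubini_cont[OF c] by simp
  also have "\<dots> = (\<integral>y. (\<integral>x. u (- x) \<partial>M) \<partial>M)"
  proof (rule Bochner_Integration.integral_cong[OF refl])
    fix y
    have "(\<integral>x. u (- (x + (- y))) \<partial>M) = (\<integral>x. u (- x) \<partial>M)"
      by (rule integral_translation) (intro cont_measurable cont_swap assms)
    then show "(\<integral>x. u (y - x) \<partial>M) = (\<integral>x. u (- x) \<partial>M)" by simp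
  qed
  also have "\<dots> = vol * (\<integral>x. u (- x) \<partial>M)" by (simp add: vol_def scaleR_conv_of_real)
  finally show ?thesis using vol_pos by simp
qed

text \<open>Finitely many translates of \<open>U\<close> cover the group, and they all have the measure of \<open>U\<close>.\<close>

lemma open_measure_pos:
  assumes "open U" "U \<noteq> {}"
  shows "0 < measure M U"
proof (rule ccontr)
  assume "\<not> 0 < measure M U"
  then have null: "emeasure M U = 0" by (simp add: emeasure_eq_measure zero_less_measure_iff)
  obtain a where a: "a \<in> U" using assms by auto
  have op: "open ((+) b ` U)" for b
  proof -
    have "(+) b ` U = (\<lambda>x. x - b) -` U" by (auto simp: image_iff) (metis add_diff_cancel_left' add.commute diff_add_cancel)
    then show ?thesis using assms(1)
      by (auto intro!: open_vimage continuous_intros)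
  qed
  have "UNIV \<subseteq> (\<Union>b. (+) b ` U)"
  proof
    fix x show "x \<in> (\<Union>b. (+) b ` U)"
      by (rule UN_I[of "x - a"]) (auto intro!: image_eqI[of _ _ a] a)
  qed
  then obtain F where F: "finite F" "UNIV \<subseteq> (\<Union>b\<in>F. (+) b ` U)"
    using compactE_image[OF compact_group, of UNIV "\<lambda>b. (+) b ` U"] op by auto
  have "emeasure M UNIV \<le> emeasure M (\<Union>b\<in>F. (+) b ` U)"
    using F op by (intro emeasure_mono) auto
  also have "\<dots> \<le> (\<Sum>b\<in>F. emeasure M ((+) b ` U))"
    using F op by (intro emeasure_subadditive_finite) auto
  also have "\<dots> = 0" using emeasure_translate[of U] assms(1) null by simp
  finally show False using vol_pos by (simp add: vol_def emeasure_eq_measure)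
qed

section \<open>The convolution algebra of continuous functions\<close>

text \<open>Dividing by the total mass makes the characters orthonormal, and idempotent for \<open>conv\<close>, whatever the
normalisation of the Haar measure.\<close>

definition mean :: "('g \<Rightarrow> complex) \<Rightarrow> complex" where
  "mean u = (\<integral>x. u x \<partial>M) / vol"

definition conv :: "('g \<Rightarrow> complex) \<Rightarrow> ('g \<Rightarrow> complex) \<Rightarrow> 'g \<Rightarrow> complex" where
  "conv u v x = mean (\<lambda>y. u (x - y) * v y)"

definition star :: "('g \<Rightarrow> complex) \<Rightarrow> 'g \<Rightarrow> complex" where
  "star u x = cnj (u (- x))"

definition sq :: "('g \<Rightarrow> complex) \<Rightarrow> real" where
  "sq u = (l2_norm M u)\<^sup>2 / vol"

lemma sq_nonneg: "0 \<le> sq u" using vol_pos by (simp add: sq_def)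

lemma sqrt_sq: "sqrt (sq u) = l2_norm M u / sqrt vol"
  by (simp add: sq_def real_sqrt_divide l2_norm_nonneg)

lemma mean_sq: "mean (\<lambda>x. u x * cnj (u x)) = sq u"
proof -
  have "(\<integral>x. u x * cnj (u x) \<partial>M) = (\<integral>x. complex_of_real ((norm (u x))\<^sup>2) \<partial>M)"
    by (simp only: complex_norm_square)
  also have "\<dots> = complex_of_real (\<integral>x. (norm (u x))\<^sup>2 \<partial>M)"
    by (rule integral_complex_of_real)
  finally show ?thesis by (simp add: mean_def sq_def l2_norm_sq)
qed

lemma mean_add: "integrable M u \<Longrightarrow> integrable M v \<Longrightarrow> mean (\<lambda>x. u x + v x) = mean u + mean v"
  by (simp add: mean_def add_divide_distrib)
lemma mean_diff: "integrable M u \<Longrightarrow> integrable M v \<Longrightarrow> mean (\<lambda>x. u x - v x) = mean u - mean v"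
  by (simp add: mean_def diff_divide_distrib)
lemma mean_cmult: "mean (\<lambda>x. c * u x) = c * mean u"
  by (simp add: mean_def)
lemma mean_const: "mean (\<lambda>x. c) = c"
  using vol_pos by (simp add: mean_def vol_def[symmetric] scaleR_conv_of_real)
lemma mean_cnj: "mean (\<lambda>x. cnj (u x)) = cnj (mean u)"
  by (simp add: mean_def)
lemma mean_translation: "cont u \<Longrightarrow> mean (\<lambda>x. u (x + a)) = mean u"
  by (simp add: mean_def integral_translation[OF cont_measurable])
lemma mean_reflection: "cont u \<Longrightarrow> mean (\<lambda>x. u (a - x)) = mean u"
  using integral_reflection[OF cont_translate, of u a] integral_translation[OF cont_measurable, of u a]
  by (simp add: mean_def)
lemma mean_swap:
  assumes "cont (\<lambda>(x, y). u x y)"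
  shows "mean (\<lambda>x. mean (\<lambda>y. u x y)) = mean (\<lambda>y. mean (\<lambda>x. u x y))"
  using Fubini_cont[OF assms] by (simp add: mean_def)

lemma cont_conv:
  assumes "cont u" "cont v"
  shows "cont (conv u v)"
proof -
  obtain B where B: "0 \<le> B" "\<And>x. norm (u x) \<le> B" using cont_bounded[OF assms(1)] by blast
  obtain C where C: "0 \<le> C" "\<And>x. norm (v x) \<le> C" using cont_bounded[OF assms(2)] by blast
  have "isCont (conv u v) a" for a
    unfolding isCont_def tendsto_at_iff_sequentially
  proof (intro allI impI)
    fix X assume "X \<longlonglongrightarrow> a"
    have "(\<lambda>i. \<integral>y. u (X i - y) * v y \<partial>M) \<longlonglongrightarrow> (\<integral>y. u (a - y) * v y \<partial>M)"
    proof (rule integral_dominated_convergence[where w = "\<lambda>_. B * C"])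
      show "AE y in M. (\<lambda>i. u (X i - y) * v y) \<longlonglongrightarrow> u (a - y) * v y"
      proof (intro AE_I2 tendsto_mult tendsto_const)
        fix y
        have "isCont u (a - y)" using assms(1) by (simp add: continuous_on_eq_continuous_at)
        moreover have "(\<lambda>i. X i - y) \<longlonglongrightarrow> a - y" using \<open>X \<longlonglongrightarrow> a\<close> by (intro tendsto_intros)
        ultimately show "(\<lambda>i. u (X i - y)) \<longlonglongrightarrow> u (a - y)" by (rule isCont_tendsto_compose)
      qed
      show "AE y in M. norm (u (X i - y) * v y) \<le> B * C" for i
        using B C by (auto simp: norm_mult intro!: mult_mono)
    qed (auto intro!: cont_measurable continuous_intros cont_minus assms)
    then show "((conv u v) \<circ> X) \<longlonglongrightarrow> conv u v a"
      using vol_pos by (auto simp: conv_def mean_def o_def intro!: tendsto_intros)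
  qed
  then show ?thesis by (simp add: continuous_on_eq_continuous_at)
qed

lemma cont_star: "cont u \<Longrightarrow> cont (star u)"
  unfolding star_def by (intro continuous_intros cont_swap)

lemma integrable_conv: "cont u \<Longrightarrow> cont v \<Longrightarrow> integrable M (\<lambda>y. u (x - y) * v y)"
  by (intro cont_integrable continuous_intros cont_minus)

lemma conv_comm:
  assumes "cont u" "cont v" shows "conv u v = conv v u"
proof
  fix x
  have "mean (\<lambda>y. (\<lambda>z. u (x - z) * v z) (x - y)) = mean (\<lambda>z. u (x - z) * v z)"
    by (rule mean_reflection) (intro continuous_intros cont_minus assms)
  then show "conv u v x = conv v u x" by (simp add: conv_def mult.commute)
qed

lemma conv_add_left:
  assumes "cont u" "cont v" "cont w"
  shows "conv (\<lambda>x. u x + v x) w = (\<lambda>x. conv u w x + conv v w x)"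
  using assms by (auto simp: conv_def fun_eq_iff distrib_right mean_add integrable_conv)

lemma conv_diff_left:
  assumes "cont u" "cont v" "cont w"
  shows "conv (\<lambda>x. u x - v x) w = (\<lambda>x. conv u w x - conv v w x)"
  using assms by (auto simp: conv_def fun_eq_iff left_diff_distrib mean_diff integrable_conv)

lemma conv_add_right:
  assumes "cont u" "cont v" "cont w"
  shows "conv w (\<lambda>x. u x + v x) = (\<lambda>x. conv w u x + conv w v x)"
  using assms by (auto simp: conv_def fun_eq_iff distrib_left mean_add integrable_conv)

lemma conv_diff_right:
  assumes "cont u" "cont v" "cont w"
  shows "conv w (\<lambda>x. u x - v x) = (\<lambda>x. conv w u x - conv w v x)"
  using assms by (auto simp: conv_def fun_eq_iff right_diff_distrib mean_diff integrable_conv)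

lemma conv_cmult_left: "conv (\<lambda>x. c * u x) w = (\<lambda>x. c * conv u w x)"
  by (rule ext) (simp add: conv_def mean_cmult mult.assoc)

lemma conv_cmult_right: "conv w (\<lambda>x. c * u x) = (\<lambda>x. c * conv w u x)"
  by (rule ext) (simp add: conv_def mean_cmult mult.left_commute)

lemma conv_translate:
  "conv (\<lambda>x. u (x + s)) v = (\<lambda>x. conv u v (x + s))"
  by (simp add: conv_def fun_eq_iff algebra_simps)

lemma conv_assoc:
  assumes "cont u" "cont v" "cont w"
  shows "conv (conv u v) w = conv u (conv v w)"
proof
  fix x
  have c: "cont (\<lambda>(y, z). u (x - z) * (v (z - y) * w y))"
    unfolding case_prod_beta
    by (intro continuous_on_mult continuous_on_compose2[OF assms(1)] continuous_on_compose2[OF assms(2)]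
        continuous_on_compose2[OF assms(3)]) (auto intro!: continuous_intros)
  have "mean (\<lambda>z. u (x - z) * v (z - y)) = conv u v (x - y)" for y
  proof -
    have "mean (\<lambda>z. (\<lambda>z. u (x - y - z) * v z) (z + (- y))) = mean (\<lambda>z. u (x - y - z) * v z)"
      by (rule mean_translation) (intro continuous_intros cont_minus assms)
    then show ?thesis by (simp add: conv_def)
  qed
  then have "conv (conv u v) w x = mean (\<lambda>y. mean (\<lambda>z. u (x - z) * v (z - y)) * w y)"
    by (simp add: conv_def)
  also have "\<dots> = mean (\<lambda>y. mean (\<lambda>z. u (x - z) * (v (z - y) * w y)))"
    by (simp add: mean_def mult.assoc[symmetric])
  also have "\<dots> = mean (\<lambda>z. mean (\<lambda>y. u (x - z) * (v (z - y) * w y)))"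
    by (rule mean_swap[OF c])
  also have "\<dots> = conv u (conv v w) x" by (simp add: conv_def mean_cmult)
  finally show "conv (conv u v) w x = conv u (conv v w) x" .
qed

lemma star_conv:
  assumes "cont u" "cont v" shows "star (conv u v) = conv (star u) (star v)"
proof
  fix x
  have "mean (\<lambda>y. (\<lambda>z. u (- x - z) * v z) (0 - y)) = mean (\<lambda>z. u (- x - z) * v z)"
    by (rule mean_reflection) (intro continuous_intros cont_minus assms)
  from this[symmetric] show "star (conv u v) x = conv (star u) (star v) x"
    by (simp add: star_def conv_def mean_cnj[symmetric])
qed

lemma star_star [simp]: "star (star u) = u" by (rule ext) (simp add: star_def)

lemma conv_star_0:
  assumes "cont u" shows "conv u (star u) 0 = sq u"
proof -
  have "mean (\<lambda>y. (\<lambda>z. u z * cnj (u z)) (0 - y)) = mean (\<lambda>z. u z * cnj (u z))"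
    by (rule mean_reflection) (intro continuous_intros assms)
  then show ?thesis by (simp add: conv_def star_def mean_sq)
qed

lemma l2_norm_reflection:
  assumes "cont u" shows "l2_norm M (\<lambda>y. u (x - y)) = l2_norm M u"
proof -
  have "mean (\<lambda>y. (\<lambda>z. u z * cnj (u z)) (x - y)) = mean (\<lambda>z. u z * cnj (u z))"
    by (rule mean_reflection) (intro continuous_intros assms)
  then have "sq (\<lambda>y. u (x - y)) = sq u" by (simp add: mean_sq)
  then have "sqrt (sq (\<lambda>y. u (x - y))) = sqrt (sq u)" by simp
  then show ?thesis using vol_pos by (simp add: sqrt_sq)
qed

lemma norm_conv_le:
  assumes "cont u" "cont v"
  shows "norm (conv u v x) \<le> sqrt (sq u) * sqrt (sq v)"
proof -
  have "norm (\<integral>y. u (x - y) * v y \<partial>M) \<le> l2_norm M u * l2_norm M v"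
    using L2_Cauchy_Schwarz[OF cont_L2 cont_L2, of "\<lambda>y. u (x - y)" v] assms cont_minus
    by (simp add: l2_norm_reflection)
  then show ?thesis using vol_pos
    by (simp add: conv_def mean_def sqrt_sq norm_divide divide_right_mono)
qed

lemma sq_le:
  assumes "cont u" "\<And>x. norm (u x) \<le> B" shows "sq u \<le> B\<^sup>2"
proof -
  have "(\<integral>x. (norm (u x))\<^sup>2 \<partial>M) \<le> (\<integral>x. B\<^sup>2 \<partial>M)"
    using cont_L2[OF assms(1)] assms(2) by (intro integral_mono power_mono) (auto simp: L2_def)
  then show ?thesis using vol_pos by (simp add: sq_def l2_norm_sq divide_simps vol_def mult.commute)
qed

lemma sq_conv_le:
  assumes "cont u" "cont v" shows "sq (conv u v) \<le> sq u * sq v"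
  using sq_le[OF cont_conv[OF assms] norm_conv_le[OF assms]]
  by (simp add: power_mult_distrib sq_nonneg)

lemma AE_cont_zero:
  assumes "cont u" "AE x in M. u x = 0" shows "u = (\<lambda>x. 0)"
proof (rule ccontr)
  assume "u \<noteq> (\<lambda>x. 0)"
  have o: "open {x. u x \<noteq> 0}" using assms(1) by (intro open_Collect_neq continuous_intros)
  moreover have "{x. u x \<noteq> 0} \<noteq> {}" using \<open>u \<noteq> (\<lambda>x. 0)\<close> by auto
  ultimately have "0 < measure M {x. u x \<noteq> 0}" by (rule open_measure_pos)
  moreover have "emeasure M {x. u x \<noteq> 0} = 0"
    using AE_iff_measurable[of "{x. u x \<noteq> 0}" M "\<lambda>x. u x = 0"] assms(2) o by auto
  ultimately show False by (simp add: emeasure_eq_measure)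
qed

lemma sq_pos:
  assumes "cont u" "u \<noteq> (\<lambda>x. 0)" shows "0 < sq u"
proof (rule ccontr)
  assume "\<not> 0 < sq u"
  then have "(\<integral>x. (norm (u x))\<^sup>2 \<partial>M) = 0"
    using sq_nonneg[of u] vol_pos by (simp add: sq_def l2_norm_sq zero_less_divide_iff le_less)
  then have "AE x in M. (norm (u x))\<^sup>2 = 0"
    using cont_L2[OF assms(1)] by (subst (asm) integral_nonneg_eq_0_iff_AE) (auto simp: L2_def)
  then have "AE x in M. u x = 0" by eventually_elim simp
  from AE_cont_zero[OF assms(1) this] assms(2) show False by simp
qed

lemma tendsto_sq_uniform:
  assumes "\<And>n. cont (u n)" "cont w" "uniform_limit UNIV u w sequentially"
  shows "(\<lambda>n. sqrt (sq (\<lambda>x. u n x - w x))) \<longlonglongrightarrow> 0"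
proof (rule metric_LIMSEQ_I)
  fix e :: real assume "0 < e"
  then have "\<forall>\<^sub>F n in sequentially. \<forall>x\<in>UNIV. dist (u n x) (w x) < e/2"
    using assms(3) \<open>0 < e\<close> unfolding uniform_limit_iff by (meson half_gt_zero)
  then obtain N where N: "\<And>n x. n \<ge> N \<Longrightarrow> dist (u n x) (w x) < e/2"
    by (auto simp: eventually_sequentially)
  show "\<exists>no. \<forall>n\<ge>no. dist (sqrt (sq (\<lambda>x. u n x - w x))) 0 < e"
  proof (intro exI allI impI)
    fix n assume "N \<le> n"
    have "sq (\<lambda>x. u n x - w x) \<le> (e/2)\<^sup>2"
      using N[OF \<open>N \<le> n\<close>] assms by (intro sq_le continuous_intros) (auto simp: dist_norm less_imp_le)
    then have "sqrt (sq (\<lambda>x. u n x - w x)) \<le> e/2"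
      using \<open>0 < e\<close> by (intro real_le_lsqrt) (auto simp: sq_nonneg)
    then show "dist (sqrt (sq (\<lambda>x. u n x - w x))) 0 < e" using \<open>0 < e\<close> by (simp add: sq_nonneg)
  qed
qed

text \<open>Convolution is continuous in both arguments for the mean square norm, and uniform convergence is
stronger than convergence in that norm.\<close>

lemma tendsto_conv_uniform:
  assumes "\<And>n. cont (u n)" "cont u'" "uniform_limit UNIV u u' sequentially"
    and "\<And>n. cont (v n)" "cont v'" "uniform_limit UNIV v v' sequentially"
  shows "(\<lambda>n. conv (u n) (v n) x) \<longlonglongrightarrow> conv u' v' x"
proof -
  define a where "a n = (\<lambda>x. u n x - u' x)" for n
  define b where "b n = (\<lambda>x. v n x - v' x)" for n
  have ab: "cont (a n)" "cont (b n)" for n unfolding a_def b_def using assms by (auto intro!: continuous_intros)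
  define e where "e n = sqrt (sq (a n))" for n
  define f where "f n = sqrt (sq (b n))" for n
  have "e \<longlonglongrightarrow> 0" "f \<longlonglongrightarrow> 0"
    unfolding e_def f_def a_def b_def using assms by (auto intro!: tendsto_sq_uniform)
  then have "(\<lambda>n. e n * f n + e n * sqrt (sq v') + sqrt (sq u') * f n) \<longlonglongrightarrow> 0 * 0 + 0 * sqrt (sq v') + sqrt (sq u') * 0"
    by (intro tendsto_intros)
  then have lim: "(\<lambda>n. e n * f n + e n * sqrt (sq v') + sqrt (sq u') * f n) \<longlonglongrightarrow> 0" by simp
  have "conv (u n) (v n) x - conv u' v' x = conv (a n) (b n) x + conv (a n) v' x + conv u' (b n) x" for n
  proof -
    have "conv (a n) (b n) x + conv (a n) v' x = conv (a n) (\<lambda>x. b n x + v' x) x"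
      using conv_add_right[of "b n" v' "a n"] ab assms by simp
    also have "(\<lambda>x. b n x + v' x) = v n" by (simp add: b_def)
    also have "conv (a n) (v n) x = conv (u n) (v n) x - conv u' (v n) x"
      unfolding a_def using conv_diff_left[of "u n" u' "v n"] assms by simp
    finally show ?thesis unfolding b_def using conv_diff_right[of "v n" v' u'] assms by simp
  qed
  then have "norm (conv (u n) (v n) x - conv u' v' x) \<le> e n * f n + e n * sqrt (sq v') + sqrt (sq u') * f n" for n
    unfolding e_def f_def using ab assms
    by (auto intro!: norm_triangle_le add_mono norm_conv_le)
  then have "(\<lambda>n. conv (u n) (v n) x - conv u' v' x) \<longlonglongrightarrow> 0"
    using Lim_null_comparison[OF _ lim, of "\<lambda>n. conv (u n) (v n) x - conv u' v' x"] by simp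
  then show ?thesis by (rule Lim_null[THEN iffD2])
qed

section \<open>Characters from idempotents\<close>

text \<open>This replaces the spectral theorem. Convolution with the self-adjoint \<open>g\<close> is a self-adjoint operator,
and \<open>p\<close> is the kernel of the projection onto the top eigenspace of its square, with eigenvalue \<open>r\<close>.
It is obtained as the limit of the powers of \<open>g \<star> g\<close>, divided by those of \<open>r\<close>. Everything is read off
the moments \<open>A n\<close>, the mean squares of the powers of \<open>g\<close>: they are log-convex, so their ratios increase
to a limit \<open>r\<close>; the normalised moments \<open>D n\<close> decrease, which makes the normalised powers a Cauchy
sequence; and the moments are submultiplicative, which keeps \<open>D n\<close> above \<open>1\<close> and the limit nonzero.\<close>

lemma power_iteration:
  assumes g: "cont g" "star g = g" "g \<noteq> (\<lambda>x. 0)"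
  obtains r p where "0 < r" "cont p" "conv p p = p" "star p = p" "p \<noteq> (\<lambda>x. 0)"
    "conv (conv g g) p = (\<lambda>x. complex_of_real r * p x)"
proof -
  \<comment> \<open>\<open>P n\<close> is the convolution power of \<open>g\<close> with \<open>n + 1\<close> factors.\<close>
  define P where "P n = (conv g ^^ n) g" for n
  have P_Suc: "P (Suc n) = conv g (P n)" for n by (simp add: P_def)
  have P0: "P 0 = g" by (simp add: P_def)
  have contP: "cont (P n)" for n by (induction n) (auto simp: P_Suc P0 g cont_conv)
  have starP: "star (P n) = P n" for n
    by (induction n) (auto simp: P_Suc P0 g star_conv contP)
  have PP: "conv (P m) (P n) = P (m + n + 1)" for m n
    by (induction m) (auto simp: P_Suc P0 conv_assoc g contP)
  define A where "A n = sq (P n)" for n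
  have P_0: "P (2 * n + 1) 0 = A n" for n
    using conv_star_0[OF contP, of n] PP[of n n] by (simp add: starP A_def mult_2)
  have logconv: "(A (Suc n))\<^sup>2 \<le> A n * A (n + 2)" for n
  proof -
    have "P (2 * Suc n + 1) 0 = conv (P n) (P (n + 2)) 0" using PP[of n "n + 2"] by (simp add: mult_2)
    then have "norm (complex_of_real (A (Suc n))) \<le> sqrt (A n) * sqrt (A (n + 2))"
      using norm_conv_le[OF contP contP, of n "n + 2" 0] P_0[of "Suc n"] by (simp add: A_def)
    then have "A (Suc n) \<le> sqrt (A n * A (n + 2))" by (simp add: real_sqrt_mult)
    then show ?thesis using sq_nonneg[of "P (Suc n)"]
      using power_mono[of "A (Suc n)" "sqrt (A n * A (n + 2))" 2] by (simp add: A_def sq_nonneg)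
  qed
  have A0: "0 < A 0" using sq_pos g by (simp add: A_def P0)
  have Apos: "0 < A n" for n
  proof (induction n rule: nat_less_induct)
    case (1 n)
    consider "n = 0" | "n = 1" | m where "n = m + 2" by (metis Suc_1 Suc_eq_plus1 add.commute add_2_eq_Suc not0_implies_Suc One_nat_def)
    then show ?case
    proof cases
      case 2
      have "P 1 0 = A 0" using P_0[of 0] by simp
      with A0 have "P 1 \<noteq> (\<lambda>x. 0)" by (metis less_irrefl of_real_eq_0_iff)
      then show ?thesis using sq_pos[OF contP] 2 by (simp add: A_def)
    next
      case (3 m)
      with 1 have "0 < A (Suc m)" "0 < A m" by auto
      with logconv[of m] have "0 < A m * A (m + 2)" by (meson less_le_trans zero_less_power)
      with \<open>0 < A m\<close> 3 show ?thesis by (simp add: zero_less_mult_iff)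
    qed (use A0 in simp)
  qed
  have sub: "A (n + N + 1) \<le> A n * A N" for n N
    using sq_conv_le[OF contP contP, of n N] PP[of n N] by (simp add: A_def)
  define R where "R n = A (Suc n) / A n" for n
  have Rinc: "incseq R"
    using logconv Apos by (intro incseq_SucI) (simp add: R_def divide_simps power2_eq_square mult.commute)
  have Rbd: "R n \<le> A 0" for n
    using sub[of n 0] Apos[of n] by (simp add: R_def divide_simps mult.commute)
  obtain r where r: "R \<longlonglongrightarrow> r" "\<And>n. R n \<le> r"
    using incseq_convergent[OF Rinc, of "A 0"] Rbd by blast
  have "0 < R 0" using Apos by (simp add: R_def)
  with r(2)[of 0] have rpos: "0 < r" by linarith
  define D where "D n = A n / r ^ Suc n" for n
  have "A (n + k) / A n = (\<Prod>i<k. R (n + i))" for n k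
    using Apos by (induction k) (auto simp: R_def divide_simps less_imp_neq[symmetric] mult.commute)
  moreover have "(\<lambda>n. \<Prod>i<k. R (n + i)) \<longlonglongrightarrow> (\<Prod>i<k. r)" for k
    by (intro tendsto_intros LIMSEQ_ignore_initial_segment r)
  ultimately have lim: "(\<lambda>n. A (n + k) / A n) \<longlonglongrightarrow> r ^ k" for k by simp
  \<comment> \<open>Submultiplicativity bounds \<open>A (n + k) / A n\<close> by \<open>A (k - 1)\<close>, and this quotient tends to \<open>r ^ k\<close>.\<close>
  have D1: "1 \<le> D N" for N
  proof -
    have "r ^ Suc N \<le> A N"
      using sub[of _ N] Apos
      by (intro LIMSEQ_le_const2[OF lim[of "Suc N"]]) (auto simp: divide_simps mult.commute add.assoc)
    then show ?thesis using rpos by (simp add: D_def divide_simps)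
  qed
  have "decseq D"
  proof (rule decseq_SucI)
    fix n show "D (Suc n) \<le> D n"
      using r(2)[of n] Apos[of n] rpos by (simp add: R_def D_def divide_simps mult.commute)
  qed
  then obtain d where d: "D \<longlonglongrightarrow> d" using decseq_convergent[of D 1] D1 by blast
  \<comment> \<open>These are the powers of \<open>g \<star> g\<close> with \<open>n + 1\<close> factors, normalised.\<close>
  define h where "h n = (\<lambda>x. complex_of_real (1 / r ^ Suc n) * P (2 * n + 1) x)" for n
  have conth: "cont (h n)" for n unfolding h_def by (intro continuous_intros contP)
  have starh: "star (h n) = h n" for n
    using starP[of "2 * n + 1"] by (auto simp: h_def star_def fun_eq_iff)
  have hh: "conv (h m) (h n) = (\<lambda>x. complex_of_real (1 / r ^ (m + n + 2)) * P (2 * (m + n + 1) + 1) x)" for m n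
    unfolding h_def conv_cmult_left conv_cmult_right PP by (rule ext) (simp add: power_add algebra_simps)
  have hh0: "conv (h m) (h n) 0 = D (m + n + 1)" for m n
    unfolding hh P_0 by (simp add: D_def)
  have sqh: "sq (\<lambda>x. h m x - h n x) = D (2 * m + 1) - 2 * D (m + n + 1) + D (2 * n + 1)" for m n
  proof -
    define k where "k = (\<lambda>x. h m x - h n x)"
    have "star k = k" using starh[of m] starh[of n] by (auto simp: k_def star_def fun_eq_iff)
    moreover have ck: "cont k" unfolding k_def by (intro continuous_intros conth)
    ultimately have 0: "complex_of_real (sq k) = conv k k 0" using conv_star_0[of k] by simp
    have 1: "conv k k = (\<lambda>x. conv (h m) k x - conv (h n) k x)"
      using conv_diff_left[OF conth conth ck, of m n] unfolding k_def .
    have 2: "conv (h j) k = (\<lambda>x. conv (h j) (h m) x - conv (h j) (h n) x)" for j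
      unfolding k_def by (rule conv_diff_right[OF conth conth conth])
    have "complex_of_real (sq k) = D (m + m + 1) - D (m + n + 1) - (D (n + m + 1) - D (n + n + 1))"
      unfolding 0 1 2 hh0 by (simp only: of_real_diff)
    then have "sq k = D (m + m + 1) - D (m + n + 1) - (D (n + m + 1) - D (n + n + 1))"
      unfolding of_real_eq_iff .
    also have "\<dots> = D (2 * m + 1) - 2 * D (m + n + 1) + D (2 * n + 1)"
      unfolding mult_2[of m] mult_2[of n] add.commute[of n m] by linarith
    finally show ?thesis unfolding k_def .
  qed
  have hSuc: "conv (P 1) (h n) = (\<lambda>x. complex_of_real r * h (Suc n) x)" for n
    unfolding h_def conv_cmult_right PP using rpos by (auto simp: fun_eq_iff)
  define C where "C = sqrt (sq (P 1)) / r"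
  have C: "0 \<le> C" using rpos by (simp add: C_def sq_nonneg)
  \<comment> \<open>One more factor \<open>P 1\<close> turns mean square estimates into uniform ones.\<close>
  have hdiff: "norm (h (Suc m) x - h (Suc n) x) \<le> C * sqrt (sq (\<lambda>x. h m x - h n x))" for m n x
  proof -
    have "complex_of_real r * (h (Suc m) x - h (Suc n) x) = conv (P 1) (\<lambda>x. h m x - h n x) x"
      unfolding conv_diff_right[OF conth conth contP] hSuc by (simp add: right_diff_distrib)
    then have "r * norm (h (Suc m) x - h (Suc n) x) = norm (conv (P 1) (\<lambda>x. h m x - h n x) x)"
      using rpos by (metis abs_of_pos norm_mult norm_of_real)
    also have "\<dots> \<le> sqrt (sq (P 1)) * sqrt (sq (\<lambda>x. h m x - h n x))"
      by (intro norm_conv_le contP continuous_intros conth)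
    finally show ?thesis using rpos by (simp add: C_def divide_simps mult.commute)
  qed
  have "uniformly_Cauchy_on UNIV h"
  proof (rule uniformly_Cauchy_onI')
    fix e :: real assume "0 < e"
    \<comment> \<open>By \<open>sqh\<close>, the mean square of \<open>h m - h n\<close> stays below \<open>4 * \<delta>\<close> once all moments are within \<open>\<delta>\<close> of \<open>d\<close>.\<close>
    define \<delta> where "\<delta> = (e / (C + 1))\<^sup>2 / 4"
    have "0 < \<delta>" using \<open>0 < e\<close> C by (simp add: \<delta>_def)
    then obtain N where N: "\<And>n. n \<ge> N \<Longrightarrow> \<bar>D n - d\<bar> < \<delta>"
      using d unfolding LIMSEQ_iff real_norm_def by blast
    show "\<exists>K. \<forall>x\<in>UNIV. \<forall>m\<ge>K. \<forall>n>m. dist (h m x) (h n x) < e"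
    proof (intro exI allI impI ballI)
      fix x :: 'g and m n assume mn: "Suc N \<le> m" "m < n"
      then obtain m' n' where *: "m = Suc m'" "n = Suc n'" by (cases m; cases n) auto
      have "N \<le> 2 * m' + 1" "N \<le> m' + n' + 1" "N \<le> 2 * n' + 1" using mn * by auto
      from this[THEN N] have "sq (\<lambda>x. h m' x - h n' x) < 4 * \<delta>" unfolding sqh by linarith
      then have "sqrt (sq (\<lambda>x. h m' x - h n' x)) < sqrt (4 * \<delta>)" by simp
      also have "sqrt (4 * \<delta>) = e / (C + 1)" using \<open>0 < e\<close> C by (simp add: \<delta>_def)
      finally have "(C + 1) * sqrt (sq (\<lambda>x. h m' x - h n' x)) < e"
        using C by (simp add: divide_simps mult.commute)
      moreover have "C * sqrt (sq (\<lambda>x. h m' x - h n' x)) \<le> (C + 1) * sqrt (sq (\<lambda>x. h m' x - h n' x))"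
        by (intro mult_right_mono) (auto simp: sq_nonneg)
      ultimately show "dist (h m x) (h n x) < e" using hdiff[of m' x n'] by (simp add: * dist_norm)
    qed
  qed
  then obtain p where p: "uniform_limit UNIV h p sequentially"
    using Cauchy_uniformly_convergent[of UNIV h] unfolding uniformly_convergent_on_def by auto
  have contp: "cont p" by (rule uniform_limit_theorem[OF _ p]) (auto simp: conth)
  have hp: "(\<lambda>n. h n x) \<longlonglongrightarrow> p x" for x by (rule tendsto_uniform_limitI[OF p UNIV_I])
  have hpS: "(\<lambda>n. h (s n) x) \<longlonglongrightarrow> p x" if "strict_mono s" for s x
    using LIMSEQ_subseq_LIMSEQ[OF hp that] by (simp add: o_def)
  have "star p = p"
  proof
    fix x
    have "(\<lambda>n. star (h n) x) \<longlonglongrightarrow> star p x" unfolding star_def by (intro tendsto_intros hp)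
    then show "star p x = p x" unfolding starh using hp[of x] by (rule LIMSEQ_unique)
  qed
  moreover have "conv p p = p"
  proof
    fix x
    have "(\<lambda>n. conv (h n) (h n) x) \<longlonglongrightarrow> conv p p x"
      by (intro tendsto_conv_uniform conth contp p)
    moreover have "conv (h n) (h n) x = h (2 * n + 1) x" for n
      unfolding hh by (simp add: h_def mult_2)
    moreover have "strict_mono (\<lambda>n::nat. 2 * n + 1)" by (simp add: strict_mono_def)
    ultimately show "conv p p x = p x"
      using hpS[of "\<lambda>n. 2 * n + 1" x] by (auto intro: LIMSEQ_unique)
  qed
  moreover have "p \<noteq> (\<lambda>x. 0)"
  proof -
    have "(\<lambda>n. h n 0) \<longlonglongrightarrow> complex_of_real d"
      using tendsto_of_real[OF d, where 'a = complex] unfolding h_def P_0 by (simp add: D_def)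
    then have "p 0 = d" by (rule LIMSEQ_unique[OF hp])
    moreover have "1 \<le> d" using d D1 by (intro LIMSEQ_le_const) auto
    ultimately show ?thesis by auto
  qed
  moreover have "conv (conv g g) p = (\<lambda>x. complex_of_real r * p x)"
  proof
    fix x
    have "(\<lambda>n. conv (P 1) (h n) x) \<longlonglongrightarrow> conv (P 1) p x"
      by (intro tendsto_conv_uniform conth contp p contP) (auto intro!: uniform_limit_intros)
    then have "(\<lambda>n. complex_of_real r * h (Suc n) x) \<longlonglongrightarrow> conv (conv g g) p x"
      unfolding hSuc by (simp add: P_def)
    moreover have "(\<lambda>n. complex_of_real r * h (Suc n) x) \<longlonglongrightarrow> complex_of_real r * p x"
      by (intro tendsto_intros hpS) (simp add: strict_mono_Suc_iff)
    ultimately show "conv (conv g g) p x = complex_of_real r * p x" by (rule LIMSEQ_unique)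
  qed
  ultimately show ?thesis using that rpos contp by blast
qed

text \<open>The mean square of \<open>e\<close> is the dimension of the range of the projection given by convolution with \<open>e\<close>;
it is at least \<open>1\<close> because \<open>\<bar>e\<bar>\<close> never exceeds it.\<close>

lemma idempotent_sq:
  assumes "cont e" "conv e e = e" "star e = e"
  shows "e 0 = sq e" "norm (e x) \<le> sq e" "e \<noteq> (\<lambda>x. 0) \<Longrightarrow> 1 \<le> sq e"
proof -
  show "e 0 = sq e" using conv_star_0[OF assms(1)] assms by simp
  have le: "norm (e x) \<le> sq e" for x using norm_conv_le[of e e x] assms by (simp add: sq_nonneg)
  then show "norm (e x) \<le> sq e" .
  have "sq e \<le> (sq e)\<^sup>2" using le by (intro sq_le assms)
  moreover assume "e \<noteq> (\<lambda>x. 0)"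
  then have "0 < sq e" by (intro sq_pos assms)
  ultimately show "1 \<le> sq e" by (simp add: power2_eq_square)
qed

text \<open>An idempotent \<open>e\<close> below \<open>p\<close> of minimal dimension has no proper part. Hence every self-adjoint element
of its range is a real multiple of \<open>e\<close>: by power iteration its square is a multiple of \<open>e\<close>, so after
scaling it is a symmetry \<open>b\<close>, and then \<open>(e + b) / 2\<close> is an idempotent below \<open>e\<close>, thus \<open>0\<close> or \<open>e\<close>.
The translates of \<open>e\<close> lie in the range of \<open>e\<close> and are combinations of two self-adjoint elements, so
they are multiples of \<open>e\<close>. This says that \<open>e / e 0\<close> is multiplicative.\<close>

lemma idempotent_contains_character:
  assumes p: "cont p" "conv p p = p" "star p = p" "p \<noteq> (\<lambda>x. 0)"
  obtains \<gamma> where "\<gamma> \<in> characters" "conv p \<gamma> = \<gamma>"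
proof -
  define Q where "Q e \<longleftrightarrow> cont e \<and> conv e e = e \<and> star e = e \<and> e \<noteq> (\<lambda>x. 0) \<and> conv p e = e" for e
  have "Q p" using p by (simp add: Q_def)
  \<comment> \<open>A proper part lowers the mean square by at least \<open>1\<close>, hence lowers its integer part, which attains a
minimum.\<close>
  then obtain e where e: "Q e" and min: "\<And>q. Q q \<Longrightarrow> nat \<lfloor>sq e\<rfloor> \<le> nat \<lfloor>sq q\<rfloor>"
    using ex_has_least_nat[of Q p "\<lambda>e. nat \<lfloor>sq e\<rfloor>"] by blast
  have ce: "cont e" and ee: "conv e e = e" and se: "star e = e" and e0: "e \<noteq> (\<lambda>x. 0)" and pe: "conv p e = e"
    using e by (auto simp: Q_def)
  have sub: "q = e" if q: "cont q" "conv q q = q" "star q = q" "q \<noteq> (\<lambda>x. 0)" "conv e q = q" for q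
  proof (rule ccontr)
    assume "q \<noteq> e"
    define d where "d = (\<lambda>x. e x - q x)"
    have "conv p q = q" using q(5) pe conv_assoc[OF p(1) ce q(1)] by simp
    then have "Q q" using q by (simp add: Q_def)
    have cd: "cont d" unfolding d_def by (intro continuous_intros ce q)
    have "conv q e = q" using conv_comm q(1,5) ce by simp
    then have "conv d d = d"
      unfolding d_def using q ee ce
      by (simp add: conv_diff_left conv_diff_right continuous_on_diff)
    moreover have "star d = d" using q se by (auto simp: d_def star_def fun_eq_iff)
    moreover have "d \<noteq> (\<lambda>x. 0)" using \<open>q \<noteq> e\<close> unfolding d_def fun_eq_iff by (metis right_minus_eq)
    ultimately have "1 \<le> sq d" "d 0 = sq d" using idempotent_sq[OF cd] by auto
    moreover have "d 0 = sq e - sq q"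
      using idempotent_sq(1)[OF ce ee se] idempotent_sq(1)[OF q(1-3)] by (simp add: d_def)
    ultimately have "1 \<le> sq e - sq q" by (metis of_real_diff of_real_eq_iff)
    moreover have "1 \<le> sq q" using idempotent_sq(3)[OF q(1-3)] q(4) by simp
    ultimately have "nat \<lfloor>sq q\<rfloor> < nat \<lfloor>sq e\<rfloor>" by linarith
    with min[OF \<open>Q q\<close>] show False by simp
  qed
  have selfadj: "\<exists>z. a = (\<lambda>x. complex_of_real z * e x)"
    if a: "cont a" "star a = a" "conv e a = a" for a
  proof (cases "a = (\<lambda>x. 0)")
    case True then show ?thesis by (intro exI[of _ 0]) simp
  next
    case False
    then obtain r q where q: "0 < r" "cont q" "conv q q = q" "star q = q" "q \<noteq> (\<lambda>x. 0)"
      "conv (conv a a) q = (\<lambda>x. complex_of_real r * q x)"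
      using power_iteration[OF a(1,2)] by metis
    have "conv e (conv (conv a a) q) = conv (conv a a) q"
      using conv_assoc[OF a(1) a(1) q(2)] conv_assoc[OF ce a(1) cont_conv[OF a(1) q(2)]] a(3) by simp
    then have "conv e q = q"
      using q(1) unfolding q(6) conv_cmult_right by (auto simp: fun_eq_iff)
    then have "q = e" using sub q by simp
    moreover have ae: "conv a e = a" using conv_comm a ce by simp
    ultimately have aa: "conv a a = (\<lambda>x. complex_of_real r * e x)"
      using q(6) conv_assoc[of a a e] a ce by simp
    define b where "b = (\<lambda>x. complex_of_real (1 / sqrt r) * a x)"
    have cb: "cont b" unfolding b_def by (intro continuous_intros a)
    have r2: "complex_of_real (1 / sqrt r) * (complex_of_real (1 / sqrt r) * (complex_of_real r * z)) = z" for z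
    proof -
      have "complex_of_real (1 / sqrt r) * (complex_of_real (1 / sqrt r) * (complex_of_real r * z))
        = complex_of_real (1 / sqrt r * (1 / sqrt r) * r) * z" by (simp only: of_real_mult mult.assoc)
      also have "1 / sqrt r * (1 / sqrt r) * r = 1" using q(1) by simp
      finally show ?thesis by simp
    qed
    have bb: "conv b b = e"
      unfolding b_def conv_cmult_left conv_cmult_right aa by (simp only: r2)
    have be: "conv b e = b" "conv e b = b" unfolding b_def conv_cmult_left conv_cmult_right ae a(3) by auto
    have sb: "star b = b" using a(2) by (auto simp: b_def star_def fun_eq_iff)
    define c where "c = (\<lambda>x. complex_of_real (1/2) * (e x + b x))"
    have cc: "cont c" unfolding c_def by (intro continuous_intros cb ce)
    have ec: "conv e c = c" unfolding c_def conv_cmult_right by (simp add: conv_add_right ce cb ee be)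
    have "conv c c = c"
      unfolding c_def conv_cmult_right conv_cmult_left
      by (simp add: conv_add_right conv_add_left ce cb ee be bb continuous_on_add fun_eq_iff field_simps)
    moreover have "star c = c" using se sb by (auto simp: c_def star_def fun_eq_iff)
    ultimately have "c = (\<lambda>x. 0) \<or> c = e" using sub cc ec by blast
    then have "b = (\<lambda>x. - e x) \<or> b = e"
      by (auto simp: c_def fun_eq_iff eq_neg_iff_add_eq_0 add.commute)
    moreover have "a = (\<lambda>x. complex_of_real (sqrt r) * b x)"
      using q(1) by (auto simp: b_def fun_eq_iff)
    ultimately have "a = (\<lambda>x. complex_of_real (- sqrt r) * e x) \<or> a = (\<lambda>x. complex_of_real (sqrt r) * e x)" by auto
    then show ?thesis by blast
  qed
  have translate: "\<exists>z. \<forall>x. e (x + s) = z * e x" for s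
  proof -
    have ct: "cont (\<lambda>x. e (x + t))" for t by (rule cont_translate[OF ce])
    have et: "conv e (\<lambda>x. e (x + t)) = (\<lambda>x. e (x + t))" for t
      using conv_comm[OF ce ct, of t] conv_translate[of e t e] ee by simp
    have se': "cnj (e (- x)) = e x" for x using se by (simp add: star_def fun_eq_iff)
    \<comment> \<open>The self-adjoint and the skew part of the translate by \<open>s\<close>, up to scalars.\<close>
    define a where "a = (\<lambda>x. e (x + s) + e (x + (- s)))"
    define b where "b = (\<lambda>x. \<i> * (e (x + s) - e (x + (- s))))"
    have "cont a" "cont b" unfolding a_def b_def by (intro continuous_intros ct)+
    moreover have "star a = a"
      unfolding a_def star_def using se'[of "x + s" for x] se'[of "x - s" for x] by (auto simp: fun_eq_iff)
    moreover have "star b = b"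
      unfolding b_def star_def using se'[of "x + s" for x] se'[of "x - s" for x] by (auto simp: fun_eq_iff algebra_simps)
    moreover have "conv e a = a" unfolding a_def by (simp only: conv_add_right ce ct et)
    moreover have "conv e b = b"
      unfolding b_def conv_cmult_right by (simp only: conv_diff_right ce ct et)
    ultimately obtain y z where y: "a = (\<lambda>x. complex_of_real y * e x)" and z: "b = (\<lambda>x. complex_of_real z * e x)"
      using selfadj by metis
    have ex: "e (x + s) = (a x - \<i> * b x) / 2" for x by (simp add: a_def b_def algebra_simps)
    have "e (x + s) = ((complex_of_real y - \<i> * z) / 2) * e x" for x
      unfolding ex fun_cong[OF y, of x] fun_cong[OF z, of x] by (simp add: field_simps)
    then show ?thesis by blast
  qed
  have se0: "0 < sq e" by (rule sq_pos[OF ce e0])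
  have e_0: "e 0 = sq e" by (rule idempotent_sq(1)[OF ce ee se])
  define \<gamma> where "\<gamma> = (\<lambda>x. complex_of_real (1 / sq e) * e x)"
  have \<gamma>add: "\<gamma> (x + s) = \<gamma> x * \<gamma> s" for x s
  proof -
    obtain z where z: "\<And>x. e (x + s) = z * e x" using translate by blast
    from z[of 0] have "e s = z * sq e" by (simp add: e_0)
    then show ?thesis using z[of x] se0 by (simp add: \<gamma>_def)
  qed
  have \<gamma>le: "norm (\<gamma> x) \<le> 1" for x
    using idempotent_sq(2)[OF ce ee se, of x] se0 by (simp add: \<gamma>_def norm_mult norm_divide divide_simps)
  have "\<gamma> 0 = 1" using se0 by (simp add: \<gamma>_def e_0)
  then have inv: "norm (\<gamma> x) * norm (\<gamma> (- x)) = 1" for x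
    using \<gamma>add[of x "- x"] by (metis add.right_inverse norm_mult norm_one)
  have \<gamma>1: "norm (\<gamma> x) = 1" for x
  proof -
    have "norm (\<gamma> x) * norm (\<gamma> (- x)) \<le> norm (\<gamma> x) * 1" by (intro mult_left_mono \<gamma>le) auto
    then show ?thesis using \<gamma>le[of x] inv[of x] by simp
  qed
  have "cont \<gamma>" unfolding \<gamma>_def by (intro continuous_intros ce)
  then have "\<gamma> \<in> characters" using \<gamma>1 \<gamma>add by (simp add: characters_def)
  moreover have "conv p \<gamma> = \<gamma>" unfolding \<gamma>_def conv_cmult_right pe ..
  ultimately show ?thesis using that by blast
qed

text \<open>Fourier coefficients, for the measure of total mass one.\<close>

definition fcoeff :: "('g \<Rightarrow> complex) \<Rightarrow> ('g \<Rightarrow> complex) \<Rightarrow> complex" where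
  "fcoeff u \<gamma> = mean (\<lambda>x. u x * cnj (\<gamma> x))"

lemma characterD:
  assumes "\<gamma> \<in> characters"
  shows "cont \<gamma>" "norm (\<gamma> x) = 1" "\<gamma> (x + y) = \<gamma> x * \<gamma> y" "\<gamma> 0 = 1" "\<gamma> (- x) = cnj (\<gamma> x)"
    "\<gamma> x * cnj (\<gamma> x) = 1" "\<gamma> x \<noteq> 0" "\<gamma> (x - y) = \<gamma> x * cnj (\<gamma> y)"
proof -
  show c: "cont \<gamma>" and n: "norm (\<gamma> x) = 1" and a: "\<gamma> (x + y) = \<gamma> x * \<gamma> y" for x y
    using assms by (auto simp: characters_def)
  show nz: "\<gamma> x \<noteq> 0" for x using n[of x] by auto
  show z: "\<gamma> 0 = 1" using a[of 0 0] nz[of 0] by simp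
  show i: "\<gamma> x * cnj (\<gamma> x) = 1" for x using n[of x] by (simp add: complex_norm_square[symmetric])
  have "\<gamma> x * \<gamma> (- x) = \<gamma> x * cnj (\<gamma> x)" using a[of x "- x"] z i by simp
  then show m: "\<gamma> (- x) = cnj (\<gamma> x)" for x using nz a[of x "- x"] z i
    by (metis add.right_inverse mult_left_cancel)
  show "\<gamma> (x - y) = \<gamma> x * cnj (\<gamma> y)" using a[of x "- y"] m by simp
qed

lemma conv_character:
  assumes "\<gamma> \<in> characters" "cont u"
  shows "conv u \<gamma> = (\<lambda>x. fcoeff u \<gamma> * \<gamma> x)"
proof
  fix x
  have "conv u \<gamma> x = conv \<gamma> u x" using conv_comm assms characterD(1) by metis
  also have "\<dots> = fcoeff u \<gamma> * \<gamma> x"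
    by (simp add: conv_def fcoeff_def characterD(8)[OF assms(1)] mean_cmult[symmetric] mult.commute mult.assoc mult.left_commute)
  finally show "conv u \<gamma> x = fcoeff u \<gamma> * \<gamma> x" .
qed

text \<open>If all coefficients of \<open>u\<close> vanish, then convolution with \<open>g = star u \<star> u\<close> kills every character, whereas
power iteration provides one in the range of \<open>p\<close>, on which \<open>g \<star> g\<close> acts as \<open>r > 0\<close>.\<close>

theorem fourier_uniqueness:
  assumes u: "cont u" and z: "\<And>\<gamma>. \<gamma> \<in> characters \<Longrightarrow> fcoeff u \<gamma> = 0"
  shows "u = (\<lambda>x. 0)"
proof (rule ccontr)
  assume "u \<noteq> (\<lambda>x. 0)"
  define g where "g = conv (star u) u"
  have cg: "cont g" unfolding g_def by (intro cont_conv cont_star u)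
  have "star g = g" unfolding g_def using conv_comm[of u "star u"] u by (simp add: star_conv cont_star)
  moreover have "g 0 = sq u" using conv_star_0[OF u] conv_comm[of u "star u"] u cont_star unfolding g_def by simp
  then have "g \<noteq> (\<lambda>x. 0)" using sq_pos[OF u \<open>u \<noteq> (\<lambda>x. 0)\<close>] by auto
  ultimately obtain r p where p: "0 < r" "cont p" "conv p p = p" "star p = p" "p \<noteq> (\<lambda>x. 0)"
    "conv (conv g g) p = (\<lambda>x. complex_of_real r * p x)"
    using power_iteration[OF cg] by metis
  obtain \<gamma> where \<gamma>: "\<gamma> \<in> characters" "conv p \<gamma> = \<gamma>"
    using idempotent_contains_character[OF p(2-5)] by metis
  have c\<gamma>: "cont \<gamma>" by (rule characterD(1)[OF \<gamma>(1)])
  have "conv u \<gamma> = (\<lambda>x. 0)" using conv_character[OF \<gamma>(1) u] z[OF \<gamma>(1)] by simp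
  moreover have conv0: "conv w (\<lambda>x. 0) = (\<lambda>x. 0)" for w by (rule ext) (simp add: conv_def mean_const)
  ultimately have g\<gamma>: "conv g \<gamma> = (\<lambda>x. 0)"
    unfolding g_def conv_assoc[OF cont_star[OF u] u c\<gamma>] by simp
  have "(\<lambda>x. complex_of_real r * \<gamma> x) = conv (conv (conv g g) p) \<gamma>"
    unfolding p(6) conv_cmult_left \<gamma>(2) ..
  also have "\<dots> = conv g (conv g \<gamma>)"
    using cg p(2) c\<gamma> \<gamma>(2) by (simp add: conv_assoc cont_conv)
  also have "\<dots> = (\<lambda>x. 0)" unfolding g\<gamma> by (rule conv0)
  finally have "complex_of_real r * \<gamma> 0 = 0" by (rule fun_cong)
  then show False using p(1) characterD(4)[OF \<gamma>(1)] by simp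
qed

section \<open>Absolutely convergent Fourier series\<close>

lemma trivial_character: "(\<lambda>_. 1) \<in> characters"
  by (simp add: characters_def)

lemma character_mult:
  assumes "\<gamma> \<in> characters" "\<delta> \<in> characters" shows "(\<lambda>x. \<gamma> x * \<delta> x) \<in> characters"
  using assms by (auto simp: characters_def norm_mult intro!: continuous_intros)

lemma character_cnj: assumes "\<gamma> \<in> characters" shows "(\<lambda>x. cnj (\<gamma> x)) \<in> characters"
  using assms by (auto simp: characters_def intro!: continuous_intros)

text \<open>Translation by \<open>a\<close> multiplies the mean by \<open>\<gamma> a\<close>.\<close>

lemma mean_character:
  assumes "\<gamma> \<in> characters" shows "mean \<gamma> = (if \<gamma> = (\<lambda>_. 1) then 1 else 0)"
proof (cases "\<gamma> = (\<lambda>_. 1)")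
  case True then show ?thesis by (simp add: mean_const)
next
  case False
  then obtain a where a: "\<gamma> a \<noteq> 1" by auto
  have "mean \<gamma> = mean (\<lambda>x. \<gamma> (x + a))" by (rule mean_translation[symmetric, OF characterD(1)[OF assms]])
  also have "\<dots> = \<gamma> a * mean \<gamma>"
    unfolding characterD(3)[OF assms] by (simp add: mean_cmult[symmetric] mult.commute)
  finally show ?thesis using a False by simp
qed

lemma fcoeff_character:
  assumes "\<gamma> \<in> characters" "\<delta> \<in> characters"
  shows "fcoeff \<gamma> \<delta> = (if \<gamma> = \<delta> then 1 else 0)"
proof -
  have "(\<lambda>x. \<gamma> x * cnj (\<delta> x)) = (\<lambda>_. 1) \<longleftrightarrow> \<gamma> = \<delta>"
  proof
    assume "(\<lambda>x. \<gamma> x * cnj (\<delta> x)) = (\<lambda>_. 1)"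
    then have "\<gamma> x * cnj (\<delta> x) = \<delta> x * cnj (\<delta> x)" for x
      using characterD(6)[OF assms(2)] by (metis (no_types))
    then show "\<gamma> = \<delta>" using characterD(7)[OF assms(2)] by (auto simp: fun_eq_iff)
  qed (use characterD(6)[OF assms(2)] in auto)
  then show ?thesis unfolding fcoeff_def
    using mean_character[OF character_mult[OF assms(1) character_cnj[OF assms(2)]]] by simp
qed

lemma L2_integrable: assumes "\<xi> \<in> L2 M" shows "integrable M \<xi>"
  using L2_integrable_mult[OF assms cont_L2, of "\<lambda>_. 1"] by simp

lemma mean_sum:
  assumes "\<And>\<gamma>. \<gamma> \<in> F \<Longrightarrow> integrable M (k \<gamma>)"
  shows "mean (\<lambda>x. \<Sum>\<gamma>\<in>F. c \<gamma> * k \<gamma> x) = (\<Sum>\<gamma>\<in>F. c \<gamma> * mean (k \<gamma>))"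
  using assms by (simp add: mean_def sum_divide_distrib)

lemma fcoeff_trig:
  assumes F: "finite F" "F \<subseteq> characters" and \<gamma>: "\<gamma> \<in> F"
  shows "fcoeff (\<lambda>x. \<Sum>\<gamma>\<in>F. b \<gamma> * \<gamma> x) \<gamma> = b \<gamma>"
proof -
  have ch: "\<gamma> \<in> F \<Longrightarrow> \<gamma> \<in> characters" for \<gamma> using F by auto
  have "fcoeff (\<lambda>x. \<Sum>\<gamma>\<in>F. b \<gamma> * \<gamma> x) \<gamma> = mean (\<lambda>x. \<Sum>\<delta>\<in>F. b \<delta> * (\<delta> x * cnj (\<gamma> x)))"
    by (simp add: fcoeff_def sum_distrib_right mult.assoc)
  also have "\<dots> = (\<Sum>\<delta>\<in>F. b \<delta> * fcoeff \<delta> \<gamma>)"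
    unfolding fcoeff_def using \<gamma> ch
    by (intro mean_sum cont_integrable continuous_intros characterD(1)) auto
  also have "\<dots> = (\<Sum>\<delta>\<in>F. if \<delta> = \<gamma> then b \<gamma> else 0)"
    using \<gamma> ch by (intro sum.cong) (auto simp: fcoeff_character)
  also have "\<dots> = b \<gamma>" using F \<gamma> by simp
  finally show ?thesis .
qed

lemma cont_trig: "F \<subseteq> characters \<Longrightarrow> cont (\<lambda>x. \<Sum>\<gamma>\<in>F. b \<gamma> * \<gamma> x)"
  by (intro continuous_intros) (auto simp: characters_def)

text \<open>With \<open>s\<close> the partial Fourier sum over \<open>F\<close> and \<open>S\<close> the left-hand side, both the pairing of \<open>\<xi>\<close> with \<open>s\<close>
and that of \<open>s\<close> with itself equal \<open>S\<close>, so the mean square of \<open>\<xi> - s\<close> is \<open>sq \<xi> - S\<close>.\<close>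

lemma Bessel:
  assumes \<xi>: "\<xi> \<in> L2 M" and F: "finite F" "F \<subseteq> characters"
  shows "(\<Sum>\<gamma>\<in>F. (norm (fcoeff \<xi> \<gamma>))\<^sup>2) \<le> sq \<xi>"
proof -
  define s where "s = (\<lambda>x. \<Sum>\<gamma>\<in>F. fcoeff \<xi> \<gamma> * \<gamma> x)"
  define S where "S = (\<Sum>\<gamma>\<in>F. (norm (fcoeff \<xi> \<gamma>))\<^sup>2)"
  have ch: "\<gamma> \<in> F \<Longrightarrow> \<gamma> \<in> characters" for \<gamma> using F by auto
  have cs: "cont s" unfolding s_def using F(2) by (intro continuous_intros) (auto simp: characters_def)
  have sL: "s \<in> L2 M" by (rule cont_L2[OF cs])
  have fc: "fcoeff s \<gamma> = fcoeff \<xi> \<gamma>" if "\<gamma> \<in> F" for \<gamma>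
    unfolding s_def by (rule fcoeff_trig[OF F that])
  have pair: "mean (\<lambda>x. u x * cnj (s x)) = S" if u: "u \<in> L2 M" "\<And>\<gamma>. \<gamma> \<in> F \<Longrightarrow> fcoeff u \<gamma> = fcoeff \<xi> \<gamma>" for u
  proof -
    have "mean (\<lambda>x. u x * cnj (s x)) = mean (\<lambda>x. \<Sum>\<gamma>\<in>F. cnj (fcoeff \<xi> \<gamma>) * (u x * cnj (\<gamma> x)))"
      by (simp add: s_def sum_distrib_left algebra_simps)
    also have "\<dots> = (\<Sum>\<gamma>\<in>F. cnj (fcoeff \<xi> \<gamma>) * fcoeff u \<gamma>)"
      unfolding fcoeff_def
      by (intro mean_sum L2_integrable_mult u(1) cont_L2 continuous_intros characterD(1)) (rule ch)
    also have "\<dots> = S" unfolding S_def of_real_sum complex_norm_square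
      using u(2) by (intro sum.cong) (auto simp: mult.commute)
    finally show ?thesis .
  qed
  define d where "d = (\<lambda>x. \<xi> x - s x)"
  have dL: "d \<in> L2 M" using L2_add[OF \<xi> L2_cmult[OF sL, of "-1"]] by (simp add: d_def)
  note i = L2_integrable_mult[OF _ L2_cnj]
  have "complex_of_real (sq d) = mean (\<lambda>x. (\<xi> x * cnj (\<xi> x) - \<xi> x * cnj (s x)) - (cnj (\<xi> x * cnj (s x)) - s x * cnj (s x)))"
    unfolding mean_sq[symmetric] d_def by (simp add: algebra_simps)
  also have "\<dots> = (mean (\<lambda>x. \<xi> x * cnj (\<xi> x)) - mean (\<lambda>x. \<xi> x * cnj (s x))) - (mean (\<lambda>x. cnj (\<xi> x * cnj (s x))) - mean (\<lambda>x. s x * cnj (s x)))"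
    by (subst mean_diff mean_diff mean_diff; (intro Bochner_Integration.integrable_diff integrable_cnj i \<xi> sL)?)+ simp
  also have "\<dots> = complex_of_real (sq \<xi> - S)"
    unfolding mean_cnj using pair[OF \<xi>] pair[OF sL fc] by (simp add: mean_sq)
  finally have "sq d = sq \<xi> - S" unfolding of_real_eq_iff .
  then show ?thesis using sq_nonneg[of d] by (simp add: S_def)
qed

text \<open>The function \<open>h\<close> has norm at most \<open>r\<close> in \<open>A(G)\<close>. Bounding the finite partial sums of the coefficients
expresses their absolute summability and the norm estimate at once.\<close>

definition wiener_le :: "real \<Rightarrow> ('g \<Rightarrow> complex) \<Rightarrow> bool" where
  "wiener_le r h \<longleftrightarrow> (\<exists>a. (\<forall>F. finite F \<longrightarrow> F \<subseteq> characters \<longrightarrow> (\<Sum>\<gamma>\<in>F. norm (a \<gamma>)) \<le> r) \<and>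
     (\<forall>x. ((\<lambda>\<gamma>. a \<gamma> * \<gamma> x) has_sum h x) characters))"

text \<open>Completeness of \<open>A(G)\<close> in the form used throughout: series of elements with summable norms may be
summed coefficientwise. The double series over \<open>I \<times> characters\<close> converges absolutely, so the order of
summation is immaterial. Products, finite sums and geometric series are all instances.\<close>

lemma wiener_le_family:
  fixes h :: "'i \<Rightarrow> 'g \<Rightarrow> complex"
  assumes h: "\<And>i. i \<in> I \<Longrightarrow> wiener_le (r i) (h i)"
    and R: "\<And>F. finite F \<Longrightarrow> F \<subseteq> I \<Longrightarrow> sum r F \<le> R"
    and H: "\<And>x. ((\<lambda>i. h i x) has_sum H x) I"
  shows "wiener_le R H"
proof -
  obtain a where a: "\<And>i F. i \<in> I \<Longrightarrow> finite F \<Longrightarrow> F \<subseteq> characters \<Longrightarrow> (\<Sum>\<gamma>\<in>F. norm (a i \<gamma>)) \<le> r i"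
    and ah: "\<And>i x. i \<in> I \<Longrightarrow> ((\<lambda>\<gamma>. a i \<gamma> * \<gamma> x) has_sum h i x) characters"
    using h unfolding wiener_le_def by metis
  have bd: "(\<Sum>p\<in>S. norm (a (fst p) (snd p))) \<le> R" if "finite S" "S \<subseteq> I \<times> characters" for S
  proof -
    have "(\<Sum>p\<in>S. norm (a (fst p) (snd p))) \<le> (\<Sum>p\<in>fst ` S \<times> snd ` S. norm (a (fst p) (snd p)))"
      using that by (intro sum_mono2) (auto simp: mem_Times_iff intro: rev_image_eqI)
    also have "\<dots> = (\<Sum>i\<in>fst ` S. \<Sum>\<gamma>\<in>snd ` S. norm (a i \<gamma>))"
      by (simp add: sum.cartesian_product case_prod_beta)
    also have "\<dots> \<le> (\<Sum>i\<in>fst ` S. r i)" using that by (intro sum_mono a) auto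
    also have "\<dots> \<le> R" using that by (intro R) auto
    finally show ?thesis .
  qed
  have abs: "(\<lambda>p. norm (a (fst p) (snd p))) summable_on I \<times> characters"
    using bd by (intro nonneg_bdd_above_summable_on) (auto intro!: bdd_aboveI2[where M = R])
  have sum0: "(\<lambda>p. a (fst p) (snd p)) summable_on I \<times> characters"
    by (rule abs_summable_summable[OF abs])
  have sumx: "(\<lambda>p. a (fst p) (snd p) * snd p x) summable_on I \<times> characters" for x
    by (rule abs_summable_summable, rule summable_on_cong[THEN iffD1, OF _ abs])
      (auto simp: norm_mult characterD(2))
  define b where "b \<gamma> = infsum (\<lambda>i. a i \<gamma>) I" for \<gamma>
  have hb: "((\<lambda>i. a i \<gamma>) has_sum b \<gamma>) I" if "\<gamma> \<in> characters" for \<gamma>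
    unfolding b_def using summable_on_SigmaD1[of "\<lambda>\<gamma> i. a i \<gamma>" characters "\<lambda>_. I", OF _ that] sum0
    by (subst (asm) summable_on_swap) (auto simp: case_prod_beta intro!: has_sum_infsum)
  have "((\<lambda>\<gamma>. b \<gamma> * \<gamma> x) has_sum H x) characters" for x
  proof -
    obtain S where S: "((\<lambda>p. a (fst p) (snd p) * snd p x) has_sum S) (I \<times> characters)"
      using sumx[of x] by (auto simp: summable_on_def)
    have "((\<lambda>i. h i x) has_sum S) I" using S by (rule has_sum_SigmaD) (simp add: ah)
    then have "S = H x" using H[of x] infsumI by blast
    moreover have "((\<lambda>\<gamma>. b \<gamma> * \<gamma> x) has_sum S) characters"
      using S[THEN has_sum_swap[THEN iffD1]] by (rule has_sum_SigmaD) (simp add: has_sum_cmult_left hb)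
    ultimately show ?thesis by simp
  qed
  moreover have "(\<Sum>\<gamma>\<in>F. norm (b \<gamma>)) \<le> R" if F: "finite F" "F \<subseteq> characters" for F
  proof -
    have hn: "(\<lambda>i. norm (a i \<gamma>)) summable_on I" if "\<gamma> \<in> characters" for \<gamma>
      using summable_on_SigmaD1[of "\<lambda>\<gamma> i. norm (a i \<gamma>)" characters "\<lambda>_. I", OF _ that] abs
      by (subst (asm) summable_on_swap) (auto simp: case_prod_beta)
    have "(\<Sum>\<gamma>\<in>F. norm (b \<gamma>)) \<le> (\<Sum>\<gamma>\<in>F. infsum (\<lambda>i. norm (a i \<gamma>)) I)"
      unfolding b_def using F hn by (intro sum_mono norm_infsum_bound) auto
    also have "\<dots> \<le> R"
    proof (rule has_sum_le_finite_sums)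
      show "((\<lambda>i. \<Sum>\<gamma>\<in>F. norm (a i \<gamma>)) has_sum (\<Sum>\<gamma>\<in>F. infsum (\<lambda>i. norm (a i \<gamma>)) I)) I"
        using F hn by (induction F rule: finite_induct) (auto intro!: has_sum_add)
      fix G assume G: "finite G" "G \<subseteq> I"
      have "(\<Sum>i\<in>G. \<Sum>\<gamma>\<in>F. norm (a i \<gamma>)) \<le> (\<Sum>i\<in>G. r i)" using G F by (intro sum_mono a) auto
      also have "\<dots> \<le> R" by (rule R[OF G])
      finally show "(\<Sum>i\<in>G. \<Sum>\<gamma>\<in>F. norm (a i \<gamma>)) \<le> R" .
    qed
    finally show ?thesis .
  qed
  ultimately show ?thesis unfolding wiener_le_def by blast
qed

lemma wiener_le_nonneg: "wiener_le r h \<Longrightarrow> 0 \<le> r"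
  unfolding wiener_le_def by (metis empty_subsetI finite.emptyI sum.empty)

lemma wiener_le_mono: "wiener_le r h \<Longrightarrow> r \<le> s \<Longrightarrow> wiener_le s h"
  unfolding wiener_le_def by (meson order_trans)

lemma wiener_le_bound:
  assumes "wiener_le r h" shows "norm (h x) \<le> r"
proof -
  obtain a where a: "\<And>F. finite F \<Longrightarrow> F \<subseteq> characters \<Longrightarrow> (\<Sum>\<gamma>\<in>F. norm (a \<gamma>)) \<le> r"
    and h: "((\<lambda>\<gamma>. a \<gamma> * \<gamma> x) has_sum h x) characters"
    using assms unfolding wiener_le_def by blast
  show ?thesis
  proof (rule tendsto_upperbound[OF tendsto_norm[OF h[unfolded has_sum_def]]])
    show "\<forall>\<^sub>F F in finite_subsets_at_top characters. norm (\<Sum>\<gamma>\<in>F. a \<gamma> * \<gamma> x) \<le> r"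
    proof (rule eventually_finite_subsets_at_top_weakI)
      fix F :: "('g \<Rightarrow> complex) set" assume F: "finite F" "F \<subseteq> characters"
      have "norm (\<Sum>\<gamma>\<in>F. a \<gamma> * \<gamma> x) \<le> (\<Sum>\<gamma>\<in>F. norm (a \<gamma>))"
        using F by (intro sum_norm_le) (auto simp: norm_mult characterD(2))
      then show "norm (\<Sum>\<gamma>\<in>F. a \<gamma> * \<gamma> x) \<le> r" using a[OF F] by linarith
    qed
  qed simp
qed

lemma wiener_le_cmult:
  assumes "wiener_le r h" shows "wiener_le (norm c * r) (\<lambda>x. c * h x)"
proof -
  obtain a where a: "\<And>F. finite F \<Longrightarrow> F \<subseteq> characters \<Longrightarrow> (\<Sum>\<gamma>\<in>F. norm (a \<gamma>)) \<le> r"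
    and h: "\<And>x. ((\<lambda>\<gamma>. a \<gamma> * \<gamma> x) has_sum h x) characters"
    using assms unfolding wiener_le_def by blast
  show ?thesis unfolding wiener_le_def
  proof (intro exI[of _ "\<lambda>\<gamma>. c * a \<gamma>"] conjI allI impI)
    fix F :: "('g \<Rightarrow> complex) set" assume "finite F" "F \<subseteq> characters"
    then show "(\<Sum>\<gamma>\<in>F. norm (c * a \<gamma>)) \<le> norm c * r"
      using a by (simp add: norm_mult sum_distrib_left[symmetric] mult_left_mono)
  qed (use has_sum_cmult_right[OF h, of c] in \<open>simp add: mult.assoc\<close>)
qed

lemma wiener_le_character_mult:
  assumes "wiener_le r h" and \<delta>: "\<delta> \<in> characters" shows "wiener_le r (\<lambda>x. \<delta> x * h x)"
proof -
  obtain a where a: "\<And>F. finite F \<Longrightarrow> F \<subseteq> characters \<Longrightarrow> (\<Sum>\<gamma>\<in>F. norm (a \<gamma>)) \<le> r"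
    and h: "\<And>x. ((\<lambda>\<gamma>. a \<gamma> * \<gamma> x) has_sum h x) characters"
    using assms unfolding wiener_le_def by blast
  define j where "j = (\<lambda>(\<gamma> :: 'g \<Rightarrow> complex) x. cnj (\<delta> x) * \<gamma> x)"
  define i where "i = (\<lambda>(\<gamma> :: 'g \<Rightarrow> complex) x. \<delta> x * \<gamma> x)"
  have ij: "i (j \<gamma>) = \<gamma>" "j (i \<gamma>) = \<gamma>" for \<gamma>
    using characterD(6)[OF \<delta>] by (auto simp: i_def j_def fun_eq_iff mult.assoc[symmetric] mult.commute)
  have ch: "j \<gamma> \<in> characters" "i \<gamma> \<in> characters" if "\<gamma> \<in> characters" for \<gamma>
    using that \<delta> unfolding i_def j_def by (auto intro!: character_mult character_cnj)
  show ?thesis unfolding wiener_le_def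
  proof (intro exI[of _ "\<lambda>\<gamma>. a (j \<gamma>)"] conjI allI impI)
    fix F :: "('g \<Rightarrow> complex) set" assume F: "finite F" "F \<subseteq> characters"
    have "(\<Sum>\<gamma>\<in>F. norm (a (j \<gamma>))) = (\<Sum>\<gamma>\<in>j ` F. norm (a \<gamma>))"
      by (subst sum.reindex) (auto intro!: inj_onI simp: o_def dest: arg_cong[where f = i] simp: ij)
    also have "\<dots> \<le> r" using F ch by (intro a) auto
    finally show "(\<Sum>\<gamma>\<in>F. norm (a (j \<gamma>))) \<le> r" .
  next
    fix x
    have "((\<lambda>\<gamma>. \<delta> x * (a \<gamma> * \<gamma> x)) has_sum \<delta> x * h x) characters"
      by (rule has_sum_cmult_right[OF h])
    moreover have "((\<lambda>\<gamma>. \<delta> x * (a \<gamma> * \<gamma> x)) has_sum \<delta> x * h x) characters =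
      ((\<lambda>\<gamma>. a (j \<gamma>) * \<gamma> x) has_sum \<delta> x * h x) characters"
      by (rule has_sum_reindex_bij_witness[where i = j and j = i])
        (auto simp: ij ch, simp add: i_def)
    ultimately show "((\<lambda>\<gamma>. a (j \<gamma>) * \<gamma> x) has_sum \<delta> x * h x) characters" by simp
  qed
qed

lemma wiener_le_cnj:
  assumes "wiener_le r h" shows "wiener_le r (\<lambda>x. cnj (h x))"
proof -
  obtain a where a: "\<And>F. finite F \<Longrightarrow> F \<subseteq> characters \<Longrightarrow> (\<Sum>\<gamma>\<in>F. norm (a \<gamma>)) \<le> r"
    and h: "\<And>x. ((\<lambda>\<gamma>. a \<gamma> * \<gamma> x) has_sum h x) characters"
    using assms unfolding wiener_le_def by blast
  define j where "j = (\<lambda>(\<gamma> :: 'g \<Rightarrow> complex) x. cnj (\<gamma> x))"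
  have jj: "j (j \<gamma>) = \<gamma>" for \<gamma> by (simp add: j_def)
  have ch: "j \<gamma> \<in> characters" if "\<gamma> \<in> characters" for \<gamma>
    using that unfolding j_def by (rule character_cnj)
  show ?thesis unfolding wiener_le_def
  proof (intro exI[of _ "\<lambda>\<gamma>. cnj (a (j \<gamma>))"] conjI allI impI)
    fix F :: "('g \<Rightarrow> complex) set" assume F: "finite F" "F \<subseteq> characters"
    have "(\<Sum>\<gamma>\<in>F. norm (cnj (a (j \<gamma>)))) = (\<Sum>\<gamma>\<in>j ` F. norm (a \<gamma>))"
      by (subst sum.reindex) (auto intro!: inj_onI simp: o_def dest: arg_cong[where f = j] simp: jj)
    also have "\<dots> \<le> r" using F ch by (intro a) auto
    finally show "(\<Sum>\<gamma>\<in>F. norm (cnj (a (j \<gamma>)))) \<le> r" .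
  next
    fix x
    have "((\<lambda>\<gamma>. cnj (a \<gamma> * \<gamma> x)) has_sum cnj (h x)) characters"
      by (simp only: has_sum_cnj_iff h)
    moreover have "((\<lambda>\<gamma>. cnj (a \<gamma> * \<gamma> x)) has_sum cnj (h x)) characters =
      ((\<lambda>\<gamma>. cnj (a (j \<gamma>)) * \<gamma> x) has_sum cnj (h x)) characters"
      by (rule has_sum_reindex_bij_witness[where i = j and j = j])
        (auto simp: jj ch, simp add: j_def)
    ultimately show "((\<lambda>\<gamma>. cnj (a (j \<gamma>)) * \<gamma> x) has_sum cnj (h x)) characters" by simp
  qed
qed

lemma wiener_le_character:
  assumes "\<gamma> \<in> characters" shows "wiener_le 1 \<gamma>"
  unfolding wiener_le_def
proof (intro exI[of _ "\<lambda>\<delta>. if \<delta> = \<gamma> then 1 else 0"] conjI allI impI)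
  fix F :: "('g \<Rightarrow> complex) set" assume "finite F"
  then have "(\<Sum>\<delta>\<in>F. norm (if \<delta> = \<gamma> then 1 else 0 :: complex)) = (if \<gamma> \<in> F then 1 else 0)"
    by (simp add: if_distrib[of norm] cong: if_cong)
  then show "(\<Sum>\<delta>\<in>F. norm (if \<delta> = \<gamma> then 1 else 0 :: complex)) \<le> 1" by simp
next
  fix x
  have "((\<lambda>\<delta>. (if \<delta> = \<gamma> then 1 else 0) * \<delta> x) has_sum \<gamma> x) {\<gamma>}"
    by (rule has_sum_finiteI) auto
  then show "((\<lambda>\<delta>. (if \<delta> = \<gamma> then 1 else 0) * \<delta> x) has_sum \<gamma> x) characters"
    by (rule has_sum_cong_neutral[THEN iffD1, rotated -1]) (use assms in auto)
qed

lemma wiener_le_mult: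
  assumes "wiener_le r h" "wiener_le s k" shows "wiener_le (r * s) (\<lambda>x. h x * k x)"
proof -
  obtain a where a: "\<And>F. finite F \<Longrightarrow> F \<subseteq> characters \<Longrightarrow> (\<Sum>\<gamma>\<in>F. norm (a \<gamma>)) \<le> r"
    and h: "\<And>x. ((\<lambda>\<gamma>. a \<gamma> * \<gamma> x) has_sum h x) characters"
    using assms(1) unfolding wiener_le_def by blast
  show ?thesis
  proof (rule wiener_le_family[where I = characters])
    show "wiener_le (norm (a \<gamma>) * s) (\<lambda>x. a \<gamma> * (\<gamma> x * k x))" if "\<gamma> \<in> characters" for \<gamma>
      by (intro wiener_le_cmult wiener_le_character_mult assms that)
    show "(\<Sum>\<gamma>\<in>F. norm (a \<gamma>) * s) \<le> r * s" if "finite F" "F \<subseteq> characters" for F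
      using a[OF that] wiener_le_nonneg[OF assms(2)]
      by (simp add: sum_distrib_right[symmetric] mult_right_mono)
    show "((\<lambda>\<gamma>. a \<gamma> * (\<gamma> x * k x)) has_sum h x * k x) characters" for x
      using has_sum_cmult_left[OF h, of x "k x"] by (simp add: mult.assoc)
  qed
qed

lemma wiener_le_one: "wiener_le 1 (\<lambda>_. 1)"
  by (rule wiener_le_character[OF trivial_character])

lemma wiener_le_power: "wiener_le r h \<Longrightarrow> wiener_le (r ^ n) (\<lambda>x. h x ^ n)"
  by (induction n) (auto intro: wiener_le_one wiener_le_mult)

lemma wiener_le_sum:
  assumes "finite I" "\<And>i. i \<in> I \<Longrightarrow> wiener_le (r i) (h i)"
  shows "wiener_le (\<Sum>i\<in>I. r i) (\<lambda>x. \<Sum>i\<in>I. h i x)"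
proof (rule wiener_le_family[where I = I])
  show "sum r F \<le> sum r I" if "finite F" "F \<subseteq> I" for F
    using assms that by (intro sum_mono2) (auto intro: wiener_le_nonneg)
qed (use assms in auto)

text \<open>Cauchy-Schwarz over the frequencies and Bessel's inequality bound the sum of the coefficients by the
supremum, at the price of the square root of the number of frequencies.\<close>

lemma wiener_le_trig:
  assumes F: "finite F" "F \<subseteq> characters" and B: "\<And>x. norm (\<Sum>\<gamma>\<in>F. b \<gamma> * \<gamma> x) \<le> B"
  shows "wiener_le (sqrt (card F) * B) (\<lambda>x. \<Sum>\<gamma>\<in>F. b \<gamma> * \<gamma> x)"
proof -
  define q where "q = (\<lambda>x. \<Sum>\<gamma>\<in>F. b \<gamma> * \<gamma> x)"
  have cq: "cont q" unfolding q_def by (rule cont_trig[OF F(2)])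
  have B0: "0 \<le> B" using B norm_ge_zero order_trans by blast
  have "(\<Sum>\<gamma>\<in>F. (norm (b \<gamma>))\<^sup>2) = (\<Sum>\<gamma>\<in>F. (norm (fcoeff q \<gamma>))\<^sup>2)"
    unfolding q_def using F by (intro sum.cong) (auto simp: fcoeff_trig)
  also have "\<dots> \<le> sq q" by (rule Bessel[OF cont_L2[OF cq] F])
  also have "\<dots> \<le> B\<^sup>2" using B by (intro sq_le cq) (auto simp: q_def)
  finally have "(\<Sum>\<gamma>\<in>F. (norm (b \<gamma>))\<^sup>2) \<le> B\<^sup>2" .
  moreover have "(\<Sum>\<gamma>\<in>F. norm (b \<gamma>) * 1)\<^sup>2 \<le> (\<Sum>\<gamma>\<in>F. (norm (b \<gamma>))\<^sup>2) * (\<Sum>\<gamma>\<in>F. 1\<^sup>2)"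
    by (rule Cauchy_Schwarz_ineq_sum)
  ultimately have "(\<Sum>\<gamma>\<in>F. norm (b \<gamma>))\<^sup>2 \<le> B\<^sup>2 * card F"
    by (simp) (meson mult_right_mono of_nat_0_le_iff order_trans)
  then have "(\<Sum>\<gamma>\<in>F. norm (b \<gamma>)) \<le> sqrt (B\<^sup>2 * card F)" by (rule real_le_rsqrt)
  also have "\<dots> = sqrt (card F) * B" using B0 by (simp add: real_sqrt_mult)
  finally have le: "(\<Sum>\<gamma>\<in>F. norm (b \<gamma>)) \<le> sqrt (card F) * B" .
  have "wiener_le (\<Sum>\<gamma>\<in>F. norm (b \<gamma>) * 1) (\<lambda>x. \<Sum>\<gamma>\<in>F. b \<gamma> * \<gamma> x)"
    using F by (intro wiener_le_sum wiener_le_cmult wiener_le_character) auto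
  then show ?thesis by (rule wiener_le_mono) (use le in simp)
qed

text \<open>A finite set whose coefficient sum is within \<open>e\<close> of the supremum of all such sums leaves a tail of
norm at most \<open>e\<close>.\<close>

lemma wiener_le_approx:
  assumes "wiener_le r g" "0 < e"
  obtains F b where "finite F" "F \<subseteq> characters" "wiener_le e (\<lambda>x. g x - (\<Sum>\<gamma>\<in>F. b \<gamma> * \<gamma> x))"
proof -
  obtain a where a: "\<And>F. finite F \<Longrightarrow> F \<subseteq> characters \<Longrightarrow> (\<Sum>\<gamma>\<in>F. norm (a \<gamma>)) \<le> r"
    and h: "\<And>x. ((\<lambda>\<gamma>. a \<gamma> * \<gamma> x) has_sum g x) characters"
    using assms(1) unfolding wiener_le_def by blast
  define s where "s = (SUP F\<in>{F. finite F \<and> F \<subseteq> characters}. \<Sum>\<gamma>\<in>F. norm (a \<gamma>))"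
  have bdd: "bdd_above ((\<lambda>F. \<Sum>\<gamma>\<in>F. norm (a \<gamma>)) ` {F. finite F \<and> F \<subseteq> characters})"
    using a by (intro bdd_aboveI2[where M = r]) auto
  have ne: "{F::('g \<Rightarrow> complex) set. finite F \<and> F \<subseteq> characters} \<noteq> {}" by blast
  have "s - e < s" using assms(2) by simp
  then obtain F where F: "finite F" "F \<subseteq> characters" "s - e < (\<Sum>\<gamma>\<in>F. norm (a \<gamma>))"
    unfolding s_def using less_cSUP_iff[OF ne bdd] by blast
  show ?thesis
  proof (rule that[OF F(1,2), of a])
    show "wiener_le e (\<lambda>x. g x - (\<Sum>\<gamma>\<in>F. a \<gamma> * \<gamma> x))" unfolding wiener_le_def
    proof (intro exI[of _ "\<lambda>\<gamma>. if \<gamma> \<in> F then 0 else a \<gamma>"] conjI allI impI)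
      fix K :: "('g \<Rightarrow> complex) set" assume K: "finite K" "K \<subseteq> characters"
      have "(\<Sum>\<gamma>\<in>K. norm (if \<gamma> \<in> F then 0 else a \<gamma>)) = (\<Sum>\<gamma>\<in>K - F. norm (a \<gamma>))"
        using K by (intro sum.mono_neutral_cong_right) auto
      also have "\<dots> = (\<Sum>\<gamma>\<in>K \<union> F. norm (a \<gamma>)) - (\<Sum>\<gamma>\<in>F. norm (a \<gamma>))"
        using sum.subset_diff[of F "K \<union> F" "\<lambda>\<gamma>. norm (a \<gamma>)"] K F by (simp add: Un_Diff)
      also have "(\<Sum>\<gamma>\<in>K \<union> F. norm (a \<gamma>)) \<le> s"
        unfolding s_def using K F by (intro cSUP_upper bdd) auto
      finally show "(\<Sum>\<gamma>\<in>K. norm (if \<gamma> \<in> F then 0 else a \<gamma>)) \<le> e" using F(3) by simp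
    next
      fix x
      have "((\<lambda>\<gamma>. a \<gamma> * \<gamma> x) has_sum (\<Sum>\<gamma>\<in>F. a \<gamma> * \<gamma> x)) F" using F by simp
      then have "((\<lambda>\<gamma>. (if \<gamma> \<in> F then a \<gamma> else 0) * \<gamma> x) has_sum (\<Sum>\<gamma>\<in>F. a \<gamma> * \<gamma> x)) characters"
        by (rule has_sum_cong_neutral[THEN iffD1, rotated -1]) (use F in auto)
      from has_sum_add[OF h[of x] has_sum_cmult_right[OF this, of "-1"]]
      have "((\<lambda>\<gamma>. a \<gamma> * \<gamma> x + - 1 * ((if \<gamma> \<in> F then a \<gamma> else 0) * \<gamma> x)) has_sum
          g x - (\<Sum>\<gamma>\<in>F. a \<gamma> * \<gamma> x)) characters" by simp
      then
      show "((\<lambda>\<gamma>. (if \<gamma> \<in> F then 0 else a \<gamma>) * \<gamma> x) has_sum g x - (\<Sum>\<gamma>\<in>F. a \<gamma> * \<gamma> x)) characters"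
        by (rule has_sum_cong[THEN iffD1, rotated]) auto
    qed
  qed
qed

end

section \<open>Wiener's lemma for positive functions\<close>

lemma summable_power_times_geometric:
  fixes t :: real assumes "0 < t" "t < 1"
  shows "summable (\<lambda>n. real ((n + 1) ^ m) * t ^ n)"
proof -
  have "(\<lambda>n. (1 + inverse (real (Suc n))) ^ m * t) \<longlonglongrightarrow> (1 + 0) ^ m * t"
    by (intro tendsto_intros LIMSEQ_inverse_real_of_nat)
  then have "\<forall>\<^sub>F n in sequentially. (1 + inverse (real (Suc n))) ^ m * t < (1 + t) / 2"
    using assms by (intro order_tendstoD(2)) auto
  then obtain N where N: "\<And>n. n \<ge> N \<Longrightarrow> (1 + inverse (real (Suc n))) ^ m * t < (1 + t) / 2"
    by (auto simp: eventually_sequentially)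
  show ?thesis
  proof (rule summable_ratio_test[where c = "(1 + t) / 2" and N = N])
    fix n assume "N \<le> n"
    have "real (Suc n + 1) = (1 + inverse (real (Suc n))) * real (n + 1)" by (simp add: field_simps)
    then have "real ((Suc n + 1) ^ m) * t ^ Suc n = ((1 + inverse (real (Suc n))) ^ m * t) * (real ((n + 1) ^ m) * t ^ n)"
      by (simp only: of_nat_power power_mult_distrib power_Suc mult_ac)
    also have "\<dots> \<le> (1 + t) / 2 * (real ((n + 1) ^ m) * t ^ n)"
      using N[OF \<open>N \<le> n\<close>] assms by (intro mult_right_mono) auto
    finally show "norm (real ((Suc n + 1) ^ m) * t ^ Suc n) \<le> (1 + t) / 2 * norm (real ((n + 1) ^ m) * t ^ n)"
      using assms by simp
  qed (use assms in auto)
qed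

context compact_haar begin

text \<open>Since characters commute, the frequencies of the \<open>n\<close>-th power are products of powers of the original
ones with exponents at most \<open>n\<close>, of which there are only polynomially many in \<open>n\<close>.\<close>

lemma trig_power_frequencies:
  fixes S :: "('g \<Rightarrow> complex) set"
  assumes S: "finite S" "S \<subseteq> characters"
  shows "\<exists>F c. finite F \<and> F \<subseteq> characters \<and> card F \<le> (n + 1) ^ card S \<and>
    (\<forall>x. (\<Sum>\<gamma>\<in>S. b \<gamma> * \<gamma> x) ^ n = (\<Sum>\<gamma>\<in>F. c \<gamma> * \<gamma> x))"
proof -
  define T where "T n = S \<rightarrow>\<^sub>E {0..n}" for n :: nat
  define ch where "ch e = (\<lambda>x. \<Prod>\<gamma>\<in>S. \<gamma> x ^ e \<gamma>)" for e :: "('g \<Rightarrow> complex) \<Rightarrow> nat"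
  have finT: "finite (T n)" for n unfolding T_def using S by (intro finite_PiE) auto
  have pw: "(\<lambda>x. \<gamma> x ^ k) \<in> characters" if "\<gamma> \<in> characters" for \<gamma> :: "'g \<Rightarrow> complex" and k
    by (induction k) (auto intro: trivial_character character_mult that)
  have chX: "ch e \<in> characters" for e
    unfolding ch_def using S by (induction S rule: finite_induct) (auto intro: trivial_character character_mult pw)
  have ex: "\<exists>c. \<forall>x. (\<Sum>\<gamma>\<in>S. b \<gamma> * \<gamma> x) ^ n = (\<Sum>\<gamma>\<in>ch ` T n. c \<gamma> * \<gamma> x)" for n
  proof (induction n)
    case 0
    have "T 0 = {restrict (\<lambda>_. 0) S}" unfolding T_def by (auto simp: PiE_def extensional_def Pi_def fun_eq_iff)
    moreover have "ch (restrict (\<lambda>_. 0) S) = (\<lambda>_. 1)" by (simp add: ch_def)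
    ultimately have "ch ` T 0 = {\<lambda>_. 1}" by (simp only: image_insert image_empty)
    then show ?case by (intro exI[of _ "\<lambda>_. 1"]) simp
  next
    case (Suc n)
    then obtain c where c: "\<And>x. (\<Sum>\<gamma>\<in>S. b \<gamma> * \<gamma> x) ^ n = (\<Sum>\<gamma>\<in>ch ` T n. c \<gamma> * \<gamma> x)" by blast
    have img: "(\<lambda>x. \<delta> x * \<gamma> x) \<in> ch ` T (Suc n)" if "\<delta> \<in> S" "\<gamma> \<in> ch ` T n" for \<gamma> \<delta>
    proof -
      from that(2) obtain e where e: "e \<in> T n" "\<gamma> = ch e" by blast
      have "e(\<delta> := Suc (e \<delta>)) \<in> T (Suc n)" using e(1) that(1) by (fastforce simp: T_def PiE_iff extensional_def)
      moreover have "(\<lambda>x. \<delta> x * ch e x) = ch (e(\<delta> := Suc (e \<delta>)))"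
      proof
        fix x
        have "(\<Prod>\<gamma>\<in>S - {\<delta>}. \<gamma> x ^ (e(\<delta> := Suc (e \<delta>))) \<gamma>) = (\<Prod>\<gamma>\<in>S - {\<delta>}. \<gamma> x ^ e \<gamma>)"
          by (intro prod.cong) auto
        then show "\<delta> x * ch e x = ch (e(\<delta> := Suc (e \<delta>))) x"
          unfolding ch_def prod.remove[OF S(1) that(1)] by simp
      qed
      ultimately show ?thesis using e(2) by auto
    qed
    \<comment> \<open>Different pairs may have the same product \<open>\<kappa>\<close>; their coefficients are collected.\<close>
    define d where "d \<kappa> = (\<Sum>p\<in>{p \<in> S \<times> ch ` T n. (\<lambda>x. fst p x * snd p x) = \<kappa>}. b (fst p) * c (snd p))" for \<kappa>
    have "(\<Sum>\<gamma>\<in>S. b \<gamma> * \<gamma> x) ^ Suc n = (\<Sum>\<gamma>\<in>ch ` T (Suc n). d \<gamma> * \<gamma> x)" for x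
    proof -
      have "(\<Sum>\<gamma>\<in>S. b \<gamma> * \<gamma> x) ^ Suc n = (\<Sum>p\<in>S \<times> ch ` T n. b (fst p) * c (snd p) * (fst p x * snd p x))"
        unfolding power_Suc c sum_product sum.cartesian_product by (simp add: case_prod_beta mult_ac)
      also have "\<dots> = (\<Sum>\<kappa>\<in>ch ` T (Suc n). \<Sum>p\<in>{p \<in> S \<times> ch ` T n. (\<lambda>x. fst p x * snd p x) = \<kappa>}.
          b (fst p) * c (snd p) * (fst p x * snd p x))"
        using S finT img by (intro sum.group[symmetric]) auto
      also have "\<dots> = (\<Sum>\<kappa>\<in>ch ` T (Suc n). d \<kappa> * \<kappa> x)"
        unfolding d_def sum_distrib_right by (intro sum.cong refl) auto
      finally show ?thesis .
    qed
    then show ?case by blast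
  qed
  have "card (ch ` T n) \<le> card (T n)" by (rule card_image_le[OF finT])
  also have "card (T n) = (n + 1) ^ card S" unfolding T_def using S by (simp add: card_PiE)
  finally have "card (ch ` T n) \<le> (n + 1) ^ card S" .
  moreover obtain c where "\<forall>x. (\<Sum>\<gamma>\<in>S. b \<gamma> * \<gamma> x) ^ n = (\<Sum>\<gamma>\<in>ch ` T n. c \<gamma> * \<gamma> x)" using ex by blast
  ultimately show ?thesis using finT chX by (intro exI[of _ "ch ` T n"] exI[of _ c]) auto
qed

lemma wiener_le_trig_power:
  fixes S :: "('g \<Rightarrow> complex) set"
  assumes S: "finite S" "S \<subseteq> characters" and B: "\<And>x. norm (\<Sum>\<gamma>\<in>S. b \<gamma> * \<gamma> x) \<le> B"
  shows "wiener_le (real ((n + 1) ^ card S) * B ^ n) (\<lambda>x. (\<Sum>\<gamma>\<in>S. b \<gamma> * \<gamma> x) ^ n)"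
proof -
  obtain F c where F: "finite F" "F \<subseteq> characters" "card F \<le> (n + 1) ^ card S"
    and eq: "\<And>x. (\<Sum>\<gamma>\<in>S. b \<gamma> * \<gamma> x) ^ n = (\<Sum>\<gamma>\<in>F. c \<gamma> * \<gamma> x)"
    using trig_power_frequencies[OF S, of n b] by blast
  have B0: "0 \<le> B" using B norm_ge_zero order_trans by blast
  have "norm (\<Sum>\<gamma>\<in>F. c \<gamma> * \<gamma> x) \<le> B ^ n" for x
    unfolding eq[symmetric] norm_power by (intro power_mono B) simp
  from wiener_le_trig[OF F(1,2) this]
  have 1: "wiener_le (sqrt (card F) * B ^ n) (\<lambda>x. (\<Sum>\<gamma>\<in>S. b \<gamma> * \<gamma> x) ^ n)" unfolding eq .
  have "sqrt (card F) \<le> real (card F)"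
  proof (cases "card F = 0")
    case False
    then have "real (card F) \<le> (real (card F))\<^sup>2" by (simp add: power2_eq_square)
    then show ?thesis by (intro real_le_lsqrt) auto
  qed simp
  also have "\<dots> \<le> real ((n + 1) ^ card S)" using F(3) by (rule of_nat_mono)
  finally show ?thesis using B0 by (intro wiener_le_mono[OF 1] mult_right_mono) auto
qed

text \<open>The spectral radius of \<open>g\<close> in \<open>A(G)\<close> is at most its supremum. Split \<open>g = p + (g - p)\<close> with \<open>p\<close> a
trigonometric polynomial and \<open>g - p\<close> small in norm. In the binomial expansion, powers of \<open>p\<close> cost a
polynomial factor besides the supremum of \<open>p\<close>, and powers of \<open>g - p\<close> are small.\<close>

lemma wiener_le_power_growth:
  assumes g: "wiener_le r g" and \<rho>: "\<And>x. norm (g x) \<le> \<rho>" and t: "\<rho> < t"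
  obtains m where "\<And>n. wiener_le (real ((n + 1) ^ m) * t ^ n) (\<lambda>x. g x ^ n)"
proof -
  define e where "e = (t - \<rho>) / 2"
  have e: "0 < e" using t by (simp add: e_def)
  have \<rho>0: "0 \<le> \<rho>" using \<rho> norm_ge_zero order_trans by blast
  obtain S b where S: "finite S" "S \<subseteq> characters" and ap: "wiener_le e (\<lambda>x. g x - (\<Sum>\<gamma>\<in>S. b \<gamma> * \<gamma> x))"
    using wiener_le_approx[OF g e] by blast
  define p where "p x = (\<Sum>\<gamma>\<in>S. b \<gamma> * \<gamma> x)" for x
  have pb: "norm (p x) \<le> \<rho> + e" for x
  proof -
    have "norm (p x) \<le> norm (g x) + norm (g x - p x)" by (metis norm_minus_commute norm_triangle_sub)
    then show ?thesis using \<rho>[of x] wiener_le_bound[OF ap, of x] by (simp add: p_def)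
  qed
  define m where "m = card S"
  have "wiener_le (real ((n + 1) ^ m) * t ^ n) (\<lambda>x. g x ^ n)" for n
  proof -
    have pk: "wiener_le (real ((k + 1) ^ m) * (\<rho> + e) ^ k) (\<lambda>x. p x ^ k)" for k
      unfolding m_def p_def by (intro wiener_le_trig_power S) (use pb in \<open>simp add: p_def\<close>)
    have ek: "wiener_le (e ^ k) (\<lambda>x. (g x - p x) ^ k)" for k
      using wiener_le_power[OF ap] unfolding p_def .
    have "wiener_le (\<Sum>k\<le>n. norm (of_nat (n choose k) :: complex) * (real ((k + 1) ^ m) * (\<rho> + e) ^ k * e ^ (n - k)))
      (\<lambda>x. \<Sum>k\<le>n. of_nat (n choose k) * (p x ^ k * (g x - p x) ^ (n - k)))"
      by (intro wiener_le_sum wiener_le_cmult wiener_le_mult pk ek) auto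
    moreover have "(\<Sum>k\<le>n. of_nat (n choose k) * (p x ^ k * (g x - p x) ^ (n - k))) = g x ^ n" for x
      using binomial_ring[of "p x" "g x - p x" n] by (simp add: mult.assoc)
    ultimately have 1: "wiener_le (\<Sum>k\<le>n. real (n choose k) * (real ((k + 1) ^ m) * (\<rho> + e) ^ k * e ^ (n - k)))
      (\<lambda>x. g x ^ n)" by simp
    have "(\<Sum>k\<le>n. real (n choose k) * (real ((k + 1) ^ m) * (\<rho> + e) ^ k * e ^ (n - k)))
      \<le> (\<Sum>k\<le>n. real ((n + 1) ^ m) * (real (n choose k) * (\<rho> + e) ^ k * e ^ (n - k)))"
    proof (rule sum_mono)
      fix k assume "k \<in> {..n}"
      then have "real ((k + 1) ^ m) \<le> real ((n + 1) ^ m)" by (intro of_nat_mono power_mono) auto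
      then have "real ((k + 1) ^ m) * (real (n choose k) * (\<rho> + e) ^ k * e ^ (n - k)) \<le>
        real ((n + 1) ^ m) * (real (n choose k) * (\<rho> + e) ^ k * e ^ (n - k))"
        using e \<rho>0 by (intro mult_right_mono) auto
      then show "real (n choose k) * (real ((k + 1) ^ m) * (\<rho> + e) ^ k * e ^ (n - k)) \<le>
        real ((n + 1) ^ m) * (real (n choose k) * (\<rho> + e) ^ k * e ^ (n - k))"
        by (simp only: mult_ac)
    qed
    also have "\<dots> = real ((n + 1) ^ m) * (\<rho> + e + e) ^ n"
      unfolding sum_distrib_left[symmetric] binomial_ring[of "\<rho> + e" e n] ..
    also have "\<rho> + e + e = t" by (simp add: e_def)
    finally show ?thesis by (rule wiener_le_mono[OF 1])
  qed
  then show ?thesis using that by blast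
qed

text \<open>After division by the maximum \<open>C\<close> of \<open>h\<close>, the function \<open>g = 1 - h / C\<close> has values in \<open>[0, \<rho>]\<close> with
\<open>\<rho> < 1\<close>. Its powers decay geometrically in \<open>A(G)\<close> up to a polynomial factor, so the geometric series
for \<open>1 / (1 - g)\<close> converges there.\<close>

theorem Wiener_inverse:
  assumes h: "wiener_le r h" and ch: "cont h" and pos: "\<And>x. h x = complex_of_real (k x)" "\<And>x. 0 < k x"
  obtains R where "wiener_le R (\<lambda>x. 1 / h x)"
proof -
  have ck: "continuous_on UNIV k"
  proof -
    have "k = (\<lambda>x. Re (h x))" using pos by (auto simp: fun_eq_iff)
    then show ?thesis using ch by (auto intro!: continuous_intros)
  qed
  obtain x0 where x0: "\<And>x. k x0 \<le> k x" using continuous_attains_inf[OF compact_group _ ck] by auto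
  obtain x1 where x1: "\<And>x. k x \<le> k x1" using continuous_attains_sup[OF compact_group _ ck] by auto
  define C where "C = k x1"
  have C: "0 < C" using pos by (simp add: C_def)
  define g where "g x = 1 - complex_of_real (1 / C) * h x" for x
  have g: "wiener_le (1 + norm (complex_of_real (- 1 / C)) * r) g"
  proof -
    have "wiener_le (\<Sum>i\<in>{True, False}. if i then 1 else norm (complex_of_real (- 1 / C)) * r)
      (\<lambda>x. \<Sum>i\<in>{True, False}. if i then 1 else complex_of_real (- 1 / C) * h x)"
    proof (rule wiener_le_sum)
      fix i
      show "wiener_le (if i then 1 else norm (complex_of_real (- 1 / C)) * r)
        (\<lambda>x. if i then 1 else complex_of_real (- 1 / C) * h x)"
        using wiener_le_cmult[OF h, of "complex_of_real (- 1 / C)"] wiener_le_one by (cases i) auto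
    qed simp
    then show ?thesis by (simp add: g_def[abs_def])
  qed
  define \<rho> where "\<rho> = 1 - k x0 / C"
  have \<rho>1: "\<rho> < 1" "0 \<le> \<rho>" using pos C x1[of x0] by (auto simp: \<rho>_def C_def)
  have \<rho>: "norm (g x) \<le> \<rho>" for x
  proof -
    have "g x = complex_of_real (1 - k x / C)" by (simp add: g_def pos(1))
    then have "norm (g x) = \<bar>1 - k x / C\<bar>" by (simp only: norm_of_real)
    also have "\<dots> = 1 - k x / C" using C x1[of x] by (simp add: C_def)
    also have "\<dots> \<le> \<rho>" using C x0[of x] by (simp add: \<rho>_def divide_right_mono)
    finally show ?thesis .
  qed
  define t where "t = (1 + \<rho>) / 2"
  have t: "\<rho> < t" "t < 1" "0 < t" using \<rho>1 by (auto simp: t_def)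
  obtain m where m: "\<And>n. wiener_le (real ((n + 1) ^ m) * t ^ n) (\<lambda>x. g x ^ n)"
    using wiener_le_power_growth[OF g \<rho> t(1)] by blast
  have sm: "summable (\<lambda>n. real ((n + 1) ^ m) * t ^ n)" by (rule summable_power_times_geometric[OF t(3,2)])
  have "wiener_le (\<Sum>n. real ((n + 1) ^ m) * t ^ n) (\<lambda>x. 1 / (1 - g x))"
  proof (rule wiener_le_family[where I = UNIV, OF m])
    show "(\<Sum>n\<in>F. real ((n + 1) ^ m) * t ^ n) \<le> (\<Sum>n. real ((n + 1) ^ m) * t ^ n)" if "finite F" for F
      using t by (intro sum_le_suminf sm that) auto
    show "((\<lambda>n. g x ^ n) has_sum 1 / (1 - g x)) UNIV" for x
    proof (rule norm_summable_imp_has_sum)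
      have "norm (g x) < 1" using \<rho>[of x] \<rho>1 by simp
      then show "summable (\<lambda>n. norm (g x ^ n))" "(\<lambda>n. g x ^ n) sums (1 / (1 - g x))"
        by (auto simp: norm_power intro!: summable_geometric geometric_sums)
    qed
  qed
  from wiener_le_cmult[OF this, of "complex_of_real (1 / C)"] show ?thesis
    using that C by (simp add: g_def)
qed

section \<open>Correlations of square integrable functions\<close>

lemma outer_regular:
  assumes "A \<in> sets M" "0 < e"
  obtains U where "open U" "A \<subseteq> U" "measure M U < measure M A + e"
proof -
  have "emeasure M A = (INF U\<in>{U. open U \<and> A \<subseteq> U}. emeasure M U)"
    using haar assms(1) unfolding haar_measure_def open_openin[symmetric] by blast
  moreover have "emeasure M A < ennreal (measure M A + e)"
    unfolding emeasure_eq_measure using assms(2) by (simp add: ennreal_less_iff)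
  ultimately obtain U where U: "open U" "A \<subseteq> U" "emeasure M U < ennreal (measure M A + e)"
    by (auto simp: INF_less_iff)
  then have "measure M U < measure M A + e"
    unfolding emeasure_eq_measure by (simp add: ennreal_less_iff)
  with U that show ?thesis by blast
qed

lemma inner_regular:
  assumes A: "A \<in> sets M" and e: "0 < e"
  obtains K where "compact K" "K \<subseteq> A" "measure M A < measure M K + e"
proof -
  have "- A \<in> sets M" using A sets.compl_sets[OF A] by (simp add: Compl_eq_Diff_UNIV)
  from outer_regular[OF this e]
  obtain U where U: "open U" "- A \<subseteq> U" "measure M U < measure M (- A) + e" by blast
  have compl: "measure M (- B) = vol - measure M B" if "B \<in> sets M" for B
    using finite_measure_compl[OF that] by (simp add: vol_def Compl_eq_Diff_UNIV)
  have "compact (- U)" using compact_Int_closed[OF compact_group, of "- U"] U(1) by (simp add: closed_def)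
  moreover have "measure M A < measure M (- U) + e"
    using U(3) compl[OF A] compl[of U] U(1) by simp
  ultimately show ?thesis using U(2) that[of "- U"] by auto
qed

definition L1_modulus :: "('g \<Rightarrow> complex) \<Rightarrow> 'g \<Rightarrow> real" where
  "L1_modulus f t = (\<integral>s. norm (f (s + t) - f s) \<partial>M)"

lemma L1_modulus_integrable:
  fixes f :: "'g \<Rightarrow> complex"
  shows "integrable M f \<Longrightarrow> integrable M (\<lambda>s. norm (f (s + t) - f s))"
  using integrable_translation[of f t] by (intro integrable_norm Bochner_Integration.integrable_diff)

text \<open>For an indicator function, sandwich the set between a compact \<open>K\<close> and an open \<open>U\<close> of nearly equal
measure: for small \<open>t\<close> the set \<open>K\<close> translated by \<open>t\<close> stays inside \<open>U\<close>. The general case is density.\<close>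

lemma translation_continuous_L1:
  assumes "integrable M f"
  shows "(L1_modulus f \<longlongrightarrow> 0) (nhds 0)"
  using assms
proof (induction rule: integrable_induct)
  case (base A c)
  have A: "A \<in> sets M" by (rule base)
  have "((\<lambda>t. \<integral>s. \<bar>indicator A (s + t) - indicator A s\<bar> \<partial>M :: real) \<longlongrightarrow> 0) (nhds 0)"
  proof (rule tendstoI)
    fix e :: real assume "0 < e"
    then have e: "0 < e / 4" by simp
    obtain U where U: "open U" "A \<subseteq> U" "measure M U < measure M A + e / 4" using outer_regular[OF A e] by blast
    obtain K where K: "compact K" "K \<subseteq> A" "measure M A < measure M K + e / 4" using inner_regular[OF A e] by blast
    have oW: "open ((\<lambda>p::'g \<times> 'g. fst p + snd p) -` U)"
      using U(1) by (intro open_vimage continuous_intros)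
    have "{0} \<times> K \<subseteq> (\<lambda>p. fst p + snd p) -` U" using K U by auto
    from Elementary_Topology.tube_lemma[OF K(1) oW this] obtain V where V: "0 \<in> V" "open V" "\<And>t k. t \<in> V \<Longrightarrow> k \<in> K \<Longrightarrow> t + k \<in> U"
      by fastforce
    have mK: "K \<in> sets M" and mU: "U \<in> sets M" using K U by (auto intro: borel_compact)
    note [measurable] = mK mU A
    have int: "integrable M (\<lambda>s. indicator B (s + t) :: real)" "integrable M (indicator B :: _ \<Rightarrow> real)"
      "(\<integral>s. indicator B (s + t) \<partial>M) = measure M B" if "B \<in> sets M" for B t
    proof -
      show i: "integrable M (indicator B :: _ \<Rightarrow> real)" using that by (simp add: emeasure_eq_measure)
      show "integrable M (\<lambda>s. indicator B (s + t) :: real)" by (rule integrable_translation[OF i])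
      show "(\<integral>s. indicator B (s + t) \<partial>M) = measure M B"
        using integral_translation[of "indicator B :: _ \<Rightarrow> real" t] that by simp
    qed
    have "dist (\<integral>s. \<bar>indicator A (s + t) - indicator A s\<bar> \<partial>M :: real) 0 < e" if "t \<in> V" for t
    proof -
      have "(\<integral>s. \<bar>indicator A (s + t) - indicator A s\<bar> \<partial>M :: real) \<le>
        (\<integral>s. (indicator A s - indicator K s) + (indicator U (s + t) - indicator K s)
          + (indicator U (s + t) - indicator A (s + t)) \<partial>M)"
      proof (rule integral_mono)
        show "integrable M (\<lambda>s. \<bar>indicator A (s + t) - indicator A s\<bar> :: real)"
          by (intro integrable_abs Bochner_Integration.integrable_diff int A)
        show "integrable M (\<lambda>s. (indicator A s - indicator K s) + (indicator U (s + t) - indicator K s)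
          + (indicator U (s + t) - indicator A (s + t)) :: real)"
          by (intro Bochner_Integration.integrable_add Bochner_Integration.integrable_diff int A mK mU)
        fix s
        show "\<bar>indicator A (s + t) - indicator A s\<bar> \<le> (indicator A s - indicator K s) + (indicator U (s + t) - indicator K s)
          + (indicator U (s + t) - indicator A (s + t) :: real)"
          using K(2) U(2) V(3)[OF that, of s] by (auto simp: indicator_def add.commute)
      qed
      also have "\<dots> = (measure M A - measure M K) + (measure M U - measure M K) + (measure M U - measure M A)"
        using int A mK mU by simp
      also have "\<dots> < e" using U(3) K(3) by linarith
      finally show ?thesis by simp
    qed
    then show "\<forall>\<^sub>F t in nhds 0. dist (\<integral>s. \<bar>indicator A (s + t) - indicator A s\<bar> \<partial>M :: real) 0 < e"
      using V by (auto simp: eventually_nhds)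
  qed
  then have "((\<lambda>t. norm c * (\<integral>s. \<bar>indicator A (s + t) - indicator A s\<bar> \<partial>M :: real)) \<longlongrightarrow> norm c * 0) (nhds 0)"
    by (intro tendsto_intros)
  moreover have "L1_modulus (\<lambda>x. indicator A x *\<^sub>R c) = (\<lambda>t. norm c * (\<integral>s. \<bar>indicator A (s + t) - indicator A s\<bar> \<partial>M :: real))"
    by (simp add: L1_modulus_def fun_eq_iff scaleR_diff_left[symmetric] mult.commute)
  ultimately show ?case by simp
next
  case (add f g)
  have lim: "((\<lambda>t. L1_modulus f t + L1_modulus g t) \<longlongrightarrow> 0) (nhds 0)"
    using tendsto_add[OF add.IH] by simp
  have le: "L1_modulus (\<lambda>x. f x + g x) t \<le> L1_modulus f t + L1_modulus g t" for t
  proof -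
    have "L1_modulus (\<lambda>x. f x + g x) t \<le> (\<integral>s. norm (f (s + t) - f s) + norm (g (s + t) - g s) \<partial>M)"
      unfolding L1_modulus_def
    proof (rule integral_mono)
      show "integrable M (\<lambda>s. norm (f (s + t) + g (s + t) - (f s + g s)))"
        using L1_modulus_integrable[of "\<lambda>x. f x + g x"] add.hyps by simp
      fix s
      have "f (s + t) + g (s + t) - (f s + g s) = (f (s + t) - f s) + (g (s + t) - g s)" by simp
      then show "norm (f (s + t) + g (s + t) - (f s + g s)) \<le> norm (f (s + t) - f s) + norm (g (s + t) - g s)"
        by (simp only: norm_triangle_ineq)
    qed (intro Bochner_Integration.integrable_add L1_modulus_integrable add.hyps)
    then show ?thesis using add.hyps by (simp add: L1_modulus_def L1_modulus_integrable)
  qed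
  show ?case
  proof (rule tendsto_sandwich[OF _ _ tendsto_const lim])
    show "\<forall>\<^sub>F t in nhds 0. 0 \<le> L1_modulus (\<lambda>x. f x + g x) t"
      by (rule always_eventually) (simp add: L1_modulus_def)
    show "\<forall>\<^sub>F t in nhds 0. L1_modulus (\<lambda>x. f x + g x) t \<le> L1_modulus f t + L1_modulus g t"
      by (rule always_eventually) (simp only: le simp_thms)
  qed
next
  case (lim f s)
  define d where "d i = (\<integral>x. norm (s i x - f x) \<partial>M)" for i
  have di: "integrable M (\<lambda>x. norm (s i x - f x))" for i
    by (intro integrable_norm Bochner_Integration.integrable_diff lim.hyps)
  have "d \<longlonglongrightarrow> (\<integral>x. 0 \<partial>M)" unfolding d_def
  proof (rule integral_dominated_convergence[where w = "\<lambda>x. 3 * norm (f x)"])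
    show "AE x in M. (\<lambda>i. norm (s i x - f x)) \<longlonglongrightarrow> 0"
      using lim.hyps(2) by (auto intro!: tendsto_norm_zero LIM_zero)
    show "AE x in M. norm (norm (s i x - f x)) \<le> 3 * norm (f x)" for i
    proof (intro AE_I2)
      fix x assume "x \<in> space M"
      from lim.hyps(3)[OF this, of i] norm_triangle_ineq4[of "s i x" "f x"]
      show "norm (norm (s i x - f x)) \<le> 3 * norm (f x)" by simp
    qed
  qed (use lim.hyps di in auto)
  then have d: "d \<longlonglongrightarrow> 0" by simp
  have le: "L1_modulus f t \<le> 2 * d i + L1_modulus (s i) t" for t i
  proof -
    have "L1_modulus f t \<le> (\<integral>x. norm (s i (x + t) - f (x + t)) + norm (s i x - f x) + norm (s i (x + t) - s i x) \<partial>M)"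
      unfolding L1_modulus_def
    proof (rule integral_mono)
      fix x
      have "f (x + t) - f x = - (s i (x + t) - f (x + t)) + ((s i x - f x) + (s i (x + t) - s i x))" by simp
      then show "norm (f (x + t) - f x) \<le> norm (s i (x + t) - f (x + t)) + norm (s i x - f x) + norm (s i (x + t) - s i x)"
        using norm_triangle_ineq[of "- (s i (x + t) - f (x + t))" "(s i x - f x) + (s i (x + t) - s i x)"]
          norm_triangle_ineq[of "s i x - f x" "s i (x + t) - s i x"] by (simp only: norm_minus_cancel)
    qed (intro Bochner_Integration.integrable_add L1_modulus_integrable lim.hyps di integrable_translation[OF di])+
    also have "\<dots> = d i + d i + L1_modulus (s i) t"
      using integral_translation[of "\<lambda>x. norm (s i x - f x)" t] di integrable_translation[OF di]
        L1_modulus_integrable[OF lim.hyps(1)]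
      by (simp add: d_def L1_modulus_def)
    finally show ?thesis by simp
  qed
  show ?case
  proof (rule tendstoI)
    fix e :: real assume "0 < e"
    then have "\<forall>\<^sub>F i in sequentially. d i < e / 4" using d by (intro order_tendstoD(2)[OF d]) auto
    then obtain i where i: "d i < e / 4" by (auto simp: eventually_sequentially)
    have "\<forall>\<^sub>F t in nhds 0. L1_modulus (s i) t < e / 2"
      using \<open>0 < e\<close> by (intro order_tendstoD(2)[OF lim.IH]) auto
    then show "\<forall>\<^sub>F t in nhds 0. dist (L1_modulus f t) 0 < e"
    proof eventually_elim
      case (elim t)
      have "0 \<le> L1_modulus f t" by (simp add: L1_modulus_def)
      then show ?case using le[of t i] elim i by simp
    qed
  qed
qed

lemma L2_translate: "\<xi> \<in> L2 M \<Longrightarrow> (\<lambda>s. \<xi> (s + t)) \<in> L2 M"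
  using integrable_translation[of "\<lambda>x. (norm (\<xi> x))\<^sup>2" t]
  by (auto simp: L2_def intro: measurable_compose[OF translation_measurable])

lemma l2_norm_translate: "\<xi> \<in> L2 M \<Longrightarrow> l2_norm M (\<lambda>s. \<xi> (s + t)) = l2_norm M \<xi>"
  using integral_translation[of "\<lambda>x. (norm (\<xi> x))\<^sup>2" t] by (auto simp: L2_def l2_norm_def)

text \<open>Correlations are the matrix coefficients of the regular representation, \<open>\<langle>\<tau>\<^sub>t \<xi>, \<eta>\<rangle>\<close> with \<open>\<tau>\<^sub>t\<close> the
translation by \<open>t\<close>.\<close>

definition corr :: "('g \<Rightarrow> complex) \<Rightarrow> ('g \<Rightarrow> complex) \<Rightarrow> 'g \<Rightarrow> complex" where
  "corr \<xi> \<eta> t = (\<integral>s. \<xi> (s + t) * cnj (\<eta> s) \<partial>M)"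

lemma l2_norm_cnj: "l2_norm M (\<lambda>x. cnj (\<eta> x)) = l2_norm M \<eta>"
  by (simp add: l2_norm_def)

lemma corr_bound:
  assumes "\<xi> \<in> L2 M" "\<eta> \<in> L2 M"
  shows "norm (corr \<xi> \<eta> t) \<le> l2_norm M \<xi> * l2_norm M \<eta>"
  using L2_Cauchy_Schwarz[OF L2_translate[OF assms(1)] L2_cnj[OF assms(2)], of t]
  by (simp add: corr_def l2_norm_translate assms l2_norm_cnj)

lemma L2_diff: "\<xi> \<in> L2 M \<Longrightarrow> \<eta> \<in> L2 M \<Longrightarrow> (\<lambda>x. \<xi> x - \<eta> x) \<in> L2 M"
  using L2_add[of \<xi> M "\<lambda>x. -1 * \<eta> x"] L2_cmult[of \<eta> M "-1"] by simp

lemma corr_diff_left: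
  assumes "\<xi> \<in> L2 M" "\<xi>' \<in> L2 M" "\<eta> \<in> L2 M"
  shows "corr (\<lambda>x. \<xi> x - \<xi>' x) \<eta> t = corr \<xi> \<eta> t - corr \<xi>' \<eta> t"
  unfolding corr_def left_diff_distrib
  by (intro Bochner_Integration.integral_diff L2_integrable_mult L2_translate L2_cnj assms)

text \<open>For bounded \<open>\<xi>\<close> the square of a difference is dominated by a multiple of its modulus, so continuity of
translation in \<open>L\<^sup>1\<close> gives continuity in \<open>L\<^sup>2\<close>.\<close>

lemma cont_corr_bounded:
  assumes \<xi>: "\<xi> \<in> L2 M" and \<eta>: "\<eta> \<in> L2 M" and B: "\<And>x. norm (\<xi> x) \<le> B"
  shows "cont (corr \<xi> \<eta>)"
proof -
  have B0: "0 \<le> B" using B norm_ge_zero order_trans by blast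
  have i\<xi>: "integrable M \<xi>" by (rule L2_integrable[OF \<xi>])
  have "isCont (corr \<xi> \<eta>) t0" for t0
  proof -
    have est: "norm (corr \<xi> \<eta> t - corr \<xi> \<eta> t0) \<le> sqrt (2 * B * L1_modulus \<xi> (t - t0)) * l2_norm M \<eta>" for t
    proof -
      define d where "d = (\<lambda>s. \<xi> (s + (t - t0)) - \<xi> s)"
      have dL: "d \<in> L2 M" unfolding d_def by (intro L2_diff L2_translate \<xi>)
      have "corr \<xi> \<eta> t - corr \<xi> \<eta> t0 = corr d \<eta> t0"
        unfolding d_def using corr_diff_left[OF L2_translate[OF \<xi>] \<xi> \<eta>, of "t - t0" t0]
        by (simp add: corr_def add.assoc)
      then have "norm (corr \<xi> \<eta> t - corr \<xi> \<eta> t0) \<le> l2_norm M d * l2_norm M \<eta>"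
        using corr_bound[OF dL \<eta>] by simp
      moreover have "l2_norm M d \<le> sqrt (2 * B * L1_modulus \<xi> (t - t0))"
      proof -
        have "(\<integral>s. (norm (d s))\<^sup>2 \<partial>M) \<le> (\<integral>s. 2 * B * norm (d s) \<partial>M)"
        proof (rule integral_mono)
          show "integrable M (\<lambda>s. (norm (d s))\<^sup>2)" using dL by (simp add: L2_def)
          show "integrable M (\<lambda>s. 2 * B * norm (d s))" using L2_integrable[OF dL] by simp
          fix s
          have "norm (d s) \<le> 2 * B"
            unfolding d_def using norm_triangle_ineq4[of "\<xi> (s + (t - t0))" "\<xi> s"] B[of s] B[of "s + (t - t0)"] by linarith
          then show "(norm (d s))\<^sup>2 \<le> 2 * B * norm (d s)"
            unfolding power2_eq_square by (intro mult_right_mono) auto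
        qed
        also have "\<dots> = 2 * B * L1_modulus \<xi> (t - t0)" by (simp add: d_def L1_modulus_def)
        finally show ?thesis unfolding l2_norm_def by simp
      qed
      ultimately show ?thesis by (meson mult_right_mono l2_norm_nonneg order_trans)
    qed
    have "((\<lambda>t. t - t0) \<longlongrightarrow> t0 - t0) (at t0)" by (intro tendsto_intros)
    then have "filterlim (\<lambda>t. t - t0) (nhds 0) (at t0)" by simp
    from filterlim_compose[OF translation_continuous_L1[OF i\<xi>] this]
    have "((\<lambda>t. sqrt (2 * B * L1_modulus \<xi> (t - t0)) * l2_norm M \<eta>) \<longlongrightarrow> sqrt (2 * B * 0) * l2_norm M \<eta>) (at t0)"
      by (intro tendsto_intros)
    then have "((\<lambda>t. corr \<xi> \<eta> t - corr \<xi> \<eta> t0) \<longlongrightarrow> 0) (at t0)"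
      by (intro Lim_null_comparison[OF always_eventually[OF allI[OF est]]]) simp
    then show ?thesis unfolding isCont_def by (rule LIM_zero_cancel)
  qed
  then show ?thesis by (simp add: continuous_on_eq_continuous_at)
qed

text \<open>Truncations of \<open>\<xi>\<close> converge to \<open>\<xi>\<close> in \<open>L\<^sup>2\<close>, so their correlations with \<open>\<eta>\<close> converge uniformly.\<close>

lemma cont_corr:
  assumes \<xi>: "\<xi> \<in> L2 M" and \<eta>: "\<eta> \<in> L2 M"
  shows "cont (corr \<xi> \<eta>)"
proof -
  define c where "c n = (\<lambda>x. if norm (\<xi> x) \<le> real n then \<xi> x else 0)" for n :: nat
  have m[measurable]: "\<xi> \<in> borel_measurable M" using \<xi> by (simp add: L2_def)
  have mc[measurable]: "c n \<in> borel_measurable M" for n unfolding c_def by measurable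
  have cL: "c n \<in> L2 M" for n
  proof -
    have "integrable M (\<lambda>x. (norm (c n x))\<^sup>2)"
      by (rule Bochner_Integration.integrable_bound[of M "\<lambda>x. (norm (\<xi> x))\<^sup>2"])
        (use \<xi> in \<open>auto simp: c_def L2_def\<close>)
    then show ?thesis by (simp add: L2_def)
  qed
  have contc: "cont (corr (c n) \<eta>)" for n
    by (rule cont_corr_bounded[OF cL \<eta>, where B = "real n"]) (simp add: c_def)
  have "(\<lambda>n. \<integral>x. (norm (c n x - \<xi> x))\<^sup>2 \<partial>M) \<longlonglongrightarrow> (\<integral>x. 0 \<partial>M)"
  proof (rule integral_dominated_convergence[where w = "\<lambda>x. (norm (\<xi> x))\<^sup>2"])
    show "AE x in M. (\<lambda>n. (norm (c n x - \<xi> x))\<^sup>2) \<longlonglongrightarrow> 0"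
    proof (intro AE_I2)
      fix x
      obtain N :: nat where "norm (\<xi> x) \<le> real N" using real_arch_simple by blast
      then have "\<forall>\<^sub>F n in sequentially. (norm (c n x - \<xi> x))\<^sup>2 = 0"
        by (auto simp: eventually_sequentially c_def intro!: exI[of _ N])
      then show "(\<lambda>n. (norm (c n x - \<xi> x))\<^sup>2) \<longlonglongrightarrow> 0" by (rule tendsto_eventually)
    qed
    show "AE x in M. norm ((norm (c n x - \<xi> x))\<^sup>2) \<le> (norm (\<xi> x))\<^sup>2" for n
      by (auto simp: c_def)
    show "integrable M (\<lambda>x. (norm (\<xi> x))\<^sup>2)" using \<xi> by (simp add: L2_def)
  qed auto
  from tendsto_real_sqrt[OF this] have l: "(\<lambda>n. l2_norm M (\<lambda>x. c n x - \<xi> x)) \<longlonglongrightarrow> 0"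
    by (simp add: l2_norm_def)
  have "uniform_limit UNIV (\<lambda>n. corr (c n) \<eta>) (corr \<xi> \<eta>) sequentially"
  proof (rule uniform_limitI)
    fix e :: real assume "0 < e"
    have "(\<lambda>n. l2_norm M (\<lambda>x. c n x - \<xi> x) * l2_norm M \<eta>) \<longlonglongrightarrow> 0 * l2_norm M \<eta>"
      by (intro tendsto_intros l)
    then have "\<forall>\<^sub>F n in sequentially. l2_norm M (\<lambda>x. c n x - \<xi> x) * l2_norm M \<eta> < e"
      using \<open>0 < e\<close> by (intro order_tendstoD(2)) auto
    then show "\<forall>\<^sub>F n in sequentially. \<forall>t\<in>UNIV. dist (corr (c n) \<eta> t) (corr \<xi> \<eta> t) < e"
    proof eventually_elim
      case (elim n)
      then show ?case
        using corr_bound[OF L2_diff[OF cL \<xi>] \<eta>, of n] corr_diff_left[OF cL \<xi> \<eta>, of n]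
        by (auto simp: dist_norm intro: le_less_trans)
    qed
  qed
  then show ?thesis by (rule uniform_limit_theorem[rotated]) (auto simp: contc)
qed

lemma corr_weighted:
  assumes \<xi>: "\<xi> \<in> L2 M" and \<eta>: "\<eta> \<in> L2 M" and w: "cont w"
  shows "(\<integral>t. w t * corr \<xi> \<eta> t \<partial>M) = (\<integral>s. (\<integral>t. w t * \<xi> (s + t) \<partial>M) * cnj (\<eta> s) \<partial>M)"
proof -
  obtain W where W: "0 \<le> W" "\<And>x. norm (w x) \<le> W" using cont_bounded[OF w] by blast
  define q where "q = (\<lambda>p::'g \<times> 'g. w (fst p) * (\<xi> (snd p + fst p) * cnj (\<eta> (snd p))))"
  have [measurable]: "\<xi> \<in> borel_measurable M" "(\<lambda>x. cnj (\<eta> x)) \<in> borel_measurable M" "w \<in> borel_measurable M"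
    using \<xi> L2_cnj[OF \<eta>] cont_measurable[OF w] by (auto simp: L2_def)
  have add: "(\<lambda>p::'g \<times> 'g. snd p + fst p) \<in> measurable (M \<Otimes>\<^sub>M M) M"
    using add_measurable by (simp add: measurable_cong_sets[OF refl sets_M] add.commute)
  have q: "q \<in> borel_measurable (M \<Otimes>\<^sub>M M)"
    unfolding q_def
    by (intro borel_measurable_times measurable_compose[OF add] measurable_compose[OF measurable_fst]
        measurable_compose[OF measurable_snd]) measurable
  have iq: "integrable M (\<lambda>s. q (t, s))" for t
    unfolding q_def by (auto intro!: integrable_mult_right L2_integrable_mult L2_translate L2_cnj \<xi> \<eta>)
  have "integrable (M \<Otimes>\<^sub>M M) q"
  proof (rule Fubini_integrable[OF q])
    show "AE t in M. integrable M (\<lambda>s. q (t, s))" using iq by simp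
    show "integrable M (\<lambda>t. \<integral>s. norm (q (t, s)) \<partial>M)"
    proof (rule bounded_integrable)
      show "(\<lambda>t. \<integral>s. norm (q (t, s)) \<partial>M) \<in> borel_measurable M"
        using q by measurable
      fix t
      have "(\<integral>s. norm (q (t, s)) \<partial>M) = norm (w t) * (\<integral>s. norm (\<xi> (s + t) * cnj (\<eta> s)) \<partial>M)"
        by (simp add: q_def norm_mult)
      also have "\<dots> \<le> W * (l2_norm M \<xi> * l2_norm M \<eta>)"
        using L2_Cauchy_Schwarz_norm[OF L2_translate[OF \<xi>] L2_cnj[OF \<eta>], of t] W
        by (intro mult_mono) (auto simp: l2_norm_translate \<xi> l2_norm_cnj)
      finally show "norm (\<integral>s. norm (q (t, s)) \<partial>M) \<le> W * (l2_norm M \<xi> * l2_norm M \<eta>)" by simp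
    qed
  qed
  then have "(\<integral>s. (\<integral>t. q (t, s) \<partial>M) \<partial>M) = (\<integral>t. (\<integral>s. q (t, s) \<partial>M) \<partial>M)"
    using Fubini_integral[of "\<lambda>t s. q (t, s)"] by simp
  moreover have "(\<integral>t. q (t, s) \<partial>M) = (\<integral>t. w t * \<xi> (s + t) \<partial>M) * cnj (\<eta> s)" for s
    by (simp add: q_def mult.assoc[symmetric])
  moreover have "(\<integral>s. q (t, s) \<partial>M) = w t * corr \<xi> \<eta> t" for t
    by (simp add: q_def corr_def)
  ultimately show ?thesis by simp
qed

lemma fcoeff_corr:
  assumes \<xi>: "\<xi> \<in> L2 M" and \<eta>: "\<eta> \<in> L2 M" and \<gamma>: "\<gamma> \<in> characters"
  shows "fcoeff (corr \<xi> \<eta>) \<gamma> = vol * (fcoeff \<xi> \<gamma> * cnj (fcoeff \<eta> \<gamma>))"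
proof -
  have m: "\<xi> \<in> borel_measurable M" using \<xi> by (simp add: L2_def)
  note c = characterD(1)[OF \<gamma>]
  have c2: "cont (\<lambda>t. cnj (\<gamma> t))" using c by (intro continuous_intros)
  have "(\<integral>t. cnj (\<gamma> t) * \<xi> (s + t) \<partial>M) = \<gamma> s * (\<integral>t. \<xi> t * cnj (\<gamma> t) \<partial>M)" for s
  proof -
    have "(\<integral>t. \<xi> t * cnj (\<gamma> t) \<partial>M) = (\<integral>t. \<xi> (t + s) * cnj (\<gamma> (t + s)) \<partial>M)"
      using integral_translation[of "\<lambda>t. \<xi> t * cnj (\<gamma> t)" s] m cont_measurable[OF c2] by simp
    also have "\<dots> = (\<integral>t. cnj (\<gamma> s) * (cnj (\<gamma> t) * \<xi> (s + t)) \<partial>M)"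
      by (simp add: characterD(3)[OF \<gamma>] add.commute mult_ac)
    also have "\<dots> = cnj (\<gamma> s) * (\<integral>t. cnj (\<gamma> t) * \<xi> (s + t) \<partial>M)" by simp
    finally show ?thesis using characterD(6)[OF \<gamma>, of s] by (simp add: mult.assoc[symmetric])
  qed
  then have "(\<integral>t. cnj (\<gamma> t) * corr \<xi> \<eta> t \<partial>M) = (\<integral>s. (\<integral>t. \<xi> t * cnj (\<gamma> t) \<partial>M) * (cnj (\<eta> s * cnj (\<gamma> s))) \<partial>M)"
    unfolding corr_weighted[OF \<xi> \<eta> c2] by (simp add: mult_ac)
  also have "\<dots> = (\<integral>t. \<xi> t * cnj (\<gamma> t) \<partial>M) * cnj (\<integral>s. \<eta> s * cnj (\<gamma> s) \<partial>M)"
    by (subst integral_mult_right_zero) (simp only: Bochner_Integration.integral_cnj)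
  finally show ?thesis using vol_pos by (simp add: fcoeff_def mean_def mult.commute)
qed

lemma absolutely_convergent_fourier_series:
  fixes a :: "('g \<Rightarrow> complex) \<Rightarrow> complex"
  assumes a: "\<forall>F. finite F \<longrightarrow> F \<subseteq> characters \<longrightarrow> (\<Sum>\<gamma>\<in>F. norm (a \<gamma>)) \<le> r"
  obtains h where "\<And>x. ((\<lambda>\<gamma>. a \<gamma> * \<gamma> x) has_sum h x) characters" "cont h"
    "\<And>\<gamma>. \<gamma> \<in> characters \<Longrightarrow> fcoeff h \<gamma> = a \<gamma>"
proof -
  have s: "(\<lambda>\<gamma>. norm (a \<gamma>)) summable_on characters"
    using a by (intro nonneg_bdd_above_summable_on) (auto intro!: bdd_aboveI2[where M = r])
  have sx: "(\<lambda>\<gamma>. a \<gamma> * \<gamma> x) summable_on characters" for x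
    by (rule abs_summable_summable, rule summable_on_cong[THEN iffD1, OF _ s])
      (auto simp: norm_mult characterD(2))
  define h where "h = (\<lambda>x. infsum (\<lambda>\<gamma>. a \<gamma> * \<gamma> x) characters)"
  have hs: "((\<lambda>\<gamma>. a \<gamma> * \<gamma> x) has_sum h x) characters" for x
    unfolding h_def by (rule has_sum_infsum[OF sx])
  have u: "uniform_limit UNIV (\<lambda>F x. \<Sum>\<gamma>\<in>F. a \<gamma> * \<gamma> x) h (finite_subsets_at_top characters)"
    unfolding h_def by (rule Weierstrass_m_test_general[OF _ s]) (auto simp: norm_mult characterD(2))
  have ev: "\<forall>\<^sub>F F in finite_subsets_at_top characters. finite F \<and> F \<subseteq> characters"
    by (rule eventually_finite_subsets_at_top_weakI) auto
  have "\<forall>\<^sub>F F in finite_subsets_at_top characters. cont (\<lambda>x. \<Sum>\<gamma>\<in>F. a \<gamma> * \<gamma> x)"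
    using ev by eventually_elim (auto intro: cont_trig)
  from uniform_limit_theorem[OF this u] have ch: "cont h" by simp
  have "fcoeff h \<gamma> = a \<gamma>" if \<gamma>: "\<gamma> \<in> characters" for \<gamma>
  proof -
  have "norm (fcoeff h \<gamma> - a \<gamma>) \<le> e" if "0 < e" for e :: real
  proof -
    have "\<forall>\<^sub>F F in finite_subsets_at_top characters. \<forall>x\<in>UNIV. dist (\<Sum>\<gamma>\<in>F. a \<gamma> * \<gamma> x) (h x) < e"
      using u that by (simp add: uniform_limit_iff)
    then obtain K where K: "finite K" "K \<subseteq> characters"
      "\<And>F x. finite F \<Longrightarrow> K \<subseteq> F \<Longrightarrow> F \<subseteq> characters \<Longrightarrow> dist (\<Sum>\<gamma>\<in>F. a \<gamma> * \<gamma> x) (h x) < e"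
      by (auto simp: eventually_finite_subsets_at_top)
    define F where "F = insert \<gamma> K"
    have F: "finite F" "F \<subseteq> characters" "\<gamma> \<in> F" "K \<subseteq> F" using K \<gamma> by (auto simp: F_def)
    define p where "p x = (\<Sum>\<gamma>\<in>F. a \<gamma> * \<gamma> x)" for x
    have cp: "cont p" unfolding p_def by (rule cont_trig[OF F(2)])
    have "fcoeff p \<gamma> = a \<gamma>" unfolding p_def by (rule fcoeff_trig[OF F(1,2,3)])
    then have "fcoeff h \<gamma> - a \<gamma> = mean (\<lambda>x. (h x - p x) * cnj (\<gamma> x))"
      unfolding left_diff_distrib fcoeff_def
      by (subst mean_diff) (auto intro!: cont_integrable continuous_intros ch cp characterD(1)[OF \<gamma>])
    also have "norm \<dots> \<le> e"
    proof -
      have "norm ((h x - p x) * cnj (\<gamma> x)) \<le> e" for x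
        using K(3)[OF F(1,4,2), of x]
        by (simp add: norm_mult characterD(2)[OF \<gamma>] p_def dist_norm norm_minus_commute)
      then have "(\<integral>x. norm ((h x - p x) * cnj (\<gamma> x)) \<partial>M) \<le> (\<integral>x. e \<partial>M)"
        by (intro integral_mono integrable_norm cont_integrable continuous_intros ch cp characterD(1)[OF \<gamma>]) auto
      then have "norm (\<integral>x. (h x - p x) * cnj (\<gamma> x) \<partial>M) \<le> (\<integral>x. e \<partial>M)"
        by (rule order_trans[OF integral_norm_bound])
      also have "(\<integral>x. e \<partial>M) = vol * e" by (simp add: vol_def)
      finally show ?thesis using vol_pos by (simp add: mean_def norm_divide divide_simps mult.commute)
    qed
    finally show ?thesis .
  qed
  then have "norm (fcoeff h \<gamma> - a \<gamma>) \<le> 0 + e" if "0 < e" for e using that by simp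
  then have "norm (fcoeff h \<gamma> - a \<gamma>) \<le> 0" by (rule field_le_epsilon)
  then show ?thesis by simp
  qed
  with hs ch show ?thesis by (rule that)
qed

text \<open>The Fourier coefficients of the correlation are products of those of \<open>\<xi>\<close> and \<open>\<eta>\<close>, hence summable by
Bessel's inequality; by uniqueness, the continuous correlation is the sum of its Fourier series.\<close>

theorem wiener_le_corr:
  assumes \<xi>: "\<xi> \<in> L2 M" and \<eta>: "\<eta> \<in> L2 M"
  shows "wiener_le (l2_norm M \<xi> * l2_norm M \<eta>) (corr \<xi> \<eta>)"
proof -
  define a :: "('g \<Rightarrow> complex) \<Rightarrow> complex" where "a \<gamma> = vol * (fcoeff \<xi> \<gamma> * cnj (fcoeff \<eta> \<gamma>))" for \<gamma>
  have bd: "(\<Sum>\<gamma>\<in>F. norm (a \<gamma>)) \<le> l2_norm M \<xi> * l2_norm M \<eta>" if F: "finite F" "F \<subseteq> characters" for F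
  proof -
    have "(\<Sum>\<gamma>\<in>F. norm (fcoeff \<xi> \<gamma>) * norm (fcoeff \<eta> \<gamma>))\<^sup>2 \<le>
      (\<Sum>\<gamma>\<in>F. (norm (fcoeff \<xi> \<gamma>))\<^sup>2) * (\<Sum>\<gamma>\<in>F. (norm (fcoeff \<eta> \<gamma>))\<^sup>2)"
      by (rule Cauchy_Schwarz_ineq_sum)
    also have "\<dots> \<le> sq \<xi> * sq \<eta>"
      by (intro mult_mono Bessel \<xi> \<eta> F sq_nonneg sum_nonneg) auto
    finally have "(\<Sum>\<gamma>\<in>F. norm (fcoeff \<xi> \<gamma>) * norm (fcoeff \<eta> \<gamma>)) \<le> sqrt (sq \<xi> * sq \<eta>)"
      by (rule real_le_rsqrt)
    also have "\<dots> = l2_norm M \<xi> * l2_norm M \<eta> / vol"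
      using vol_pos by (simp add: real_sqrt_mult sqrt_sq)
    finally have "vol * (\<Sum>\<gamma>\<in>F. norm (fcoeff \<xi> \<gamma>) * norm (fcoeff \<eta> \<gamma>)) \<le> l2_norm M \<xi> * l2_norm M \<eta>"
      using vol_pos by (simp add: divide_simps mult.commute)
    then show ?thesis using vol_pos by (simp add: a_def norm_mult sum_distrib_left)
  qed
  have "\<forall>F. finite F \<longrightarrow> F \<subseteq> characters \<longrightarrow> (\<Sum>\<gamma>\<in>F. norm (a \<gamma>)) \<le> l2_norm M \<xi> * l2_norm M \<eta>"
    using bd by blast
  from absolutely_convergent_fourier_series[OF this] obtain h
    where h: "\<And>x. ((\<lambda>\<gamma>. a \<gamma> * \<gamma> x) has_sum h x) characters" "cont h"
      "\<And>\<gamma>. \<gamma> \<in> characters \<Longrightarrow> fcoeff h \<gamma> = a \<gamma>" by blast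
  have "(\<lambda>x. corr \<xi> \<eta> x - h x) = (\<lambda>x. 0)"
  proof (rule fourier_uniqueness)
    show "cont (\<lambda>x. corr \<xi> \<eta> x - h x)" by (intro continuous_intros cont_corr \<xi> \<eta> h)
    fix \<gamma> :: "'g \<Rightarrow> complex" assume \<gamma>: "\<gamma> \<in> characters"
    have "fcoeff (\<lambda>x. corr \<xi> \<eta> x - h x) \<gamma> = fcoeff (corr \<xi> \<eta>) \<gamma> - fcoeff h \<gamma>"
      unfolding fcoeff_def left_diff_distrib
      by (intro mean_diff cont_integrable continuous_intros cont_corr \<xi> \<eta> h characterD(1)[OF \<gamma>])
    also have "\<dots> = 0" unfolding h(3)[OF \<gamma>] fcoeff_corr[OF \<xi> \<eta> \<gamma>] a_def by simp
    finally show "fcoeff (\<lambda>x. corr \<xi> \<eta> x - h x) \<gamma> = 0" .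
  qed
  then have "corr \<xi> \<eta> = h" by (auto simp: fun_eq_iff)
  then show ?thesis unfolding wiener_le_def using bd h(1) by (intro exI[of _ a]) auto
qed

end

section \<open>Finitely many linear conditions\<close>

text \<open>By induction on \<open>I\<close>: on the kernel \<open>W\<close> of \<open>l j\<close> the claim holds with fewer functionals, and a vector
\<open>w\<close> outside \<open>W\<close> determines the remaining coefficient.\<close>

lemma functional_in_span:
  fixes V :: "('a \<Rightarrow> complex) set"
  assumes "finite I"
    and V: "\<And>u v c. u \<in> V \<Longrightarrow> v \<in> V \<Longrightarrow> (\<lambda>x. u x + c * v x) \<in> V"
    and l: "\<And>i u v c. i \<in> I \<Longrightarrow> u \<in> V \<Longrightarrow> v \<in> V \<Longrightarrow> l i (\<lambda>x. u x + c * v x) = l i u + c * l i v"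
    and m: "\<And>u v c. u \<in> V \<Longrightarrow> v \<in> V \<Longrightarrow> m (\<lambda>x. u x + c * v x) = m u + c * (m v :: complex)"
    and ker: "\<And>v. v \<in> V \<Longrightarrow> (\<And>i. i \<in> I \<Longrightarrow> l i v = 0) \<Longrightarrow> m v = 0"
  shows "\<exists>c. \<forall>v\<in>V. m v = (\<Sum>i\<in>I. c i * l i v)"
  using assms
proof (induction I arbitrary: V rule: finite_induct)
  case empty
  then show ?case by simp
next
  case (insert j I)
  note V = insert.prems(1) and l = insert.prems(2) and m = insert.prems(3) and ker = insert.prems(4)
  define W where "W = {v \<in> V. l j v = 0}"
  have "\<exists>c. \<forall>v\<in>W. m v = (\<Sum>i\<in>I. c i * l i v)"
  proof (rule insert.IH)
    show "(\<lambda>x. u x + c * v x) \<in> W" if "u \<in> W" "v \<in> W" for u v c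
      using that V l by (auto simp: W_def)
    show "m v = 0" if "v \<in> W" "\<And>i. i \<in> I \<Longrightarrow> l i v = 0" for v
      using that by (intro ker) (auto simp: W_def)
  qed (use l m in \<open>auto simp: W_def\<close>)
  then obtain c where c: "\<And>v. v \<in> W \<Longrightarrow> m v = (\<Sum>i\<in>I. c i * l i v)" by blast
  show ?case
  proof (cases "\<exists>w\<in>V. l j w \<noteq> 0")
    case False
    then have "W = V" by (auto simp: W_def)
    then show ?thesis using c insert.hyps False by (intro exI[of _ c]) auto
  next
    case True
    then obtain w where w: "w \<in> V" "l j w \<noteq> 0" by blast
    define d where "d = (m w - (\<Sum>i\<in>I. c i * l i w)) / l j w"
    have "m v = d * l j v + (\<Sum>i\<in>I. c i * l i v)" if v: "v \<in> V" for v
    proof -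
      define z where "z = - (l j v / l j w)"
      have "(\<lambda>x. v x + z * w x) \<in> W" unfolding W_def using V[OF v w(1), of z] l[OF _ v w(1), of j z] w(2)
        by (simp add: z_def)
      then have "m v + z * m w = (\<Sum>i\<in>I. c i * (l i v + z * l i w))"
        using c[of "\<lambda>x. v x + z * w x"] m[OF v w(1)] l[OF _ v w(1)] by simp
      also have "\<dots> = (\<Sum>i\<in>I. c i * l i v) + z * (\<Sum>i\<in>I. c i * l i w)"
        by (simp add: distrib_left sum.distrib sum_distrib_left mult_ac)
      finally have "m v = (\<Sum>i\<in>I. c i * l i v) - z * (m w - (\<Sum>i\<in>I. c i * l i w))"
        by (simp add: algebra_simps)
      moreover have "- z * (m w - (\<Sum>i\<in>I. c i * l i w)) = d * l j v"
        by (simp add: z_def d_def)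
      ultimately show ?thesis by simp
    qed
    moreover have "(\<Sum>i\<in>insert j I. (c(j := d)) i * l i v) = d * l j v + (\<Sum>i\<in>I. c i * l i v)" for v
    proof -
      have "(\<Sum>i\<in>I. (c(j := d)) i * l i v) = (\<Sum>i\<in>I. c i * l i v)"
        using insert.hyps by (intro sum.cong) auto
      then show ?thesis using insert.hyps by simp
    qed
    ultimately show ?thesis by (intro exI[of _ "c(j := d)"]) simp
  qed
qed

text \<open>A system of finitely many linear equations is solvable exactly if its right-hand sides satisfy all
linear relations between its left-hand sides. This plays the role of the Hahn-Banach theorem for a
weak topology, and even produces exact solutions.\<close>

lemma solve_finitely_many_functionals:
  fixes V :: "('a \<Rightarrow> complex) set"
  assumes "finite I" and V0: "(\<lambda>_. 0) \<in> V"
    and V: "\<And>u v c. u \<in> V \<Longrightarrow> v \<in> V \<Longrightarrow> (\<lambda>x. u x + c * v x) \<in> V"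
    and l: "\<And>i u v c. i \<in> I \<Longrightarrow> u \<in> V \<Longrightarrow> v \<in> V \<Longrightarrow> l i (\<lambda>x. u x + c * v x) = l i u + c * l i v"
    and rel: "\<And>c. (\<And>v. v \<in> V \<Longrightarrow> (\<Sum>i\<in>I. c i * l i v) = 0) \<Longrightarrow> (\<Sum>i\<in>I. c i * t i) = 0"
  shows "\<exists>u\<in>V. \<forall>i\<in>I. l i u = (t i :: complex)"
  using assms(1) l rel
proof (induction I rule: finite_induct)
  case empty
  then show ?case using V0 by blast
next
  case (insert j I)
  have "\<exists>u\<in>V. \<forall>i\<in>I. l i u = t i"
  proof (rule insert.IH)
    fix c assume c: "\<And>v. v \<in> V \<Longrightarrow> (\<Sum>i\<in>I. c i * l i v) = 0"
    have eq: "(\<Sum>i\<in>insert j I. (c(j := 0)) i * s i) = (\<Sum>i\<in>I. c i * s i)" for s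
    proof -
      have "(\<Sum>i\<in>I. (c(j := 0)) i * s i) = (\<Sum>i\<in>I. c i * s i)"
        using insert.hyps by (intro sum.cong) auto
      then show ?thesis using insert.hyps by simp
    qed
    show "(\<Sum>i\<in>I. c i * t i) = 0" using insert.prems(2)[of "c(j := 0)"] c unfolding eq by blast
  qed (use insert.prems(1) in blast)
  then obtain u where u: "u \<in> V" "\<And>i. i \<in> I \<Longrightarrow> l i u = t i" by blast
  show ?case
  proof (cases "\<exists>w\<in>V. (\<forall>i\<in>I. l i w = 0) \<and> l j w \<noteq> 0")
    case True
    then obtain w where w: "w \<in> V" "\<And>i. i \<in> I \<Longrightarrow> l i w = 0" "l j w \<noteq> 0" by blast
    define z where "z = (t j - l j u) / l j w"
    have "l i (\<lambda>x. u x + z * w x) = t i" if "i \<in> insert j I" for i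
      unfolding insert.prems(1)[OF that u(1) w(1)] using that u(2) w(2,3) by (auto simp: z_def)
    then show ?thesis using V[OF u(1) w(1)] by blast
  next
    case False
    have "\<exists>c. \<forall>v\<in>V. l j v = (\<Sum>i\<in>I. c i * l i v)"
      by (rule functional_in_span[OF insert.hyps(1) V]) (use insert.prems(1) False in auto)
    then obtain c where c: "\<And>v. v \<in> V \<Longrightarrow> l j v = (\<Sum>i\<in>I. c i * l i v)" by blast
    have eq: "(\<Sum>i\<in>insert j I. (c(j := - 1)) i * s i) = (\<Sum>i\<in>I. c i * s i) - s j" for s
    proof -
      have "(\<Sum>i\<in>I. (c(j := - 1)) i * s i) = (\<Sum>i\<in>I. c i * s i)"
        using insert.hyps by (intro sum.cong) auto
      then show ?thesis using insert.hyps by simp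
    qed
    have "(\<Sum>i\<in>I. c i * t i) - t j = 0"
      using insert.prems(2)[of "c(j := - 1)"] c unfolding eq by simp
    then have "l j u = t j" using c[OF u(1)] u(2) by simp
    then show ?thesis using u by blast
  qed
qed

lemma openin_generated_finite_basis:
  assumes "openin (topology_generated_by B) U" "x \<in> U"
  obtains F where "finite F" "F \<noteq> {}" "F \<subseteq> B" "x \<in> \<Inter>F" "\<Inter>F \<subseteq> U"
proof -
  have "\<exists>F. finite F \<and> F \<noteq> {} \<and> F \<subseteq> B \<and> x \<in> \<Inter>F \<and> \<Inter>F \<subseteq> U"
    using openin_topology_generated_by[OF assms(1)] assms(2)
  proof (induction rule: generate_topology_on.induct)
    case (Int a b)
    then obtain F G where "finite F" "F \<noteq> {}" "F \<subseteq> B" "x \<in> \<Inter>F" "\<Inter>F \<subseteq> a"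
      "finite G" "G \<noteq> {}" "G \<subseteq> B" "x \<in> \<Inter>G" "\<Inter>G \<subseteq> b" by auto
    then show ?case by (intro exI[of _ "F \<union> G"]) auto
  next
    case (UN K)
    then obtain k where k: "k \<in> K" "x \<in> k" by auto
    from UN.IH[OF k] obtain F where F: "finite F" "F \<noteq> {}" "F \<subseteq> B" "x \<in> \<Inter>F" "\<Inter>F \<subseteq> k"
      by (elim exE conjE)
    have "\<Inter>F \<subseteq> \<Union>K" using F(5) k(1) by (rule order_trans[OF _ Union_upper])
    with F show ?case by (intro exI[of _ F] conjI)
  next
    case (Basis s)
    then show ?case by (intro exI[of _ "{s}"]) auto
  qed auto
  then show ?thesis by (elim exE conjE) (rule that)
qed

context compact_haar begin

section \<open>Common zeros, and trace class operators as elements of A(G)\<close>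

definition wiener :: "('g \<Rightarrow> complex) \<Rightarrow> bool" where "wiener h \<longleftrightarrow> (\<exists>r. wiener_le r h)"

lemma wiener_mult: "wiener h \<Longrightarrow> wiener k \<Longrightarrow> wiener (\<lambda>x. h x * k x)"
  unfolding wiener_def using wiener_le_mult by blast

lemma wiener_cnj: "wiener h \<Longrightarrow> wiener (\<lambda>x. cnj (h x))"
  unfolding wiener_def using wiener_le_cnj by blast

lemma wiener_cmult: "wiener h \<Longrightarrow> wiener (\<lambda>x. c * h x)"
  unfolding wiener_def using wiener_le_cmult by blast

lemma wiener_sum:
  assumes "finite I" "\<And>i. i \<in> I \<Longrightarrow> wiener (h i)" shows "wiener (\<lambda>x. \<Sum>i\<in>I. h i x)"
proof -
  obtain r where "\<And>i. i \<in> I \<Longrightarrow> wiener_le (r i) (h i)" using assms(2) unfolding wiener_def by metis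
  then have "wiener_le (\<Sum>i\<in>I. r i) (\<lambda>x. \<Sum>i\<in>I. h i x)" by (intro wiener_le_sum assms(1))
  then show ?thesis unfolding wiener_def by blast
qed

text \<open>The functions \<open>h\<close> considered form a proper ideal of \<open>A(G)\<close>. If they had no common zero, a finite sum of
squares of absolute values would be a strictly positive element, invertible by Wiener's lemma.\<close>

theorem common_zero:
  assumes f: "cont f" "\<not> wiener f"
  obtains x0 where "\<And>h. cont h \<Longrightarrow> wiener h \<Longrightarrow> wiener (\<lambda>x. f x * h x) \<Longrightarrow> h x0 = 0"
proof -
  have "\<exists>x0. \<forall>h. cont h \<longrightarrow> wiener h \<longrightarrow> wiener (\<lambda>x. f x * h x) \<longrightarrow> h x0 = 0"
  proof (rule ccontr)
    assume "\<not> ?thesis"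
    then obtain H where H: "\<And>y. cont (H y)" "\<And>y. wiener (H y)" "\<And>y. wiener (\<lambda>x. f x * H y x)" "\<And>y. H y y \<noteq> 0"
      by metis
    have "open {x. H y x \<noteq> 0}" for y using H(1) by (intro open_Collect_neq continuous_intros)
    moreover have "UNIV \<subseteq> (\<Union>y\<in>UNIV. {x. H y x \<noteq> 0})" using H(4) by auto
    ultimately obtain F where F: "finite F" "UNIV \<subseteq> (\<Union>y\<in>F. {x. H y x \<noteq> 0})"
      using compactE_image[OF compact_group, of UNIV "\<lambda>y. {x. H y x \<noteq> 0}"] by metis
    define S where "S x = (\<Sum>y\<in>F. H y x * cnj (H y x))" for x
    define k where "k x = (\<Sum>y\<in>F. (norm (H y x))\<^sup>2)" for x
    have Sk: "S x = complex_of_real (k x)" for x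
      unfolding S_def k_def of_real_sum complex_norm_square ..
    have kpos: "0 < k x" for x
    proof -
      obtain y where y: "y \<in> F" "H y x \<noteq> 0" using F(2) by auto
      have "0 < (norm (H y x))\<^sup>2" using y by simp
      also have "\<dots> \<le> k x" unfolding k_def using F y by (intro member_le_sum) auto
      finally show ?thesis .
    qed
    have "wiener S" unfolding S_def by (intro wiener_sum F wiener_mult wiener_cnj H)
    moreover have "cont S" unfolding S_def by (intro continuous_intros H)
    moreover obtain r where "wiener_le r S" using \<open>wiener S\<close> unfolding wiener_def by blast
    ultimately obtain R where "wiener_le R (\<lambda>x. 1 / S x)" using Wiener_inverse[of r S k] Sk kpos by blast
    then have inv: "wiener (\<lambda>x. 1 / S x)" unfolding wiener_def by blast
    have "wiener (\<lambda>x. \<Sum>y\<in>F. (f x * H y x) * cnj (H y x))" by (intro wiener_sum F wiener_mult[OF H(3) wiener_cnj[OF H(2)]])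
    from wiener_mult[OF this inv] have "wiener (\<lambda>x. (\<Sum>y\<in>F. (f x * H y x) * cnj (H y x)) * (1 / S x))" .
    moreover have "(\<Sum>y\<in>F. (f x * H y x) * cnj (H y x)) * (1 / S x) = f x" for x
    proof -
      have "(\<Sum>y\<in>F. (f x * H y x) * cnj (H y x)) = f x * S x"
        by (simp add: S_def sum_distrib_left mult.assoc)
      moreover have "S x \<noteq> 0" using Sk[of x] kpos[of x] by simp
      ultimately show ?thesis by simp
    qed
    ultimately show False using f(2) by simp
  qed
  then show ?thesis using that by blast
qed

text \<open>The element of \<open>A(G)\<close> attached to the trace class operator \<open>(\<Sum>n. \<xi> n \<otimes> (\<eta> n)\<^sup>*)\<close>.\<close>

definition corr_sum :: "(nat \<Rightarrow> 'g \<Rightarrow> complex) \<Rightarrow> (nat \<Rightarrow> 'g \<Rightarrow> complex) \<Rightarrow> 'g \<Rightarrow> complex" where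
  "corr_sum \<xi> \<eta> t = (\<Sum>n. corr (\<xi> n) (\<eta> n) t)"

lemma corr_sum_properties:
  assumes \<xi>: "square_summable M \<xi>" and \<eta>: "square_summable M \<eta>"
  shows "cont (corr_sum \<xi> \<eta>)" and "wiener (corr_sum \<xi> \<eta>)"
    and "\<And>w. cont w \<Longrightarrow> (\<Sum>n. \<integral>t. w t * corr (\<xi> n) (\<eta> n) t \<partial>M) = (\<integral>t. w t * corr_sum \<xi> \<eta> t \<partial>M)"
proof -
  define r where "r n = l2_norm M (\<xi> n) * l2_norm M (\<eta> n)" for n
  have L: "\<xi> n \<in> L2 M" "\<eta> n \<in> L2 M" for n using assms by (auto simp: square_summable_def)
  have r0: "0 \<le> r n" for n by (simp add: r_def l2_norm_nonneg)
  have sr: "summable r"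
  proof (rule summable_comparison_test')
    show "summable (\<lambda>n. (l2_norm M (\<xi> n))\<^sup>2 + (l2_norm M (\<eta> n))\<^sup>2)"
      using assms by (auto simp: square_summable_def intro: summable_add)
    fix n
    have "2 * r n \<le> (l2_norm M (\<xi> n))\<^sup>2 + (l2_norm M (\<eta> n))\<^sup>2"
      using sum_squares_bound[of "l2_norm M (\<xi> n)" "l2_norm M (\<eta> n)"] by (simp add: r_def mult.assoc)
    then show "norm (r n) \<le> (l2_norm M (\<xi> n))\<^sup>2 + (l2_norm M (\<eta> n))\<^sup>2" using r0[of n] by simp
  qed
  have le: "norm (corr (\<xi> n) (\<eta> n) t) \<le> r n" for n t unfolding r_def by (rule corr_bound[OF L])
  have "uniform_limit UNIV (\<lambda>n t. \<Sum>i<n. corr (\<xi> i) (\<eta> i) t) (corr_sum \<xi> \<eta>) sequentially"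
    unfolding corr_sum_def[abs_def] by (rule Weierstrass_m_test[OF le sr])
  then show "cont (corr_sum \<xi> \<eta>)"
    by (rule uniform_limit_theorem[rotated]) (auto intro!: always_eventually continuous_intros cont_corr L)
  have ns: "summable (\<lambda>n. norm (corr (\<xi> n) (\<eta> n) t))" for t
    by (rule summable_comparison_test'[OF sr]) (simp add: le)
  have "wiener_le (suminf r) (corr_sum \<xi> \<eta>)"
  proof (rule wiener_le_family[where I = UNIV and r = r])
    show "wiener_le (r n) (corr (\<xi> n) (\<eta> n))" for n unfolding r_def by (rule wiener_le_corr[OF L])
    show "sum r F \<le> suminf r" if "finite F" for F using that sr r0 by (intro sum_le_suminf) auto
    show "((\<lambda>n. corr (\<xi> n) (\<eta> n) t) has_sum corr_sum \<xi> \<eta> t) UNIV" for t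
      unfolding corr_sum_def by (intro norm_summable_imp_has_sum ns summable_sums summable_norm_cancel[OF ns])
  qed
  then show "wiener (corr_sum \<xi> \<eta>)" unfolding wiener_def by blast
  fix w :: "'g \<Rightarrow> complex" assume w: "cont w"
  obtain W where W: "0 \<le> W" "\<And>x. norm (w x) \<le> W" using cont_bounded[OF w] by blast
  have ci: "integrable M (\<lambda>t. w t * corr (\<xi> n) (\<eta> n) t)" for n
    by (intro cont_integrable continuous_intros w cont_corr L)
  have "(\<integral>t. (\<Sum>n. w t * corr (\<xi> n) (\<eta> n) t) \<partial>M) = (\<Sum>n. \<integral>t. w t * corr (\<xi> n) (\<eta> n) t \<partial>M)"
  proof (rule integral_suminf[OF ci])
    show "AE t in M. summable (\<lambda>n. norm (w t * corr (\<xi> n) (\<eta> n) t))"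
      by (auto simp: norm_mult intro!: summable_mult ns)
    show "summable (\<lambda>n. \<integral>t. norm (w t * corr (\<xi> n) (\<eta> n) t) \<partial>M)"
    proof (rule summable_comparison_test')
      show "summable (\<lambda>n. vol * (W * r n))" by (intro summable_mult sr)
      fix n
      have "(\<integral>t. norm (w t * corr (\<xi> n) (\<eta> n) t) \<partial>M) \<le> (\<integral>t. W * r n \<partial>M)"
      proof (rule integral_mono[OF integrable_norm[OF ci]])
        show "norm (w t * corr (\<xi> n) (\<eta> n) t) \<le> W * r n" for t
          unfolding norm_mult by (intro mult_mono W le) auto
      qed simp
      then show "norm (\<integral>t. norm (w t * corr (\<xi> n) (\<eta> n) t) \<partial>M) \<le> vol * (W * r n)"
        by (simp add: vol_def)
    qed
  qed
  moreover have "(\<Sum>n. w t * corr (\<xi> n) (\<eta> n) t) = w t * corr_sum \<xi> \<eta> t" for t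
    unfolding corr_sum_def by (intro suminf_mult summable_norm_cancel[OF ns])
  ultimately show "(\<Sum>n. \<integral>t. w t * corr (\<xi> n) (\<eta> n) t \<partial>M) = (\<integral>t. w t * corr_sum \<xi> \<eta> t \<partial>M)" by simp
qed

section \<open>The weak* closure of the graph\<close>

definition toeplitz :: "('g \<Rightarrow> complex) \<Rightarrow> 'g \<times> 'g \<Rightarrow> complex" where
  "toeplitz u = (\<lambda>(x, y). u (x - y))"

lemma cont_toeplitz: "cont u \<Longrightarrow> cont (toeplitz u)"
  unfolding toeplitz_def case_prod_beta
  by (rule continuous_on_compose2[of UNIV u]) (auto intro!: continuous_intros)

lemma integral_op_toeplitz:
  assumes u: "cont u" and \<xi>: "\<xi> \<in> L2 M"
  shows "integral_op M (toeplitz u) \<xi> y = (\<integral>t. u t * \<xi> (y + t) \<partial>M)"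
proof -
  have m: "\<xi> \<in> borel_measurable M" using \<xi> by (simp add: L2_def)
  have "(\<lambda>x. u (x - y) * \<xi> x) \<in> borel_measurable M"
    using cont_measurable[OF cont_translate[OF u, of "- y"]] m by simp
  from integral_translation[OF this, of y]
  show ?thesis by (simp add: integral_op_def toeplitz_def add.commute)
qed

text \<open>This reduces the continuity and the bound of a convolution operator to those of correlations.\<close>

lemma integral_op_toeplitz_corr:
  assumes "cont u" "\<xi> \<in> L2 M"
  shows "integral_op M (toeplitz u) \<xi> = corr \<xi> (\<lambda>x. cnj (u x))"
  by (rule ext) (simp add: integral_op_toeplitz[OF assms] corr_def add.commute mult.commute)

lemma bounded_op_toeplitz:
  assumes u: "cont u" shows "bounded_op M (integral_op M (toeplitz u))"
proof -
  have cu: "cont (\<lambda>x. cnj (u x))" using u by (intro continuous_intros)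
  note uL = cont_L2[OF cu]
  have T: "integral_op M (toeplitz u) \<xi> = corr \<xi> (\<lambda>x. cnj (u x))" if "\<xi> \<in> L2 M" for \<xi>
    by (rule integral_op_toeplitz_corr[OF u that])
  show ?thesis unfolding bounded_op_def
  proof (intro conjI ballI allI impI)
    fix \<xi> assume \<xi>: "\<xi> \<in> L2 M"
    show "integral_op M (toeplitz u) \<xi> \<in> L2 M" unfolding T[OF \<xi>] by (intro cont_L2 cont_corr \<xi> uL)
    fix \<eta> assume \<eta>: "\<eta> \<in> L2 M"
    show "AE x in M. integral_op M (toeplitz u) (\<lambda>y. \<xi> y + \<eta> y) x =
        integral_op M (toeplitz u) \<xi> x + integral_op M (toeplitz u) \<eta> x"
      unfolding T[OF \<xi>] T[OF \<eta>] T[OF L2_add[OF \<xi> \<eta>]] corr_def distrib_right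
      by (intro AE_I2 Bochner_Integration.integral_add L2_integrable_mult L2_translate L2_cnj \<xi> \<eta> uL)
    assume ae: "AE x in M. \<xi> x = \<eta> x"
    have m: "\<xi> \<in> borel_measurable M" "\<eta> \<in> borel_measurable M" using \<xi> \<eta> by (auto simp: L2_def)
    have "integral_op M (toeplitz u) \<xi> y = integral_op M (toeplitz u) \<eta> y" for y
      unfolding integral_op_def toeplitz_def prod.case
    proof (rule integral_cong_AE)
      have c: "(\<lambda>x. u (x - y)) \<in> borel_measurable M" using cont_measurable[OF cont_translate[OF u, of "- y"]] by simp
      show "(\<lambda>x. u (x - y) * \<xi> x) \<in> borel_measurable M" "(\<lambda>x. u (x - y) * \<eta> x) \<in> borel_measurable M"
        using m c by auto
      show "AE x in M. u (x - y) * \<xi> x = u (x - y) * \<eta> x" using ae by eventually_elim simp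
    qed
    then show "AE x in M. integral_op M (toeplitz u) \<xi> x = integral_op M (toeplitz u) \<eta> x" by simp
  next
    fix c \<xi> assume \<xi>: "\<xi> \<in> L2 M"
    show "AE x in M. integral_op M (toeplitz u) (\<lambda>y. c * \<xi> y) x = c * integral_op M (toeplitz u) \<xi> x"
      by (simp add: integral_op_def mult.left_commute)
  next
    show "\<exists>C. \<forall>\<xi>\<in>L2 M. l2_norm M (integral_op M (toeplitz u) \<xi>) \<le> C * l2_norm M \<xi>"
    proof (intro exI ballI)
      fix \<xi> assume \<xi>: "\<xi> \<in> L2 M"
      have "sq (corr \<xi> (\<lambda>x. cnj (u x))) \<le> (l2_norm M \<xi> * l2_norm M (\<lambda>x. cnj (u x)))\<^sup>2"
        by (intro sq_le cont_corr corr_bound \<xi> uL)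
      then have "sqrt (sq (corr \<xi> (\<lambda>x. cnj (u x)))) \<le> l2_norm M \<xi> * l2_norm M (\<lambda>x. cnj (u x))"
        by (intro real_le_lsqrt) (auto simp: sq_nonneg l2_norm_nonneg)
      then show "l2_norm M (integral_op M (toeplitz u) \<xi>) \<le> (sqrt vol * l2_norm M (\<lambda>x. cnj (u x))) * l2_norm M \<xi>"
        using vol_pos by (simp add: T[OF \<xi>] sqrt_sq divide_simps mult_ac)
    qed
  qed
qed

lemma trace_pairing_toeplitz:
  assumes u: "cont u" and "square_summable M \<xi>" "square_summable M \<eta>"
  shows "trace_pairing M \<xi> \<eta> (integral_op M (toeplitz u)) = (\<integral>t. u t * corr_sum \<xi> \<eta> t \<partial>M)"
proof -
  have L: "\<xi> n \<in> L2 M" "\<eta> n \<in> L2 M" for n using assms by (auto simp: square_summable_def)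
  have "l2_inner M (integral_op M (toeplitz u) (\<xi> n)) (\<eta> n) = (\<integral>t. u t * corr (\<xi> n) (\<eta> n) t \<partial>M)" for n
    unfolding l2_inner_def integral_op_toeplitz[OF u L(1)] corr_weighted[OF L u] ..
  then show ?thesis unfolding trace_pairing_def using corr_sum_properties(3)[OF assms(2,3) u] by simp
qed

definition translation_op :: "'g \<Rightarrow> 'g l2_op" where
  "translation_op a \<xi> = (\<lambda>x. \<xi> (x + a))"

lemma bounded_op_translation: "bounded_op M (translation_op a)"
  unfolding bounded_op_def translation_op_def
proof (intro conjI ballI allI impI)
  fix \<xi> \<eta> :: "'g \<Rightarrow> complex" assume "AE x in M. \<xi> x = \<eta> x"
  then have "AE x in distr M M (\<lambda>x. x + a). \<xi> x = \<eta> x" unfolding distr_translation .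
  then show "AE x in M. \<xi> (x + a) = \<eta> (x + a)" by (rule AE_distrD[OF translation_measurable])
next
  show "\<exists>C. \<forall>\<xi>\<in>L2 M. l2_norm M (\<lambda>x. \<xi> (x + a)) \<le> C * l2_norm M \<xi>"
    by (intro exI[of _ 1]) (simp add: l2_norm_translate)
qed (auto intro: L2_translate)

lemma trace_pairing_translation: "trace_pairing M \<xi> \<eta> (translation_op a) = corr_sum \<xi> \<eta> a"
  by (simp add: trace_pairing_def l2_inner_def translation_op_def corr_sum_def corr_def)

lemma bounded_op_zero: "bounded_op M (\<lambda>\<xi> x. 0)"
  by (auto simp: bounded_op_def L2_def l2_norm_def intro: exI[of _ 0])

lemma L2_pair_cont: assumes "cont (k :: 'g \<times> 'g \<Rightarrow> complex)" shows "k \<in> L2 (M \<Otimes>\<^sub>M M)"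
proof -
  have "cont (\<lambda>x. complex_of_real ((norm (k x))\<^sup>2))" using assms by (intro continuous_intros)
  from integrable_Re[OF pair_integrable_cont[OF this]] show ?thesis
    using assms cont_measurable_pair by (auto simp: L2_def)
qed

lemma toeplitz_in_graph:
  assumes "cont f" "cont u"
  shows "(integral_op M (toeplitz u), integral_op M (toeplitz (\<lambda>t. f t * u t))) \<in> multiplier_graph M (toeplitz f)"
proof -
  have eq: "(\<lambda>p. toeplitz f p * toeplitz u p) = toeplitz (\<lambda>t. f t * u t)"
    by (auto simp: toeplitz_def fun_eq_iff)
  have "toeplitz u \<in> multiplier_domain M (toeplitz f)"
    unfolding multiplier_domain_def eq using assms
    by (auto intro!: L2_pair_cont cont_toeplitz continuous_intros)
  then show ?thesis unfolding multiplier_graph_def by (auto simp: eq)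
qed

lemma topspace_weak_star: "topspace (weak_star_topology M) = {T. bounded_op M T}"
proof -
  have "square_summable M (\<lambda>_ _. 0)" by (auto simp: square_summable_def L2_def l2_norm_def)
  then show ?thesis unfolding weak_star_topology_def topology_generated_by_topspace by blast
qed

text \<open>A basic neighbourhood constrains the pairings with finitely many trace class operators only; the
approximants constructed below have exactly the pairings of \<open>T0\<close>.\<close>

lemma weak_star_neighbourhood:
  assumes "openin (weak_star_topology M) U" "T0 \<in> U"
  obtains F and X Y :: "'g l2_op set \<Rightarrow> nat \<Rightarrow> 'g \<Rightarrow> complex"
  where "finite F" "\<forall>b\<in>F. square_summable M (X b) \<and> square_summable M (Y b)"
    "\<forall>T. bounded_op M T \<longrightarrow> (\<forall>b\<in>F. trace_pairing M (X b) (Y b) T = trace_pairing M (X b) (Y b) T0) \<longrightarrow> T \<in> U"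
proof -
  obtain F where F: "finite F" "F \<noteq> {}" and FB: "F \<subseteq> {{T. bounded_op M T \<and> trace_pairing M \<xi> \<eta> T \<in> U} | \<xi> \<eta> U.
        square_summable M \<xi> \<and> square_summable M \<eta> \<and> open U}" and FT: "T0 \<in> \<Inter>F" "\<Inter>F \<subseteq> U"
    by (rule openin_generated_finite_basis[OF assms[unfolded weak_star_topology_def]])
  define P where "P b \<xi> \<eta> \<Omega> \<longleftrightarrow> square_summable M \<xi> \<and> square_summable M \<eta> \<and>
    (\<forall>T. T \<in> b \<longleftrightarrow> bounded_op M T \<and> trace_pairing M \<xi> \<eta> T \<in> \<Omega>)" for b \<xi> \<eta> \<Omega>
  have "\<forall>b\<in>F. \<exists>\<xi> \<eta> \<Omega>. P b \<xi> \<eta> \<Omega>"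
  proof
    fix b assume "b \<in> F"
    then have "b \<in> {{T. bounded_op M T \<and> trace_pairing M \<xi> \<eta> T \<in> U} | \<xi> \<eta> U.
        square_summable M \<xi> \<and> square_summable M \<eta> \<and> open U}" by (rule subsetD[OF FB])
    then obtain \<xi> \<eta> \<Omega> where "b = {T. bounded_op M T \<and> trace_pairing M \<xi> \<eta> T \<in> \<Omega>}"
      "square_summable M \<xi>" "square_summable M \<eta>" unfolding mem_Collect_eq by (elim exE conjE)
    then have "P b \<xi> \<eta> \<Omega>" by (simp add: P_def)
    then show "\<exists>\<xi> \<eta> \<Omega>. P b \<xi> \<eta> \<Omega>" by (intro exI)
  qed
  from bchoice[OF this] obtain X where "\<forall>b\<in>F. \<exists>\<eta> \<Omega>. P b (X b) \<eta> \<Omega>" by (elim exE)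
  from bchoice[OF this] obtain Y where "\<forall>b\<in>F. \<exists>\<Omega>. P b (X b) (Y b) \<Omega>" by (elim exE)
  from bchoice[OF this] obtain \<Omega> where P: "\<forall>b\<in>F. P b (X b) (Y b) (\<Omega> b)" by (elim exE)
  have XY: "\<forall>b\<in>F. square_summable M (X b) \<and> square_summable M (Y b)"
    using P by (auto simp: P_def)
  show ?thesis
  proof (rule that[OF F(1) XY], intro allI impI)
    fix T assume T: "bounded_op M T" "\<forall>b\<in>F. trace_pairing M (X b) (Y b) T = trace_pairing M (X b) (Y b) T0"
    have "T \<in> b" if "b \<in> F" for b
    proof -
      have mem: "S \<in> b \<longleftrightarrow> bounded_op M S \<and> trace_pairing M (X b) (Y b) S \<in> \<Omega> b" for S
        using P that unfolding P_def by blast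
      have "T0 \<in> b" using FT(1) that by blast
      then show ?thesis unfolding mem using T that by simp
    qed
    then show "T \<in> U" using FT(2) by blast
  qed
qed

text \<open>A neighbourhood of the pair imposes the conditions \<open>\<integral>t. u t * g1 b t \<partial>M = 0\<close> and
\<open>\<integral>t. f t * u t * g2 b t \<partial>M = g2 b x0\<close> for finitely many functions \<open>g1 b\<close> and \<open>g2 b\<close> in \<open>A(G)\<close>. A
linear relation between the left-hand sides, valid for all continuous \<open>u\<close>, means \<open>a + f \<cdot> h = 0\<close> for
combinations \<open>a\<close> of the \<open>g1 b\<close> and \<open>h\<close> of the \<open>g2 b\<close>; then \<open>f \<cdot> h\<close> is in \<open>A(G)\<close>, so \<open>h\<close> vanishes at
\<open>x0\<close> and the relation holds for the right-hand sides too.\<close>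

lemma translation_in_closure:
  assumes f: "cont f" and x0: "\<And>h. cont h \<Longrightarrow> wiener h \<Longrightarrow> wiener (\<lambda>x. f x * h x) \<Longrightarrow> h x0 = 0"
  shows "(\<lambda>\<xi> x. 0, translation_op x0) \<in>
    prod_topology (weak_star_topology M) (weak_star_topology M) closure_of multiplier_graph M (toeplitz f)"
  unfolding in_closure_of
proof (intro conjI allI impI)
  show "(\<lambda>\<xi> x. 0, translation_op x0) \<in> topspace (prod_topology (weak_star_topology M) (weak_star_topology M))"
    by (simp add: topspace_weak_star bounded_op_zero bounded_op_translation)
  fix W assume "(\<lambda>\<xi> x. 0, translation_op x0) \<in> W \<and> openin (prod_topology (weak_star_topology M) (weak_star_topology M)) W"
  then obtain U1 U2 where U: "openin (weak_star_topology M) U1" "openin (weak_star_topology M) U2"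
    "(\<lambda>\<xi> x. 0) \<in> U1" "translation_op x0 \<in> U2" "U1 \<times> U2 \<subseteq> W"
    unfolding openin_prod_topology_alt by blast
  obtain F1 and X1 Y1 :: "'g l2_op set \<Rightarrow> nat \<Rightarrow> 'g \<Rightarrow> complex"
    where fin1: "finite F1" and ss1: "\<forall>b\<in>F1. square_summable M (X1 b) \<and> square_summable M (Y1 b)"
    and nb1: "\<forall>T. bounded_op M T \<longrightarrow> (\<forall>b\<in>F1. trace_pairing M (X1 b) (Y1 b) T = trace_pairing M (X1 b) (Y1 b) (\<lambda>\<xi> x. 0)) \<longrightarrow> T \<in> U1"
    by (rule weak_star_neighbourhood[OF U(1,3)])
  obtain F2 and X2 Y2 :: "'g l2_op set \<Rightarrow> nat \<Rightarrow> 'g \<Rightarrow> complex"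
    where fin2: "finite F2" and ss2: "\<forall>b\<in>F2. square_summable M (X2 b) \<and> square_summable M (Y2 b)"
    and nb2: "\<forall>T. bounded_op M T \<longrightarrow> (\<forall>b\<in>F2. trace_pairing M (X2 b) (Y2 b) T = trace_pairing M (X2 b) (Y2 b) (translation_op x0)) \<longrightarrow> T \<in> U2"
    by (rule weak_star_neighbourhood[OF U(2,4)])
  define g1 where "g1 b = corr_sum (X1 b) (Y1 b)" for b
  define g2 where "g2 b = corr_sum (X2 b) (Y2 b)" for b
  have g1: "cont (g1 b)" "wiener (g1 b)" if "b \<in> F1" for b
    unfolding g1_def using corr_sum_properties(1,2)[of "X1 b" "Y1 b"] ss1 that by auto
  have g2: "cont (g2 b)" "wiener (g2 b)" if "b \<in> F2" for b
    unfolding g2_def using corr_sum_properties(1,2)[of "X2 b" "Y2 b"] ss2 that by auto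
  define I where "I = Inl ` F1 \<union> Inr ` F2"
  define l where "l i u = (case i of Inl b \<Rightarrow> (\<integral>t. u t * g1 b t \<partial>M) | Inr b \<Rightarrow> (\<integral>t. (f t * u t) * g2 b t \<partial>M))" for i u
  define t where "t i = (case i of Inl b \<Rightarrow> 0 | Inr b \<Rightarrow> g2 b x0)"
    for i :: "'g l2_op set + 'g l2_op set"
  have sumI: "(\<Sum>i\<in>I. s i) = (\<Sum>b\<in>F1. s (Inl b)) + (\<Sum>b\<in>F2. s (Inr b))" for s :: "_ \<Rightarrow> complex"
    unfolding I_def using fin1 fin2 by (subst sum.union_disjoint) (auto simp: sum.reindex)
  have "\<exists>u\<in>Collect cont. \<forall>i\<in>I. l i u = t i"
  proof (rule solve_finitely_many_functionals)
    show "finite I" using fin1 fin2 by (simp add: I_def)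
    show "(\<lambda>_. 0) \<in> Collect cont" by simp
    show "(\<lambda>x. u x + c * v x) \<in> Collect cont" if "u \<in> Collect cont" "v \<in> Collect cont" for u v :: "'g \<Rightarrow> complex" and c
      using that by (auto intro!: continuous_intros)
    show "l i (\<lambda>x. u x + c * v x) = l i u + c * l i v" if "i \<in> I" "u \<in> Collect cont" "v \<in> Collect cont" for i u v c
    proof -
      have lin: "(\<integral>t. (p t + c * q t) \<partial>M) = (\<integral>t. p t \<partial>M) + c * (\<integral>t. q t \<partial>M)" if "cont p" "cont q" for p q
        using cont_integrable that by simp
      show ?thesis
      proof (cases i)
        case (Inl b)
        then have c1: "cont (g1 b)" using that(1) g1 by (auto simp: I_def)
        have "l i (\<lambda>x. u x + c * v x) = (\<integral>t. u t * g1 b t + c * (v t * g1 b t) \<partial>M)"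
          by (simp add: l_def Inl algebra_simps)
        also have "\<dots> = l i u + c * l i v"
          using that(2,3) c1 by (subst lin) (auto simp: l_def Inl intro!: continuous_intros)
        finally show ?thesis .
      next
        case (Inr b)
        then have c1: "cont (g2 b)" using that(1) g2 by (auto simp: I_def)
        have "l i (\<lambda>x. u x + c * v x) = (\<integral>t. (f t * u t) * g2 b t + c * ((f t * v t) * g2 b t) \<partial>M)"
          by (simp add: l_def Inr algebra_simps)
        also have "\<dots> = l i u + c * l i v"
          using that(2,3) c1 f by (subst lin) (auto simp: l_def Inr intro!: continuous_intros)
        finally show ?thesis .
      qed
    qed
    fix c assume rel: "\<And>v. v \<in> Collect cont \<Longrightarrow> (\<Sum>i\<in>I. c i * l i v) = 0"
    define a where "a x = (\<Sum>b\<in>F1. c (Inl b) * g1 b x)" for x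
    define h where "h x = (\<Sum>b\<in>F2. c (Inr b) * g2 b x)" for x
    have ca: "cont a" and ch: "cont h" unfolding a_def h_def by (intro continuous_intros g1 g2; assumption)+
    have Aa: "wiener a" and Ah: "wiener h" unfolding a_def h_def using fin1 fin2 g1 g2 by (auto intro!: wiener_sum wiener_cmult)
    \<comment> \<open>Testing the relation against the complex conjugate of \<open>q\<close> shows that \<open>q\<close> vanishes.\<close>
    define q where "q x = a x + f x * h x" for x
    have cq: "cont q" unfolding q_def by (intro continuous_intros ca ch f)
    have int: "(\<Sum>i\<in>I. c i * l i v) = (\<integral>t. q t * v t \<partial>M)" if v: "cont v" for v
    proof -
      have "(\<integral>t. q t * v t \<partial>M) = (\<integral>t. (\<Sum>b\<in>F1. c (Inl b) * (v t * g1 b t)) + (\<Sum>b\<in>F2. c (Inr b) * ((f t * v t) * g2 b t)) \<partial>M)"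
        by (simp add: q_def a_def h_def distrib_left distrib_right sum_distrib_left sum_distrib_right mult_ac)
      also have "\<dots> = (\<integral>t. (\<Sum>b\<in>F1. c (Inl b) * (v t * g1 b t)) \<partial>M) + (\<integral>t. (\<Sum>b\<in>F2. c (Inr b) * ((f t * v t) * g2 b t)) \<partial>M)"
        by (intro Bochner_Integration.integral_add cont_integrable continuous_intros v f g1 g2)
      also have "(\<integral>t. (\<Sum>b\<in>F1. c (Inl b) * (v t * g1 b t)) \<partial>M) = (\<Sum>b\<in>F1. c (Inl b) * (\<integral>t. v t * g1 b t \<partial>M))"
        by (subst Bochner_Integration.integral_sum) (auto intro!: cont_integrable continuous_intros v g1)
      also have "(\<integral>t. (\<Sum>b\<in>F2. c (Inr b) * ((f t * v t) * g2 b t)) \<partial>M) = (\<Sum>b\<in>F2. c (Inr b) * (\<integral>t. (f t * v t) * g2 b t \<partial>M))"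
        by (subst Bochner_Integration.integral_sum) (auto intro!: cont_integrable continuous_intros v f g2)
      finally show ?thesis by (simp add: sumI l_def)
    qed
    have ccq: "cont (\<lambda>x. cnj (q x))" by (intro continuous_intros cq)
    have "(\<integral>x. q x * cnj (q x) \<partial>M) = 0" using int[OF ccq] rel[of "\<lambda>x. cnj (q x)"] ccq by simp
    then have "sq q = 0" using mean_sq[of q] by (simp add: mean_def)
    then have "q = (\<lambda>x. 0)" using sq_pos[OF cq] by auto
    then have "f x * h x = (- 1) * a x" for x by (simp add: q_def fun_eq_iff eq_neg_iff_add_eq_0 add.commute)
    then have "wiener (\<lambda>x. f x * h x)" using wiener_cmult[OF Aa, of "- 1"] by simp
    from x0[OF ch Ah this] show "(\<Sum>i\<in>I. c i * t i) = 0" by (simp add: sumI t_def h_def)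
  qed
  then obtain u where u: "cont u" "\<And>i. i \<in> I \<Longrightarrow> l i u = t i" by auto
  have cfu: "cont (\<lambda>t. f t * u t)" by (intro continuous_intros f u)
  have "integral_op M (toeplitz u) \<in> U1"
  proof (rule nb1[rule_format, OF bounded_op_toeplitz[OF u(1)]])
    fix b assume b: "b \<in> F1"
    have "trace_pairing M (X1 b) (Y1 b) (integral_op M (toeplitz u)) = l (Inl b) u"
      by (simp add: trace_pairing_toeplitz[OF u(1) bspec[OF ss1 b, THEN conjunct1] bspec[OF ss1 b, THEN conjunct2]] l_def g1_def)
    also have "\<dots> = 0" using u(2)[of "Inl b"] b by (simp add: I_def t_def)
    finally show "trace_pairing M (X1 b) (Y1 b) (integral_op M (toeplitz u)) = trace_pairing M (X1 b) (Y1 b) (\<lambda>\<xi> x. 0)"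
      by (simp add: trace_pairing_def l2_inner_def)
  qed
  moreover have "integral_op M (toeplitz (\<lambda>t. f t * u t)) \<in> U2"
  proof (rule nb2[rule_format, OF bounded_op_toeplitz[OF cfu]])
    fix b assume b: "b \<in> F2"
    have "trace_pairing M (X2 b) (Y2 b) (integral_op M (toeplitz (\<lambda>t. f t * u t))) = l (Inr b) u"
      by (simp add: trace_pairing_toeplitz[OF cfu bspec[OF ss2 b, THEN conjunct1] bspec[OF ss2 b, THEN conjunct2]] l_def g2_def)
    also have "\<dots> = g2 b x0" using u(2)[of "Inr b"] b by (simp add: I_def t_def)
    finally show "trace_pairing M (X2 b) (Y2 b) (integral_op M (toeplitz (\<lambda>t. f t * u t))) = trace_pairing M (X2 b) (Y2 b) (translation_op x0)"
      by (simp add: trace_pairing_translation g2_def)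
  qed
  ultimately show "\<exists>y. y \<in> multiplier_graph M (toeplitz f) \<and> y \<in> W"
    using toeplitz_in_graph[OF f u(1)] U(5) by blast
qed

theorem not_weak_star_closable:
  assumes f: "cont f" "\<not> wiener f"
  shows "\<not> weak_star_closable M (toeplitz f)"
proof
  assume cl: "weak_star_closable M (toeplitz f)"
  obtain x0 where x0: "\<And>h. cont h \<Longrightarrow> wiener h \<Longrightarrow> wiener (\<lambda>x. f x * h x) \<Longrightarrow> h x0 = 0"
    using common_zero[OF f] by blast
  let ?G = "prod_topology (weak_star_topology M) (weak_star_topology M) closure_of multiplier_graph M (toeplitz f)"
  have "(\<lambda>\<xi> x. 0, translation_op x0) \<in> ?G" by (rule translation_in_closure[OF f(1) x0])
  moreover have "(\<lambda>\<xi> x. 0, \<lambda>\<xi> x. 0) \<in> ?G"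
  proof -
    have z: "integral_op M (toeplitz (\<lambda>_. 0)) = (\<lambda>\<xi> x. 0)" by (simp add: integral_op_def toeplitz_def fun_eq_iff)
    have "(\<lambda>\<xi> x. 0, \<lambda>\<xi> x. 0) \<in> multiplier_graph M (toeplitz f)"
      using toeplitz_in_graph[OF f(1), of "\<lambda>_. 0"] by (simp add: z)
    moreover have "(\<lambda>\<xi> x. 0, \<lambda>\<xi> x. 0) \<in> topspace (prod_topology (weak_star_topology M) (weak_star_topology M))"
      by (simp add: topspace_weak_star bounded_op_zero)
    ultimately show ?thesis using closure_of_subset_Int by fastforce
  qed
  ultimately have "op_eq M (\<lambda>\<xi> x. 0) (\<lambda>\<xi> x. 0) \<longrightarrow> op_eq M (translation_op x0) (\<lambda>\<xi> x. 0)"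
    using cl unfolding weak_star_closable_def Let_def by fast
  then have "op_eq M (translation_op x0) (\<lambda>\<xi> x. 0)" by (simp add: op_eq_def)
  moreover have "(\<lambda>_. 1) \<in> L2 M" by (intro cont_L2 continuous_intros)
  ultimately have "AE x in M. (1::complex) = 0" unfolding op_eq_def translation_op_def by (rule bspec)
  then have "(\<lambda>x::'g. 1::complex) = (\<lambda>x. 0)" by (intro AE_cont_zero) auto
  then show False by (auto dest: fun_cong)
qed

section \<open>The dual group is discrete\<close>

text \<open>A nontrivial character has mean \<open>0\<close>, so \<open>1 - \<gamma>\<close> has mean \<open>1\<close> and cannot be uniformly smaller.\<close>

lemma character_near_one:
  assumes \<gamma>: "(\<gamma> :: 'g \<Rightarrow> complex) \<in> characters" and r: "r < 1" and near: "\<And>x. norm (1 - \<gamma> x) \<le> r"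
  shows "\<gamma> = (\<lambda>_. 1)"
proof (rule ccontr)
  assume "\<gamma> \<noteq> (\<lambda>_. 1)"
  then have m0: "mean \<gamma> = 0" using mean_character[OF \<gamma>] by simp
  have c: "cont \<gamma>" by (rule characterD(1)[OF \<gamma>])
  have int: "integrable M (\<lambda>x. norm (1 - \<gamma> x))"
    by (intro integrable_norm cont_integrable continuous_intros c)
  have "mean (\<lambda>x. 1 - \<gamma> x) = 1"
    using mean_diff[OF cont_integrable cont_integrable[OF c], of "\<lambda>_. 1"] m0 by (simp add: mean_const)
  then have "(\<integral>x. 1 - \<gamma> x \<partial>M) = vol" using vol_pos by (simp add: mean_def)
  then have "vol = norm (\<integral>x. 1 - \<gamma> x \<partial>M)" using vol_pos by simp
  also have "\<dots> \<le> (\<integral>x. norm (1 - \<gamma> x) \<partial>M)" by (rule integral_norm_bound)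
  also have "\<dots> \<le> (\<integral>x. r \<partial>M)" by (intro integral_mono int near) simp
  also have "\<dots> = vol * r" by (simp add: vol_def)
  finally show False using vol_pos r by simp
qed

text \<open>Cover the range of \<open>\<gamma>\<close> by finitely many discs of radius \<open>1/4\<close>. The compact-open conditions on their
preimages force \<open>h\<close> to be within \<open>3/4\<close> of \<open>\<gamma>\<close> everywhere, so \<open>h\<close> and \<open>\<gamma>\<close> differ by a character near \<open>1\<close>.\<close>

lemma openin_dual_singleton:
  assumes \<gamma>: "(\<gamma> :: 'g \<Rightarrow> complex) \<in> characters"
  shows "openin dual_topology {\<gamma>}"
proof -
  have c: "cont \<gamma>" by (rule characterD(1)[OF \<gamma>])
  have "compact (range \<gamma>)" using c compact_group by (rule compact_continuous_image)
  moreover have "range \<gamma> \<subseteq> (\<Union>z\<in>range \<gamma>. ball z (1/4))" by auto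
  ultimately obtain N where N: "N \<subseteq> range \<gamma>" "finite N" "range \<gamma> \<subseteq> (\<Union>z\<in>N. ball z (1/4))"
    using compactE_image[of "range \<gamma>" "range \<gamma>" "\<lambda>z. ball z (1/4)"] by (metis open_ball)
  define K where "K z = \<gamma> -` cball z (1/4)" for z
  have K: "compact (K z)" for z
  proof -
    have "closed (K z)" unfolding K_def by (intro closed_vimage c) auto
    from compact_Int_closed[OF compact_group this] show ?thesis by simp
  qed
  let ?B = "{{h. h ` K \<subseteq> U} | K U. compact K \<and> open U} :: ('g \<Rightarrow> complex) set set"
  let ?T = "topology_generated_by ?B"
  define V where "V z = {h::'g \<Rightarrow> complex. h ` K z \<subseteq> ball z (1/2)}" for z
  have oV: "openin ?T (V z)" for z
    by (rule topology_generated_by_Basis) (auto simp: V_def intro!: exI[of _ "K z"] exI[of _ "ball z (1/2)"] K)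
  have "N \<noteq> {}" using N(3) by auto
  then have oT: "openin ?T (\<Inter>z\<in>N. V z)" using N(2) oV by (intro openin_INT2) auto
  have "\<gamma> \<in> (\<Inter>z\<in>N. V z)" by (auto simp: V_def K_def)
  moreover have "h = \<gamma>" if h: "h \<in> (\<Inter>z\<in>N. V z)" "h \<in> characters" for h
  proof -
    have d: "norm (h x - \<gamma> x) \<le> 3/4" for x
    proof -
      obtain z where z: "z \<in> N" "\<gamma> x \<in> ball z (1/4)" using N(3) by blast
      then have "x \<in> K z" by (auto simp: K_def)
      then have "h x \<in> ball z (1/2)" using h(1) z(1) unfolding V_def by blast
      then show ?thesis using z(2) dist_triangle[of "h x" "\<gamma> x" z] norm_minus_commute[of "h x" "\<gamma> x"]
        by (simp add: dist_commute dist_norm)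
    qed
    have "(\<lambda>x. h x * cnj (\<gamma> x)) = (\<lambda>_. 1)"
    proof (rule character_near_one[where r = "3/4"])
      show "(\<lambda>x. h x * cnj (\<gamma> x)) \<in> characters" by (intro character_mult character_cnj h \<gamma>)
      fix x
      have "1 - h x * cnj (\<gamma> x) = (\<gamma> x - h x) * cnj (\<gamma> x)"
        using characterD(6)[OF \<gamma>, of x] by (simp add: left_diff_distrib)
      then show "norm (1 - h x * cnj (\<gamma> x)) \<le> 3/4"
        using d[of x] characterD(2)[OF \<gamma>, of x] by (simp add: norm_mult norm_minus_commute)
    qed simp
    then have "h x * cnj (\<gamma> x) = \<gamma> x * cnj (\<gamma> x)" for x using characterD(6)[OF \<gamma>, of x] by (simp add: fun_eq_iff)
    then show ?thesis using characterD(7)[OF \<gamma>] by (auto simp: fun_eq_iff)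
  qed
  ultimately have "{\<gamma>} = (\<Inter>z\<in>N. V z) \<inter> characters" using \<gamma> by blast
  then show ?thesis unfolding dual_topology_def openin_subtopology using oT by blast
qed

lemma dual_topology_discrete: "(dual_topology :: ('g \<Rightarrow> complex) topology) = discrete_topology characters"
proof -
  have sub: "topspace (dual_topology :: ('g \<Rightarrow> complex) topology) \<subseteq> characters" by (simp add: dual_topology_def)
  have "openin dual_topology U \<longleftrightarrow> U \<subseteq> characters" for U :: "('g \<Rightarrow> complex) set"
  proof
    assume "U \<subseteq> characters"
    then have "openin dual_topology (\<Union>\<gamma>\<in>U. {\<gamma>})" by (intro openin_Union) (auto intro!: openin_dual_singleton)
    then show "openin dual_topology U" by simp
  qed (use openin_subset sub in blast)
  then show ?thesis by (simp add: topology_eq)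
qed

lemma inj_dual_mult:
  assumes \<gamma>: "(\<gamma> :: 'g \<Rightarrow> complex) \<in> characters" shows "inj_on (dual_mult \<gamma>) A"
proof (rule inj_onI)
  fix a b assume "dual_mult \<gamma> a = dual_mult \<gamma> b"
  then have "\<gamma> x * a x = \<gamma> x * b x" for x by (simp add: dual_mult_def fun_eq_iff)
  then show "a = b" using characterD(7)[OF \<gamma>] by (auto simp: fun_eq_iff)
qed

lemma haar_measure_dual: "haar_measure dual_topology dual_mult (count_space (characters :: ('g \<Rightarrow> complex) set))"
proof -
  let ?X = "characters :: ('g \<Rightarrow> complex) set"
  let ?\<nu> = "count_space ?X"
  have sig: "sigma_sets ?X (Pow ?X) = Pow ?X"
    using sigma_algebra.sigma_sets_eq[OF sigma_algebra_Pow] .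
  have nz: "emeasure ?\<nu> ?X \<noteq> 0"
    using trivial_character by (auto simp: emeasure_count_space)
  have outer: "emeasure ?\<nu> A = (INF U\<in>{U. U \<subseteq> ?X \<and> A \<subseteq> U}. emeasure ?\<nu> U)" if "A \<subseteq> ?X" for A
  proof (rule antisym)
    show "emeasure ?\<nu> A \<le> (INF U\<in>{U. U \<subseteq> ?X \<and> A \<subseteq> U}. emeasure ?\<nu> U)"
      by (rule INF_greatest) (auto intro!: emeasure_mono)
    show "(INF U\<in>{U. U \<subseteq> ?X \<and> A \<subseteq> U}. emeasure ?\<nu> U) \<le> emeasure ?\<nu> A"
      by (rule INF_lower) (use that in auto)
  qed
  have inner: "emeasure ?\<nu> U = (SUP K\<in>{K. (K \<subseteq> ?X \<and> finite K) \<and> K \<subseteq> U}. emeasure ?\<nu> K)" if U: "U \<subseteq> ?X" for U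
  proof (rule antisym)
    let ?S = "SUP K\<in>{K. (K \<subseteq> ?X \<and> finite K) \<and> K \<subseteq> U}. emeasure ?\<nu> K"
    show "?S \<le> emeasure ?\<nu> U" by (rule SUP_least, rule emeasure_mono) (use U in auto)
    show "emeasure ?\<nu> U \<le> ?S"
    proof (cases "finite U")
      case True
      then show ?thesis by (intro SUP_upper) (use U in auto)
    next
      case False
      have "of_nat n \<le> ?S" for n
      proof -
        obtain K where K: "K \<subseteq> U" "finite K" "card K = n" using infinite_arbitrarily_large[OF False] by blast
        then have "of_nat n = emeasure ?\<nu> K" using U by (simp add: emeasure_count_space_finite)
        also have "\<dots> \<le> ?S" by (rule SUP_upper) (use K U in auto)
        finally show ?thesis .
      qed
      then have "(SUP n. of_nat n :: ennreal) \<le> ?S" by (intro SUP_least) auto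
      then have "?S = top" by (simp only: ennreal_SUP_of_nat_eq_top top_unique)
      then show ?thesis by (simp only: top_greatest)
    qed
  qed
  have inv: "emeasure ?\<nu> (dual_mult a ` A) = emeasure ?\<nu> A" if "a \<in> ?X" "A \<subseteq> ?X" for a A
  proof -
    have "dual_mult a ` A \<subseteq> ?X" using that character_mult by (auto simp: dual_mult_def)
    then show ?thesis using that inj_dual_mult[OF that(1), of A]
      by (simp add: emeasure_count_space finite_image_iff card_image)
  qed
  show ?thesis
    unfolding haar_measure_def dual_topology_discrete topspace_discrete_topology
      openin_discrete_topology compactin_discrete_topology
  proof (intro conjI allI ballI impI)
    show "sets ?\<nu> = sigma_sets ?X {U. U \<subseteq> ?X}" using sig by (simp add: Pow_def)
    show "emeasure ?\<nu> K < \<infinity>" if "K \<subseteq> ?X \<and> finite K" for K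
      using that by (simp add: emeasure_count_space_finite of_nat_less_top)
    show "emeasure ?\<nu> A = (INF U\<in>{U. U \<subseteq> ?X \<and> A \<subseteq> U}. emeasure ?\<nu> U)" if "A \<in> sets ?\<nu>" for A
      by (rule outer) (use that in simp)
    show "emeasure ?\<nu> U = (SUP K\<in>{K. (K \<subseteq> ?X \<and> finite K) \<and> K \<subseteq> U}. emeasure ?\<nu> K)" if "U \<subseteq> ?X" for U
      by (rule inner[OF that])
    show "emeasure ?\<nu> (dual_mult a ` A) = emeasure ?\<nu> A" if "a \<in> ?X" "A \<in> sets ?\<nu>" for a A
      by (rule inv[OF that(1)]) (use that in simp)
  qed (simp_all add: nz)
qed

text \<open>The series is expanded for the conjugate of \<open>f\<close>, because \<open>fourier_transform\<close> integrates against
conjugates of characters.\<close>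

lemma wiener_imp_fourier_algebra:
  assumes "wiener f" shows "f \<in> fourier_algebra"
proof -
  obtain r where "wiener_le r (\<lambda>x. cnj (f x))" using wiener_cnj[OF assms] unfolding wiener_def by blast
  then obtain a where a: "\<And>F. finite F \<Longrightarrow> F \<subseteq> characters \<Longrightarrow> (\<Sum>\<gamma>\<in>F. norm (a \<gamma>)) \<le> r"
    and h: "\<And>x. ((\<lambda>\<gamma>. a \<gamma> * \<gamma> x) has_sum cnj (f x)) characters"
    unfolding wiener_le_def by blast
  have s: "(\<lambda>\<gamma>. norm (a \<gamma>)) summable_on characters"
    using a by (intro nonneg_bdd_above_summable_on) (auto intro!: bdd_aboveI2[where M = r])
  have abs: "Infinite_Set_Sum.abs_summable_on (\<lambda>\<gamma>. cnj (a \<gamma>) * cnj (\<gamma> x)) characters" for x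
    unfolding abs_summable_equivalent[symmetric]
    by (rule summable_on_cong[THEN iffD1, OF _ s]) (auto simp: norm_mult characterD(2))
  have int: "integrable (count_space characters) (\<lambda>\<gamma>. cnj (a \<gamma>))"
    using s abs_summable_equivalent[of "\<lambda>\<gamma>. cnj (a \<gamma>)" characters] by (simp add: abs_summable_on_def)
  have "f x = fourier_transform (count_space characters) (\<lambda>\<gamma>. cnj (a \<gamma>)) x" for x
  proof -
    have "((\<lambda>\<gamma>. cnj (a \<gamma>) * cnj (\<gamma> x)) has_sum f x) characters"
      using has_sum_cnj_iff[THEN iffD2, OF h[of x]] by simp
    then have "f x = infsum (\<lambda>\<gamma>. cnj (a \<gamma>) * cnj (\<gamma> x)) characters" by (simp add: infsumI)
    also have "\<dots> = infsetsum (\<lambda>\<gamma>. cnj (a \<gamma>) * cnj (\<gamma> x)) characters"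
      by (rule infsetsum_infsum[OF abs, symmetric])
    finally show ?thesis by (simp add: infsetsum_def fourier_transform_def)
  qed
  then show ?thesis unfolding fourier_algebra_def using haar_measure_dual int by blast
qed

section \<open>Continuity modulo marginally null sets\<close>

lemma omega_open_if_open:
  assumes "open E" shows "omega_open M E"
proof -
  obtain B :: "'g set set" where B: "countable B" "topological_basis B"
    using ex_countable_basis by blast
  define R where "R = {b \<times> c | b c. b \<in> B \<and> c \<in> B \<and> b \<times> c \<subseteq> E}"
  have "R \<subseteq> (\<lambda>(b, c). b \<times> c) ` (B \<times> B)" by (auto simp: R_def)
  then have "countable R" by (rule countable_subset) (intro countable_image countable_SIGMA B)
  moreover have "R \<subseteq> rectangles M"
  proof
    fix E' assume "E' \<in> R"
    then obtain b c where "E' = b \<times> c" "b \<in> B" "c \<in> B" unfolding R_def by blast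
    then show "E' \<in> rectangles M"
      using topological_basis_open[OF B(2)] unfolding rectangles_def sets_M by (blast intro: borel_open)
  qed
  moreover have "\<Union>R = E"
  proof
    show "E \<subseteq> \<Union>R"
    proof
      fix p assume "p \<in> E"
      obtain x y where p: "p = (x, y)" by (cases p)
      obtain S T where ST: "open S" "open T" "x \<in> S" "y \<in> T" "S \<times> T \<subseteq> E"
      proof (rule open_prod_elim[OF assms \<open>p \<in> E\<close>])
        fix S T :: "'g set" assume "open S" "open T" "p \<in> S \<times> T" "S \<times> T \<subseteq> E"
        then show thesis by (intro that[of S T]) (simp_all add: p)
      qed
      obtain b where b: "b \<in> B" "x \<in> b" "b \<subseteq> S" using topological_basisE[OF B(2) ST(1,3)] .
      obtain c where c: "c \<in> B" "y \<in> c" "c \<subseteq> T" using topological_basisE[OF B(2) ST(2,4)] .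
      have "b \<times> c \<subseteq> E" using Sigma_mono[OF b(3) c(3)] ST(5) by (rule order_trans)
      then have "b \<times> c \<in> R" unfolding R_def using b(1) c(1) by (intro CollectI exI[of _ b] exI[of _ c]) simp
      then show "p \<in> \<Union>R" by (rule UnionI) (simp add: p b(2) c(2))
    qed
  qed (auto simp: R_def)
  moreover have "marginally_null M {}" unfolding marginally_null_def by blast
  ultimately show ?thesis unfolding omega_open_def by (intro exI[of _ R]) simp
qed

lemma omega_continuous_if_cont:
  assumes "cont (g :: 'g \<times> 'g \<Rightarrow> complex)" shows "omega_continuous M g"
  unfolding omega_continuous_def
proof (intro conjI allI impI)
  show "g \<in> borel_measurable (M \<Otimes>\<^sub>M M)" by (rule cont_measurable_pair[OF assms])
  fix U :: "complex set" assume "open U"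
  then have "open (g -` U)" using assms by (rule open_vimage)
  then show "omega_open M (g -` U \<inter> space (M \<Otimes>\<^sub>M M))" by (simp add: omega_open_if_open space_pair_measure)
qed

end

theorem corollary7p9:
  fixes M :: "'g::{topological_ab_group_add, second_countable_topology, t2_space} measure"
    and f :: "'g \<Rightarrow> complex"
    and \<phi> :: "'g \<times> 'g \<Rightarrow> complex"
  assumes "compact (UNIV :: 'g set)"
    and "haar_measure euclidean (+) M"
    and "continuous_on UNIV f"
    and "f \<notin> fourier_algebra"
    and "\<phi> = (\<lambda>(s, t). f (s - t))"
  shows "omega_continuous M \<phi> \<and> \<not> weak_star_closable M \<phi>"
proof -
  interpret compact_haar M using assms(1,2) by unfold_locales
  have \<phi>: "\<phi> = toeplitz f" by (simp add: assms(5) toeplitz_def)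
  have "\<not> wiener f" using assms(4) wiener_imp_fourier_algebra by blast
  then have "\<not> weak_star_closable M \<phi>" unfolding \<phi> by (rule not_weak_star_closable[OF assms(3)])
  moreover have "omega_continuous M \<phi>"
    unfolding \<phi> by (intro omega_continuous_if_cont cont_toeplitz assms(3))
  ultimately show ?thesis by blast
qed

end
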